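(* Let $R$ be a $\lambda$-ring and $x\in R$ a Schur-finite element with bound $(2,1)$. Then $R$ is contained (as a $\lambda$-subring) in a $\lambda$-ring $R'$ in which there are line elements $\ell_1,\ell_2,\ell_3$ with $x=\ell_1+\ell_2-\ell_3$.
   Context: $\lambda$-rings are special $\lambda$-rings. A line element is an element $\ell$ with $\lambda^n(\ell)=0$ for all $n>1$. For $x\in R$ and a partition $\pi$, $s_\pi(x)=u_x(s_\pi)$ where $u_x$ is the $\lambda$-ring map from the ring of symmetric functions $\Lambda$ to $R$ with $e_1\mapsto x$, $s_\pi$ being the Schur function. $x$ is Schur-finite with bound $\lambda$ if $s_\pi(x)=0$ for every partition $\pi$ whose Young diagram contains that of $\lambda$; bound $(2,1)$ means $s_\pi(x)=0$ for all $\pi$ with $\pi_1\ge2$ and at least two rows. *)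

theory Defs
  imports "HOL-Algebra.Ring" "HOL-Combinatorics.Permutations"
begin

text \<open>A polynomial with integer coefficients in variables of type 'v is represented
  as a list of pairs (coefficient, exponent vector).  Evaluation is relative to a
  finite set V of variables (exponents of variables outside V are ignored).\<close>

type_synonym 'v ipoly = "(int \<times> ('v \<Rightarrow> nat)) list"

definition ieval :: "'v set \<Rightarrow> 'v ipoly \<Rightarrow> ('v \<Rightarrow> int) \<Rightarrow> int" where
  "ieval V Q a = (\<Sum>i<length Q. fst (Q ! i) * (\<Prod>v\<in>V. a v ^ snd (Q ! i) v))"

definition reval :: "('a, 'm) ring_scheme \<Rightarrow> 'v set \<Rightarrow> 'v ipoly \<Rightarrow> ('v \<Rightarrow> 'a) \<Rightarrow> 'a" where
  "reval R V Q a = (\<Oplus>\<^bsub>R\<^esub> i\<in>{..<length Q}.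
      [fst (Q ! i)] \<cdot>\<^bsub>R\<^esub> (\<Otimes>\<^bsub>R\<^esub> v\<in>V. a v [^]\<^bsub>R\<^esub> snd (Q ! i) v))"

definition esym :: "nat \<Rightarrow> 'i set \<Rightarrow> ('i \<Rightarrow> int) \<Rightarrow> int" where
  "esym k I f = (\<Sum>T\<in>{T. T \<subseteq> I \<and> card T = k}. \<Prod>t\<in>T. f t)"

text \<open>Q is the universal polynomial P_n(a_1..a_n; b_1..b_n) with
  e_n(x_i y_j) = P_n(e_1(x)..e_n(x); e_1(y)..e_n(y)) (x, y: n variables each).
  Variables: (False,k) stands for e_k(x), (True,k) for e_k(y), 1 \<le> k \<le> n.
  The identity of integer polynomials is expressed by requiring it at all integer
  points (equivalent, since Z is infinite); by algebraic independence of the e_k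
  such a Q is unique as a polynomial, and it exists by the fundamental theorem
  on symmetric polynomials.\<close>

definition is_Pprod :: "nat \<Rightarrow> (bool \<times> nat) ipoly \<Rightarrow> bool" where
  "is_Pprod n Q \<longleftrightarrow> (\<forall>a b :: nat \<Rightarrow> int.
     ieval (UNIV \<times> {1..n}) Q
       (\<lambda>(s, k). if s then esym k {..<n} b else esym k {..<n} a)
     = esym n ({..<n} \<times> {..<n}) (\<lambda>(i, j). a i * b j))"

definition is_Pcomp :: "nat \<Rightarrow> nat \<Rightarrow> nat ipoly \<Rightarrow> bool" where
  "is_Pcomp m n Q \<longleftrightarrow> (\<forall>a :: nat \<Rightarrow> int.
     ieval {1..m*n} Q (\<lambda>k. esym k {..<m*n} a)
     = esym m {S. S \<subseteq> {..<m*n} \<and> card S = n} (\<lambda>S. \<Prod>i\<in>S. a i))"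

definition lambda_ring :: "('a, 'm) ring_scheme \<Rightarrow> (nat \<Rightarrow> 'a \<Rightarrow> 'a) \<Rightarrow> bool" where
  "lambda_ring R lam \<longleftrightarrow> cring R \<and>
    (\<forall>n. \<forall>x\<in>carrier R. lam n x \<in> carrier R) \<and>
    (\<forall>x\<in>carrier R. lam 0 x = \<one>\<^bsub>R\<^esub> \<and> lam 1 x = x) \<and>
    (\<forall>n. \<forall>x\<in>carrier R. \<forall>y\<in>carrier R.
        lam n (x \<oplus>\<^bsub>R\<^esub> y) = (\<Oplus>\<^bsub>R\<^esub> i\<in>{..n}. lam i x \<otimes>\<^bsub>R\<^esub> lam (n - i) y)) \<and>
    (\<forall>n>1. lam n \<one>\<^bsub>R\<^esub> = \<zero>\<^bsub>R\<^esub>) \<and>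
    (\<forall>n Q. is_Pprod n Q \<longrightarrow> (\<forall>x\<in>carrier R. \<forall>y\<in>carrier R.
        lam n (x \<otimes>\<^bsub>R\<^esub> y) = reval R (UNIV \<times> {1..n}) Q
                                 (\<lambda>(s, k). if s then lam k y else lam k x))) \<and>
    (\<forall>m n Q. is_Pcomp m n Q \<longrightarrow> (\<forall>x\<in>carrier R.
        lam m (lam n x) = reval R {1..m*n} Q (\<lambda>k. lam k x)))"

definition lambda_hom ::
  "('a, 'm) ring_scheme \<Rightarrow> (nat \<Rightarrow> 'a \<Rightarrow> 'a) \<Rightarrow> ('b, 'n) ring_scheme \<Rightarrow> (nat \<Rightarrow> 'b \<Rightarrow> 'b)
     \<Rightarrow> ('a \<Rightarrow> 'b) \<Rightarrow> bool" where
  "lambda_hom R lam S mu f \<longleftrightarrow> f \<in> ring_hom R S \<and>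
     (\<forall>n. \<forall>x\<in>carrier R. f (lam n x) = mu n (f x))"

definition line_element :: "('a, 'm) ring_scheme \<Rightarrow> (nat \<Rightarrow> 'a \<Rightarrow> 'a) \<Rightarrow> 'a \<Rightarrow> bool" where
  "line_element R lam l \<longleftrightarrow> l \<in> carrier R \<and> (\<forall>n>1. lam n l = \<zero>\<^bsub>R\<^esub>)"

definition is_partition :: "nat list \<Rightarrow> bool" where
  "is_partition p \<longleftrightarrow> sorted_wrt (\<ge>) p \<and> (\<forall>k\<in>set p. 0 < k)"

definition diagram_contains :: "nat list \<Rightarrow> nat list \<Rightarrow> bool" where
  "diagram_contains p q \<longleftrightarrow> length q \<le> length p \<and> (\<forall>i<length q. q ! i \<le> p ! i)"

definition conj_part :: "nat list \<Rightarrow> nat \<Rightarrow> nat" where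
  "conj_part p j = card {i. i < length p \<and> j < p ! i}"

definition conj_length :: "nat list \<Rightarrow> nat" where
  "conj_length p = (if p = [] then 0 else hd p)"

definition lamz :: "('a, 'm) ring_scheme \<Rightarrow> (nat \<Rightarrow> 'a \<Rightarrow> 'a) \<Rightarrow> int \<Rightarrow> 'a \<Rightarrow> 'a" where
  "lamz R lam k x = (if k < 0 then \<zero>\<^bsub>R\<^esub> else lam (nat k) x)"

text \<open>s_p(x) = u_x(s_p), computed via the dual Jacobi-Trudi identity
  s_p = det(e_{p'_i - i + j}) and u_x(e_k) = lambda^k(x); the determinant is the
  Leibniz expansion.\<close>
definition schur :: "('a, 'm) ring_scheme \<Rightarrow> (nat \<Rightarrow> 'a \<Rightarrow> 'a) \<Rightarrow> nat list \<Rightarrow> 'a \<Rightarrow> 'a" where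
  "schur R lam p x = (let k = conj_length p in
     (\<Oplus>\<^bsub>R\<^esub> s\<in>{s. s permutes {..<k}}.
        [sign s] \<cdot>\<^bsub>R\<^esub> (\<Otimes>\<^bsub>R\<^esub> i\<in>{..<k}.
          lamz R lam (int (conj_part p i) - int i + int (s i)) x)))"

definition schur_finite :: "('a, 'm) ring_scheme \<Rightarrow> (nat \<Rightarrow> 'a \<Rightarrow> 'a) \<Rightarrow> nat list \<Rightarrow> 'a \<Rightarrow> bool" where
  "schur_finite R lam b x \<longleftrightarrow>
     (\<forall>p. is_partition p \<and> diagram_contains p b \<longrightarrow> schur R lam p x = \<zero>\<^bsub>R\<^esub>)"

end

theory Submission
  imports Defs "HOL-Algebra.UnivPoly" "HOL-Algebra.Weak_Morphisms"
    "HOL-Computational_Algebra.Polynomial" "HOL-Computational_Algebra.Formal_Power_Series"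
    "HOL-Library.Nat_Bijection"
begin

text \<open>In \<open>R[\<ell>, z]\<close>, with \<open>\<ell>\<close> and \<open>z\<close> line elements, put \<open>w = x + \<ell> - z\<close> and let \<open>J\<close> be the
  ideal generated by the \<open>\<lambda>\<^sup>k(w)\<close>, \<open>k \<ge> 2\<close>.  It is a \<open>\<lambda>\<close>-ideal, since \<open>\<lambda>\<^sup>j(\<lambda>\<^sup>k(w))\<close>,
  \<open>j \<ge> 1\<close>, is a universal polynomial in the \<open>\<lambda>\<^sup>i(w)\<close> that vanishes when all \<open>\<lambda>\<^sup>i(w)\<close> with
  \<open>i \<ge> 2\<close> do.  Hence \<open>x = z + w - \<ell>\<close> is of the required form in the quotient by \<open>J\<close>.
  The hypothesis on \<open>x\<close> makes \<open>R\<close> embed into this quotient: it gives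
  \<open>\<lambda>\<^sup>n(x) = x \<lambda>\<^sup>n\<^sup>-\<^sup>1(x)\<close> for \<open>n \<ge> 3\<close>, so the ring homomorphism over \<open>R\<close> from \<open>R[\<ell>, z]\<close> to
  \<open>R[\<surd>c]\<close>, \<open>c = x\<^sup>2 - \<lambda>\<^sup>2(x)\<close>, that sends \<open>\<ell>\<close> to \<open>-x\<close> and \<open>z\<close> to \<open>\<surd>c\<close> maps
  the series \<open>\<Sum> \<lambda>\<^sup>k(w) t\<^sup>k\<close> to \<open>(1 - c t\<^sup>2) / (1 + \<surd>c t) = 1 - \<surd>c t\<close> and kills \<open>J\<close>.

  That \<open>R[\<ell>, z]\<close> is a \<open>\<lambda>\<close>-ring follows from identities between the universal polynomials.
  These hold at the points whose coordinates are elementary symmetric functions of integers,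
  therefore, by algebraic independence, as identities of polynomials, therefore in every ring.\<close>

section \<open>Integer polynomial functions\<close>

text \<open>The substitution is dictated by what the ideal demands:
  \<open>\<lambda>_t(x) (1 + \<ell> t) = (1 + z t) (1 + w t)\<close>. The relation for n \<ge> 3 is
  a recursion with ratio x, so the factor \<open>1 - x t\<close> cuts the series of x down to
  \<open>1 - c t^2\<close>; having no linear term, this splits as soon as c has a square root. An
  element of R that lies in the ideal is sent both to 0 and to itself, hence is 0. Three obstacles
  shape the rest. R may have torsion, so identities cannot be established by evaluation within R; an
  integer function and its counterpart in R are therefore built in parallel. The axioms quantify
  over every list that represents a universal polynomial, and such lists are tested at integer
  points only: using the axioms takes existence of these polynomials, proving them takes uniqueness.
  Finally, the extension needs a type that can be named; a polynomial in two variables has finitely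
  many coefficients, so lists over R are large enough to name the elements of the quotient.\<close>

text \<open>\<open>F\<close> and \<open>G\<close> are the evaluations in the integers and in \<open>R\<close> of the same polynomial with
  integer coefficients in the variables \<open>V\<close>, of weight at most \<open>d\<close>.  Nothing is said about
  \<open>G\<close> at points outside the carrier.\<close>

inductive pfun :: "('a, 'm) ring_scheme \<Rightarrow> ('v \<Rightarrow> nat) \<Rightarrow> 'v set \<Rightarrow> nat
    \<Rightarrow> (('v \<Rightarrow> int) \<Rightarrow> int) \<Rightarrow> (('v \<Rightarrow> 'a) \<Rightarrow> 'a) \<Rightarrow> bool"
  for R :: "('a, 'm) ring_scheme" and wt :: "'v \<Rightarrow> nat" and V :: "'v set" where
  const: "(\<And>a. \<forall>v\<in>V. a v \<in> carrier R \<Longrightarrow> G a = [c] \<cdot>\<^bsub>R\<^esub> \<one>\<^bsub>R\<^esub>) \<Longrightarrow> pfun R wt V d (\<lambda>a. c) G"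
| var: "v \<in> V \<Longrightarrow> wt v \<le> d \<Longrightarrow> (\<And>a. \<forall>v\<in>V. a v \<in> carrier R \<Longrightarrow> G a = a v)
    \<Longrightarrow> pfun R wt V d (\<lambda>a. a v) G"
| add: "pfun R wt V d F G \<Longrightarrow> pfun R wt V d F' G' \<Longrightarrow>
    (\<And>a. \<forall>v\<in>V. a v \<in> carrier R \<Longrightarrow> H a = G a \<oplus>\<^bsub>R\<^esub> G' a) \<Longrightarrow> pfun R wt V d (\<lambda>a. F a + F' a) H"
| mult: "pfun R wt V d1 F G \<Longrightarrow> pfun R wt V d2 F' G' \<Longrightarrow> d1 + d2 \<le> d \<Longrightarrow>
    (\<And>a. \<forall>v\<in>V. a v \<in> carrier R \<Longrightarrow> H a = G a \<otimes>\<^bsub>R\<^esub> G' a) \<Longrightarrow> pfun R wt V d (\<lambda>a. F a * F' a) H"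

section \<open>Change of weights and variables; vanishing of integer polynomial functions\<close>

lemma pfun_cong:
  assumes "pfun R wt V d F G" "\<And>a. F' a = F a" "\<And>a. \<forall>v\<in>V. a v \<in> carrier R \<Longrightarrow> G' a = G a"
  shows "pfun R wt V d F' G'"
proof -
  have [simp]: "F' = F" using assms(2) by auto
  show ?thesis unfolding \<open>F' = F\<close> using assms(1,3)
  proof (induction arbitrary: G' rule: pfun.induct)
    case const then show ?case by (auto intro: pfun.const)
  next
    case var then show ?case by (auto intro: pfun.var)
  next
    case (add d F G F' G' H)
    show ?case by (rule pfun.add[OF add.hyps(1,2)]) (use add in auto)
  next
    case (mult d1 F G d2 F' G' d H)
    show ?case by (rule pfun.mult[OF mult.hyps(1,2)]) (use mult in auto)
  qed
qed

lemma pfun_mono: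
  assumes "pfun R wt V d F G" "V \<subseteq> V'" "d \<le> d'"
  shows "pfun R wt V' d' F G"
  using assms(1,3)
proof (induction arbitrary: d' rule: pfun.induct)
  case const then show ?case using assms(2) by (intro pfun.const) auto
next
  case var then show ?case using assms(2) by (intro pfun.var) auto
next
  case (add d F G F' G' H)
  show ?case by (rule pfun.add[OF add.IH(1,2)[OF add.prems]]) (use add.hyps(3) assms(2) in blast)
next
  case (mult d1 F G d2 F' G' d H)
  show ?case by (rule pfun.mult[OF mult.IH(1)[OF order_refl] mult.IH(2)[OF order_refl]]) (use mult.hyps(3,4) mult.prems assms(2) in \<open>simp, blast\<close>)
qed

lemma pfun_wt_cong:
  assumes "pfun R wt V d F G" "\<And>v. v \<in> V \<Longrightarrow> wt v = wt' v"
  shows "pfun R wt' V d F G"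
  using assms(1)
proof (induction rule: pfun.induct)
  case const then show ?case by (intro pfun.const) auto
next
  case var then show ?case using assms(2) by (intro pfun.var) auto
next
  case (add d F G F' G' H)
  show ?case by (rule pfun.add[OF add.IH]) (use add in auto)
next
  case (mult d1 F G d2 F' G' d H)
  show ?case by (rule pfun.mult[OF mult.IH]) (use mult in auto)
qed

text \<open>Zero weights make the bound vacuous, which is the form for statements that only concern
  being a polynomial.\<close>

lemma pfun_unweighted: "pfun R wt V d F G \<Longrightarrow> pfun R (\<lambda>_. 0) V 0 F G"
proof (induction rule: pfun.induct)
  case const then show ?case by (intro pfun.const) auto
next
  case var then show ?case by (intro pfun.var) auto
next
  case (add d F G F' G' H)
  show ?case by (rule pfun.add[OF add.IH]) (use add in auto)
next
  case (mult d1 F G d2 F' G' d H)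
  show ?case by (rule pfun.mult[OF mult.IH]) (use mult in auto)
qed

text \<open>The given weights may be 0 and then cannot drive an induction; the ordinary degree can,
  since it drops when a variable is divided out.\<close>

lemma pfun_degree: "pfun R wt V d F G \<Longrightarrow> \<exists>d'. pfun R (\<lambda>_. 1) V d' F G"
proof (induction rule: pfun.induct)
  case (const G c d)
  then have "pfun R (\<lambda>_. 1) V d (\<lambda>a. c) G" by (rule pfun.const)
  then show ?case by blast
next
  case (var v d G)
  have "pfun R (\<lambda>_. 1) V 1 (\<lambda>a. a v) G" by (rule pfun.var) (use var in auto)
  then show ?case by blast
next
  case (add d F G F' G' H)
  then obtain d1 d2 where *: "pfun R (\<lambda>_. 1) V d1 F G" "pfun R (\<lambda>_. 1) V d2 F' G'" by blast
  have "pfun R (\<lambda>_. 1) V (d1 + d2) (\<lambda>a. F a + F' a) H"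
    by (rule pfun.add[OF pfun_mono[OF *(1)] pfun_mono[OF *(2)]]) (use add in auto)
  then show ?case by blast
next
  case (mult d1 F G d2 F' G' d H)
  then obtain e1 e2 where *: "pfun R (\<lambda>_. 1) V e1 F G" "pfun R (\<lambda>_. 1) V e2 F' G'" by blast
  have "pfun R (\<lambda>_. 1) V (e1 + e2) (\<lambda>a. F a * F' a) H"
    by (rule pfun.mult[OF *]) (use mult in auto)
  then show ?case by blast
qed

lemma pfun_agree: "pfun R wt V d F G \<Longrightarrow> (\<And>v. v \<in> V \<Longrightarrow> a v = b v) \<Longrightarrow> F a = F b"
  by (induction rule: pfun.induct) auto

lemma pfun_univariate: "pfun R wt V d F G \<Longrightarrow> \<exists>p. \<forall>t. F (a(v := t)) = poly p t"
proof (induction rule: pfun.induct)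
  case (const G c d)
  show ?case by (rule exI[of _ "[:c:]"]) simp
next
  case (var u d G)
  show ?case
  proof (cases "u = v")
    case True then show ?thesis by (intro exI[of _ "[:0, 1:]"]) simp
  next
    case False then show ?thesis by (intro exI[of _ "[:a u:]"]) simp
  qed
next
  case (add d F G F' G' H)
  then show ?case by (metis poly_add)
next
  case (mult d1 F G d2 F' G' d H)
  then show ?case by (metis poly_mult)
qed

text \<open>Along a coordinate in \<open>X\<close> the function is a polynomial in one variable with
  every non-zero integer as a root. Later uses cancel products of variables, which is possible only
  where these are non-zero.\<close>

lemma pfun_density:
  assumes "pfun R wt V d F G" "finite X" "\<And>a. (\<forall>v\<in>X. a v \<noteq> 0) \<Longrightarrow> F a = 0"
  shows "F a = 0"
  using assms(2,3)
proof (induction X arbitrary: a rule: finite_induct)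
  case empty then show ?case by simp
next
  case (insert v X)
  have "F a = 0" if a: "\<forall>u\<in>X. a u \<noteq> 0" for a
  proof -
    obtain p where p: "\<And>t. F (a(v := t)) = poly p t"
      using pfun_univariate[OF assms(1)] by metis
    have "poly p t = 0" if "t \<noteq> 0" for t
    proof -
      have "F (a(v := t)) = 0" by (rule insert.prems) (use a that insert.hyps in auto)
      then show ?thesis by (simp add: p)
    qed
    then have "- {0} \<subseteq> {t. poly p t = 0}" by auto
    moreover have "infinite (- {0::int})" by (simp add: infinite_UNIV_char_0)
    ultimately have "p = 0" using poly_roots_finite finite_subset by metis
    then show ?thesis using p[of "a v"] by simp
  qed
  then show ?case by (rule insert.IH)
qed

section \<open>Closure under ring operations and substitution\<close>

context cring
begin

lemma pfun_closed: "pfun R wt V d F G \<Longrightarrow> \<forall>v\<in>V. a v \<in> carrier R \<Longrightarrow> G a \<in> carrier R"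
  by (induction rule: pfun.induct) auto

lemma pfun_zero: "pfun R wt V d (\<lambda>a. 0) (\<lambda>a. \<zero>)"
  by (rule pfun.const) (simp add: add_pow_def)

lemma pfun_one: "pfun R wt V d (\<lambda>a. 1) (\<lambda>a. \<one>)"
  by (rule pfun.const) (simp add: add.int_pow_1)

lemma pfun_minus:
  assumes "pfun R wt V d F G" shows "pfun R wt V d (\<lambda>a. - F a) (\<lambda>a. \<ominus> G a)"
proof -
  have "pfun R wt V 0 (\<lambda>a. -1) (\<lambda>a. \<ominus> \<one>)"
    by (rule pfun.const) (simp add: add.int_pow_neg add.int_pow_1)
  then have "pfun R wt V d (\<lambda>a. (-1) * F a) (\<lambda>a. \<ominus> G a)"
    by (rule pfun.mult[OF _ assms]) (auto simp: l_minus pfun_closed[OF assms])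
  then show ?thesis by simp
qed

lemma pfun_diff:
  assumes "pfun R wt V d F G" "pfun R wt V d F' G'"
  shows "pfun R wt V d (\<lambda>a. F a - F' a) (\<lambda>a. G a \<ominus> G' a)"
  using pfun.add[OF assms(1) pfun_minus[OF assms(2)]] by (simp add: minus_eq)

lemma pfun_sum:
  assumes "finite I" "\<And>i. i \<in> I \<Longrightarrow> pfun R wt V d (F i) (G i)"
  shows "pfun R wt V d (\<lambda>a. \<Sum>i\<in>I. F i a) (\<lambda>a. \<Oplus>i\<in>I. G i a)"
  using assms
proof (induction I rule: finite_induct)
  case empty then show ?case by (simp add: pfun_zero)
next
  case (insert i I)
  have *: "pfun R wt V d (\<lambda>a. F i a + (\<Sum>i\<in>I. F i a)) (\<lambda>a. \<Oplus>i\<in>insert i I. G i a)"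
    by (rule pfun.add[of _ _ _ _ _ "G i" _ "\<lambda>a. \<Oplus>i\<in>I. G i a"])
      (use insert in \<open>auto intro!: finsum_insert pfun_closed[OF insert.prems]\<close>)
  show ?case using insert.hyps * by simp
qed

lemma pfun_prod:
  assumes "finite I" "\<And>i. i \<in> I \<Longrightarrow> pfun R wt V (e i) (F i) (G i)" "(\<Sum>i\<in>I. e i) \<le> d"
  shows "pfun R wt V d (\<lambda>a. \<Prod>i\<in>I. F i a) (\<lambda>a. \<Otimes>i\<in>I. G i a)"
  using assms
proof (induction I arbitrary: d rule: finite_induct)
  case empty then show ?case by (simp add: pfun_one)
next
  case (insert i I)
  have "pfun R wt V (\<Sum>i\<in>I. e i) (\<lambda>a. \<Prod>i\<in>I. F i a) (\<lambda>a. \<Otimes>i\<in>I. G i a)"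
    by (rule insert.IH) (use insert in auto)
  then have *: "pfun R wt V d (\<lambda>a. F i a * (\<Prod>i\<in>I. F i a)) (\<lambda>a. \<Otimes>i\<in>insert i I. G i a)"
    by (rule pfun.mult[of _ _ _ "e i" _ "G i", rotated])
      (use insert in \<open>auto intro!: finprod_insert pfun_closed[OF insert.prems(1)]\<close>)
  show ?case using insert.hyps * by simp
qed

lemma pfun_power:
  assumes "pfun R wt V e F G" "e * n \<le> d"
  shows "pfun R wt V d (\<lambda>a. F a ^ n) (\<lambda>a. G a [^] n)"
  using assms(2)
proof (induction n arbitrary: d)
  case 0 then show ?case by (simp add: pfun_one)
next
  case (Suc n)
  have "pfun R wt V d (\<lambda>a. F a ^ n * F a) (\<lambda>a. G a [^] Suc n)"
    by (rule pfun.mult[OF Suc.IH[OF order_refl] assms(1)]) (use Suc.prems in auto)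
  then show ?case by (simp add: mult.commute)
qed

lemma pfun_compose:
  assumes "pfun R wt V d F G" "\<And>v. v \<in> V \<Longrightarrow> pfun R wt' V' (wt v) (P v) (Q v)"
  shows "pfun R wt' V' d (\<lambda>a. F (\<lambda>v. P v a)) (\<lambda>a. G (\<lambda>v. Q v a))"
  using assms(1)
proof (induction rule: pfun.induct)
  case (const G c d)
  then show ?case by (intro pfun.const const) (use assms(2) pfun_closed in blast)
next
  case (var v d G)
  show ?case by (rule pfun_cong[OF pfun_mono[OF assms(2)[OF var(1)] order_refl var(2)]])
      (auto intro!: var(3) pfun_closed[OF assms(2)])
next
  case (add d F G F' G' H)
  show ?case by (rule pfun.add[OF add.IH]) (auto intro!: add.hyps(3) pfun_closed[OF assms(2)])
next
  case (mult d1 F G d2 F' G' d H)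
  show ?case by (rule pfun.mult[OF mult.IH]) (auto intro!: mult.hyps(3,4) pfun_closed[OF assms(2)])
qed

section \<open>Splitting off a variable; transfer of identities from the integers\<close>

lemma pfun_set_zero:
  assumes "pfun R wt V d F G"
  shows "pfun R wt (V - {v}) d (\<lambda>a. F (a(v := 0))) (\<lambda>a. G (a(v := \<zero>)))"
proof -
  have "pfun R wt (V - {v}) d (\<lambda>a. F (\<lambda>u. if u = v then 0 else a u)) (\<lambda>a. G (\<lambda>u. if u = v then \<zero> else a u))"
  proof (rule pfun_compose[OF assms])
    fix u assume "u \<in> V"
    then show "pfun R wt (V - {v}) (wt u) (\<lambda>a. if u = v then 0 else a u) (\<lambda>a. if u = v then \<zero> else a u)"
      by (cases "u = v") (auto intro: pfun_zero pfun.var)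
  qed
  then show ?thesis by (simp add: fun_upd_def)
qed

text \<open>The alternative in the second claim is forced by truncated subtraction: if
  \<open>wt v\<close> exceeds \<open>d\<close>, no multiple of the variable can occur, and
  \<open>d - wt v\<close> would misstate the bound. The last claim speaks of
  \<open>insert v V\<close> since \<open>v\<close> may lie outside \<open>V\<close>.\<close>

lemma pfun_divide:
  assumes "pfun R wt V d F G"
  obtains F0 G0 F1 G1 where "pfun R wt (V - {v}) d F0 G0"
    "F1 = (\<lambda>a. 0) \<and> G1 = (\<lambda>a. \<zero>) \<or> wt v \<le> d \<and> pfun R wt V (d - wt v) F1 G1"
    "\<And>a. F a = F0 a + a v * F1 a"
    "\<And>a. \<forall>u\<in>insert v V. a u \<in> carrier R \<Longrightarrow> G a = G0 a \<oplus> a v \<otimes> G1 a"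
proof -
  have "\<exists>F0 G0 F1 G1. pfun R wt (V - {v}) d F0 G0 \<and>
    (F1 = (\<lambda>a. 0) \<and> G1 = (\<lambda>a. \<zero>) \<or> wt v \<le> d \<and> pfun R wt V (d - wt v) F1 G1) \<and>
    (\<forall>a. F a = F0 a + a v * F1 a) \<and>
    (\<forall>a. (\<forall>u\<in>insert v V. a u \<in> carrier R) \<longrightarrow> G a = G0 a \<oplus> a v \<otimes> G1 a)"
    using assms
  proof (induction rule: pfun.induct)
    case (const G c d)
    show ?case
      by (rule exI[of _ "\<lambda>a. c"], rule exI[of _ "\<lambda>a. [c] \<cdot> \<one>"], rule exI[of _ "\<lambda>a. 0"], rule exI[of _ "\<lambda>a. \<zero>"])
        (use const in \<open>auto intro: pfun.const\<close>)
  next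
    case (var u d G)
    show ?case
    proof (cases "u = v")
      case True
      show ?thesis
        by (rule exI[of _ "\<lambda>a. 0"], rule exI[of _ "\<lambda>a. \<zero>"], rule exI[of _ "\<lambda>a. 1"], rule exI[of _ "\<lambda>a. \<one>"])
          (use var True in \<open>auto intro: pfun_zero pfun_one\<close>)
    next
      case False
      show ?thesis
        by (rule exI[of _ "\<lambda>a. a u"], rule exI[of _ "\<lambda>a. a u"], rule exI[of _ "\<lambda>a. 0"], rule exI[of _ "\<lambda>a. \<zero>"])
          (use var False in \<open>auto intro: pfun.var\<close>)
    qed
  next
    case (add d F G F' G' H)
    obtain F0 G0 F1 G1 where A: "pfun R wt (V - {v}) d F0 G0"
      "F1 = (\<lambda>a. 0) \<and> G1 = (\<lambda>a. \<zero>) \<or> wt v \<le> d \<and> pfun R wt V (d - wt v) F1 G1"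
      "\<And>a. F a = F0 a + a v * F1 a"
      "\<And>a. (\<forall>u\<in>insert v V. a u \<in> carrier R) \<Longrightarrow> G a = G0 a \<oplus> a v \<otimes> G1 a" using add.IH(1) by blast
    obtain F0' G0' F1' G1' where B: "pfun R wt (V - {v}) d F0' G0'"
      "F1' = (\<lambda>a. 0) \<and> G1' = (\<lambda>a. \<zero>) \<or> wt v \<le> d \<and> pfun R wt V (d - wt v) F1' G1'"
      "\<And>a. F' a = F0' a + a v * F1' a"
      "\<And>a. (\<forall>u\<in>insert v V. a u \<in> carrier R) \<Longrightarrow> G' a = G0' a \<oplus> a v \<otimes> G1' a" using add.IH(2) by blast
    have p1: "pfun R wt V (d - wt v) F1 G1" and p1': "pfun R wt V (d - wt v) F1' G1'"
      using A(2) B(2) pfun_zero by auto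
    have c: "G0 a \<in> carrier R" "G0' a \<in> carrier R" "G1 a \<in> carrier R" "G1' a \<in> carrier R"
      if "\<forall>u\<in>insert v V. a u \<in> carrier R" for a
      using that pfun_closed[OF A(1)] pfun_closed[OF B(1)] pfun_closed[OF p1] pfun_closed[OF p1'] by auto
    show ?case
    proof (rule exI[of _ "\<lambda>a. F0 a + F0' a"], rule exI[of _ "\<lambda>a. G0 a \<oplus> G0' a"],
        rule exI[of _ "\<lambda>a. F1 a + F1' a"], rule exI[of _ "\<lambda>a. G1 a \<oplus> G1' a"], intro conjI allI impI)
      show "pfun R wt (V - {v}) d (\<lambda>a. F0 a + F0' a) (\<lambda>a. G0 a \<oplus> G0' a)"
        by (rule pfun.add[OF A(1) B(1)]) simp
      show "(\<lambda>a. F1 a + F1' a) = (\<lambda>a. 0) \<and> (\<lambda>a. G1 a \<oplus> G1' a) = (\<lambda>a. \<zero>) \<or>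
        wt v \<le> d \<and> pfun R wt V (d - wt v) (\<lambda>a. F1 a + F1' a) (\<lambda>a. G1 a \<oplus> G1' a)"
        using A(2) B(2) pfun.add[OF p1 p1', of "\<lambda>a. G1 a \<oplus> G1' a"] by auto
      show "F a + F' a = F0 a + F0' a + a v * (F1 a + F1' a)" for a
        by (simp add: A(3) B(3) algebra_simps)
      show "H a = G0 a \<oplus> G0' a \<oplus> a v \<otimes> (G1 a \<oplus> G1' a)" if a: "\<forall>u\<in>insert v V. a u \<in> carrier R" for a
      proof -
        have "a v \<in> carrier R" using a by simp
        then show ?thesis using a add.hyps(3)[of a] c[OF a] A(4)[OF a] B(4)[OF a]
          by (simp add: r_distr a_ac)
      qed
    qed
  next
    case (mult d1 F G d2 F' G' d H)
    obtain F0 G0 F1 G1 where A: "pfun R wt (V - {v}) d1 F0 G0"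
      "F1 = (\<lambda>a. 0) \<and> G1 = (\<lambda>a. \<zero>) \<or> wt v \<le> d1 \<and> pfun R wt V (d1 - wt v) F1 G1"
      "\<And>a. F a = F0 a + a v * F1 a"
      "\<And>a. (\<forall>u\<in>insert v V. a u \<in> carrier R) \<Longrightarrow> G a = G0 a \<oplus> a v \<otimes> G1 a" using mult.IH(1) by blast
    obtain F0' G0' F1' G1' where B: "pfun R wt (V - {v}) d2 F0' G0'"
      "F1' = (\<lambda>a. 0) \<and> G1' = (\<lambda>a. \<zero>) \<or> wt v \<le> d2 \<and> pfun R wt V (d2 - wt v) F1' G1'"
      "\<And>a. F' a = F0' a + a v * F1' a"
      "\<And>a. (\<forall>u\<in>insert v V. a u \<in> carrier R) \<Longrightarrow> G' a = G0' a \<oplus> a v \<otimes> G1' a" using mult.IH(2) by blast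
    have p1: "pfun R wt V (d1 - wt v) F1 G1" and p1': "pfun R wt V (d2 - wt v) F1' G1'"
      using A(2) B(2) pfun_zero by auto
    have c: "G0 a \<in> carrier R" "G0' a \<in> carrier R" "G1 a \<in> carrier R" "G1' a \<in> carrier R" "G' a \<in> carrier R"
      if "\<forall>u\<in>insert v V. a u \<in> carrier R" for a
      using that pfun_closed[OF A(1)] pfun_closed[OF B(1)] pfun_closed[OF p1] pfun_closed[OF p1']
        pfun_closed[OF mult.hyps(2)] by auto
    define G0x where "G0x = (\<lambda>a. if \<forall>u\<in>V. a u \<in> carrier R then G0 a else \<zero>)"
    \<comment> \<open>The case distinction makes the quotient literally the zero function:
      \<open>G'\<close> is unrestricted outside the carrier, so a product with the factor \<zero>
      may fail to be \<zero> there.\<close>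
    define G1x where "G1x = (\<lambda>a. if F1 = (\<lambda>a. 0) \<and> G1 = (\<lambda>a. \<zero>) then \<zero> else G1 a \<otimes> G' a)"
    define G2x where "G2x = (\<lambda>a. if F1' = (\<lambda>a. 0) \<and> G1' = (\<lambda>a. \<zero>) then \<zero> else G0 a \<otimes> G1' a)"
    have A0: "pfun R wt V d1 F0 G0" by (rule pfun_mono[OF A(1)]) auto
    have m1: "(\<lambda>a. F1 a * F' a) = (\<lambda>a. 0) \<and> G1x = (\<lambda>a. \<zero>) \<or>
        wt v \<le> d \<and> pfun R wt V (d - wt v) (\<lambda>a. F1 a * F' a) G1x"
    proof (cases "F1 = (\<lambda>a. 0) \<and> G1 = (\<lambda>a. \<zero>)")
      case True then show ?thesis unfolding G1x_def by auto
    next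
      case False
      then have "wt v \<le> d1" using A(2) by auto
      then show ?thesis unfolding G1x_def
        using False mult.hyps(3) pfun.mult[OF p1 mult.hyps(2), of "d - wt v" "\<lambda>a. G1 a \<otimes> G' a"] by auto
    qed
    have m2: "(\<lambda>a. F0 a * F1' a) = (\<lambda>a. 0) \<and> G2x = (\<lambda>a. \<zero>) \<or>
        wt v \<le> d \<and> pfun R wt V (d - wt v) (\<lambda>a. F0 a * F1' a) G2x"
    proof (cases "F1' = (\<lambda>a. 0) \<and> G1' = (\<lambda>a. \<zero>)")
      case True then show ?thesis unfolding G2x_def by auto
    next
      case False
      then have "wt v \<le> d2" using B(2) by auto
      then show ?thesis unfolding G2x_def
        using False mult.hyps(3) pfun.mult[OF A0 p1', of "d - wt v" "\<lambda>a. G0 a \<otimes> G1' a"] by auto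
    qed
    have p2: "pfun R wt V (d - wt v) (\<lambda>a. F1 a * F' a) G1x" "pfun R wt V (d - wt v) (\<lambda>a. F0 a * F1' a) G2x"
      using m1 m2 pfun_zero by auto
    show ?case
    proof (rule exI[of _ "\<lambda>a. F0 a * F0' a"], rule exI[of _ "\<lambda>a. G0 a \<otimes> G0' a"],
        rule exI[of _ "\<lambda>a. F1 a * F' a + F0 a * F1' a"], rule exI[of _ "\<lambda>a. G1x a \<oplus> G2x a"],
        intro conjI allI impI)
      show "pfun R wt (V - {v}) d (\<lambda>a. F0 a * F0' a) (\<lambda>a. G0 a \<otimes> G0' a)"
        by (rule pfun.mult[OF A(1) B(1) mult.hyps(3)]) simp
      have "pfun R wt V (d - wt v) (\<lambda>a. F1 a * F' a + F0 a * F1' a) (\<lambda>a. G1x a \<oplus> G2x a)"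
        by (rule pfun.add[OF p2]) simp
      then show "(\<lambda>a. F1 a * F' a + F0 a * F1' a) = (\<lambda>a. 0) \<and> (\<lambda>a. G1x a \<oplus> G2x a) = (\<lambda>a. \<zero>) \<or>
        wt v \<le> d \<and> pfun R wt V (d - wt v) (\<lambda>a. F1 a * F' a + F0 a * F1' a) (\<lambda>a. G1x a \<oplus> G2x a)"
      proof (cases "wt v \<le> d")
        case False
        then have z: "F1 a * F' a = 0" "F0 a * F1' a = 0" "G1x b = \<zero>" "G2x b = \<zero>" for a b
          using m1 m2 by metis+
        then show ?thesis by (intro disjI1 conjI ext) (simp_all only: z zero_closed l_zero add_0_left)
      qed blast
      show "F a * F' a = F0 a * F0' a + a v * (F1 a * F' a + F0 a * F1' a)" for a
        by (simp add: A(3) B(3) algebra_simps)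
      show "H a = G0 a \<otimes> G0' a \<oplus> a v \<otimes> (G1x a \<oplus> G2x a)" if a: "\<forall>u\<in>insert v V. a u \<in> carrier R" for a
      proof -
        have v: "a v \<in> carrier R" using a by simp
        have "G1x a = G1 a \<otimes> G' a" "G2x a = G0 a \<otimes> G1' a"
          using c[OF a] by (auto simp: G1x_def G2x_def)
        moreover have "H a = G a \<otimes> G' a" using a mult.hyps(4) by simp
        moreover have "G a = G0 a \<oplus> a v \<otimes> G1 a" using A(4) a by blast
        moreover have "(G0 a \<oplus> a v \<otimes> G1 a) \<otimes> (G0' a \<oplus> a v \<otimes> G1' a) = G0 a \<otimes> G0' a \<oplus> a v \<otimes>
           (G1 a \<otimes> (G0' a \<oplus> a v \<otimes> G1' a) \<oplus> G0 a \<otimes> G1' a)"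
          using c[OF a] v by algebra
        moreover have "G' a = G0' a \<oplus> a v \<otimes> G1' a" using B(4) a by blast
        ultimately show ?thesis by simp
      qed
    qed
  qed
  then show thesis using that by blast
qed

text \<open>In \<open>F = F0 + v F1\<close>, setting the variable to 0 shows that \<open>F0\<close>
  vanishes, and density shows that \<open>F1\<close> does. One has fewer variables and the other a
  lower degree; in the end there remain integer constants, which are 0. Nothing is divided in
  \<open>R\<close>, so torsion does no harm.\<close>

lemma pfun_transfer:
  assumes "pfun R wt V d F G" "finite V" "\<And>a. F a = 0" "\<forall>v\<in>V. a v \<in> carrier R"
  shows "G a = \<zero>"
proof -
  obtain d' where "pfun R (\<lambda>_. 1) V d' F G" using pfun_degree[OF assms(1)] by blast
  from assms(2) this assms(3,4) show ?thesis
  proof (induction V arbitrary: d' F G a rule: finite_induct)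
    case empty
    have "\<exists>c. F = (\<lambda>_. c) \<and> G = (\<lambda>_. [c] \<cdot> \<one>)" using empty.prems(1)
    proof (induction rule: pfun.induct)
      case (const G c d)
      then show ?case by (intro exI[of _ c]) auto
    next
      case (add d F G F' G' H)
      then obtain c c' where "F = (\<lambda>_. c)" "F' = (\<lambda>_. c')" "G = (\<lambda>_. [c] \<cdot> \<one>)" "G' = (\<lambda>_. [c'] \<cdot> \<one>)" by blast
      with add show ?case by (intro exI[of _ "c + c'"]) (auto simp: add.int_pow_mult)
    next
      case (mult d1 F G d2 F' G' d H)
      then obtain c c' where "F = (\<lambda>_. c)" "F' = (\<lambda>_. c')" "G = (\<lambda>_. [c] \<cdot> \<one>)" "G' = (\<lambda>_. [c'] \<cdot> \<one>)" by blast
      with mult show ?case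
        by (intro exI[of _ "c * c'"]) (auto simp: add_pow_ldistr_int add.int_pow_pow mult.commute)
    qed auto
    then show ?case using empty.prems(2) by (auto simp: add_pow_def int_pow_def)
  next
    case (insert v V)
    show ?case using insert.prems
    proof (induction d' arbitrary: F G a rule: less_induct)
      case (less d)
      obtain F0 G0 F1 G1 where A: "pfun R (\<lambda>_. 1) (insert v V - {v}) d F0 G0"
        "F1 = (\<lambda>a. 0) \<and> G1 = (\<lambda>a. \<zero>) \<or> 1 \<le> d \<and> pfun R (\<lambda>_. 1) (insert v V) (d - 1) F1 G1"
        "\<And>a. F a = F0 a + a v * F1 a"
        "\<And>a. \<forall>u\<in>insert v (insert v V). a u \<in> carrier R \<Longrightarrow> G a = G0 a \<oplus> a v \<otimes> G1 a"
        by (rule pfun_divide[OF less.prems(1), of v]) blast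
      have V: "insert v V - {v} = V" using insert.hyps by auto
      have F0: "F0 b = 0" for b
      proof -
        have "F0 b = F0 (b(v := 0))" by (rule pfun_agree[OF A(1)]) auto
        then show ?thesis using A(3)[of "b(v := 0)"] less.prems(2) by simp
      qed
      have G0: "G0 a = \<zero>"
        using insert.IH[OF A(1)[unfolded V] F0] less.prems(3) by auto
      have "G1 a = \<zero>"
      proof (cases "F1 = (\<lambda>a. 0) \<and> G1 = (\<lambda>a. \<zero>)")
        case False
        then have d: "1 \<le> d" and p: "pfun R (\<lambda>_. 1) (insert v V) (d - 1) F1 G1" using A(2) by auto
        have F1: "F1 b = 0" for b
          by (rule pfun_density[OF p, of "{v}"]) (use less.prems(2) in \<open>auto simp: A(3) F0\<close>)
        show ?thesis by (rule less.IH[OF _ p F1 less.prems(3)]) (use d in auto)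
      qed auto
      then show ?case using A(4)[of a] G0 less.prems(3) by auto
    qed
  qed
qed

end

section \<open>Elementary symmetric polynomials\<close>

lemma esym_empty [simp]: "esym k {} f = (if k = 0 then 1 else 0)"
proof -
  have *: "{T. T \<subseteq> {} \<and> card T = k} = (if k = 0 then {{}} else {})" by auto
  show ?thesis by (simp only: esym_def *) simp
qed

lemma esym_0 [simp]: "finite I \<Longrightarrow> esym 0 I f = 1"
proof -
  assume "finite I"
  then have "{T. T \<subseteq> I \<and> card T = 0} = {{}}" by (auto dest: finite_subset)
  then show ?thesis by (simp add: esym_def)
qed

lemma esym_insert:
  assumes "finite I" "i \<notin> I"
  shows "esym (Suc k) (insert i I) f = esym (Suc k) I f + f i * esym k I f"
proof -
  let ?A = "{T. T \<subseteq> I \<and> card T = Suc k}" and ?B = "{T. T \<subseteq> I \<and> card T = k}"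
  have eq: "{T. T \<subseteq> insert i I \<and> card T = Suc k} = ?A \<union> insert i ` ?B"
  proof (intro equalityI subsetI)
    fix T assume T: "T \<in> {T. T \<subseteq> insert i I \<and> card T = Suc k}"
    show "T \<in> ?A \<union> insert i ` ?B"
    proof (cases "i \<in> T")
      case True
      then have "T = insert i (T - {i})" "T - {i} \<in> ?B" using T by auto
      then show ?thesis by blast
    qed (use T in auto)
  next
    fix T assume "T \<in> ?A \<union> insert i ` ?B"
    moreover have "card (insert i U) = Suc k" if "U \<subseteq> I" "card U = k" for U
      using that assms finite_subset[of U I] by (subst card_insert_disjoint) auto
    ultimately show "T \<in> {T. T \<subseteq> insert i I \<and> card T = Suc k}" by auto
  qed
  have inj: "inj_on (insert i) ?B"
  proof (rule inj_onI)
    fix T U assume "T \<in> ?B" "U \<in> ?B" "insert i T = insert i U"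
    moreover from this have "i \<notin> T" "i \<notin> U" using assms(2) by auto
    ultimately show "T = U" by (simp add: insert_ident)
  qed
  have "esym (Suc k) (insert i I) f = (\<Sum>T\<in>?A. prod f T) + (\<Sum>T\<in>insert i ` ?B. prod f T)"
    unfolding esym_def eq by (rule sum.union_disjoint) (use assms in auto)
  also have "(\<Sum>T\<in>insert i ` ?B. prod f T) = (\<Sum>T\<in>?B. prod f (insert i T))"
    using inj by (simp add: sum.reindex)
  also have "\<dots> = (\<Sum>T\<in>?B. f i * prod f T)"
    by (intro sum.cong refl prod.insert) (use assms in \<open>auto dest: finite_subset\<close>)
  finally show ?thesis by (simp add: esym_def sum_distrib_left)
qed

abbreviation lin :: "int \<Rightarrow> int fps" where "lin c \<equiv> 1 + fps_const c * fps_X"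

lemma lin_mult_nth: "fps_nth (lin c * p) n = fps_nth p n + (if n = 0 then 0 else c * fps_nth p (n - 1))"
proof -
  have "lin c * p = p + fps_const c * (fps_X * p)" by (simp only: distrib_right mult.assoc mult_1_left)
  then show ?thesis by simp
qed

text \<open>The generating function turns reindexing, permuting and padding with zeros into
  properties of finite products.\<close>

lemma esym_fps: "finite I \<Longrightarrow> fps_nth (\<Prod>i\<in>I. lin (f i)) k = esym k I f"
proof (induction I arbitrary: k rule: finite_induct)
  case (insert i I)
  then show ?case by (cases k) (simp_all add: lin_mult_nth esym_insert)
qed simp

lemma esym_reindex: "inj_on h I \<Longrightarrow> finite I \<Longrightarrow> esym k (h ` I) f = esym k I (\<lambda>i. f (h i))"
  by (simp add: esym_fps[symmetric] prod.reindex)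

lemma esym_cong: "I = J \<Longrightarrow> (\<And>i. i \<in> J \<Longrightarrow> f i = g i) \<Longrightarrow> esym k I f = esym k J g"
  unfolding esym_def by (intro sum.cong prod.cong) auto

lemma esym_mono_neutral:
  assumes "finite J" "I \<subseteq> J" "\<And>i. i \<in> J - I \<Longrightarrow> f i = 0"
  shows "esym k J f = esym k I f"
proof -
  have "(\<Prod>i\<in>J. lin (f i)) = (\<Prod>i\<in>I. lin (f i))"
    by (rule prod.mono_neutral_right) (use assms in auto)
  then show ?thesis using assms finite_subset by (metis esym_fps)
qed

lemma esym_eq_0: "finite I \<Longrightarrow> card I < k \<Longrightarrow> esym k I f = 0"
proof -
  assume "finite I" "card I < k"
  then have *: "{T. T \<subseteq> I \<and> card T = k} = {}" using card_mono[of I] by (auto simp: not_less[symmetric])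
  show ?thesis by (simp only: esym_def *) simp
qed

lemma esym_Suc_last: "esym (Suc k) {..<Suc N} f = esym (Suc k) {..<N} f + f N * esym k {..<N} f"
  by (simp add: lessThan_Suc esym_insert)

lemma esym_top: "esym N {..<N} f = (\<Prod>i<N. f i)"
proof (induction N)
  case (Suc N)
  then show ?case by (simp add: esym_Suc_last esym_eq_0)
qed simp

lemma esym_permute: "s permutes I \<Longrightarrow> finite I \<Longrightarrow> esym k I (\<lambda>i. f (s i)) = esym k I f"
  using esym_reindex[of s I k f] by (simp add: permutes_image permutes_inj_on)

text \<open>The substitution of the elementary symmetric polynomials of the variables with
  indices \<open>(s, 0), \<dots>, (s, N - 1)\<close> for the variables with indices \<open>(s, k)\<close>.\<close>

definition esub :: "'s \<Rightarrow> nat \<Rightarrow> ('s \<times> nat \<Rightarrow> int) \<Rightarrow> 's \<times> nat \<Rightarrow> int" where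
  "esub s N a = (\<lambda>(t, k). if t = s then esym k {..<N} (\<lambda>i. a (s, i)) else a (t, k))"

lemma esub_simps [simp]:
  "esub s N a (s, k) = esym k {..<N} (\<lambda>i. a (s, i))" "t \<noteq> s \<Longrightarrow> esub s N a (t, k) = a (t, k)"
  by (auto simp: esub_def)

lemma esub_upd: "esub s (Suc N) (a((s, N) := 0)) = esub s N a"
proof
  fix v :: "'a \<times> nat"
  obtain t k where v: "v = (t, k)" by (cases v)
  show "esub s (Suc N) (a((s, N) := 0)) v = esub s N a v"
  proof (cases "t = s")
    case True
    have "esym k {..<Suc N} (\<lambda>i. (a((s, N) := 0)) (s, i)) = esym k {..<N} (\<lambda>i. (a((s, N) := 0)) (s, i))"
      by (rule esym_mono_neutral) (auto simp: less_Suc_eq)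
    also have "\<dots> = esym k {..<N} (\<lambda>i. a (s, i))" by (rule esym_cong) auto
    finally show ?thesis using v True by simp
  qed (simp add: v)
qed

lemma esub_zero: "a (s, N) = 0 \<Longrightarrow> esub s (Suc N) a = esub s N a"
  using esub_upd[of s N a] by (simp add: fun_upd_idem)

context cring
begin

lemma pfun_esym:
  assumes "finite I" "\<And>i. i \<in> I \<Longrightarrow> (s, i) \<in> V \<and> wt (s, i) \<le> w" "w * k \<le> d"
  shows "\<exists>G. pfun R wt V d (\<lambda>a. esym k I (\<lambda>i. a (s, i))) G"
proof -
  have "pfun R wt V d (\<lambda>a. \<Sum>T\<in>{T. T \<subseteq> I \<and> card T = k}. \<Prod>t\<in>T. a (s, t))
     (\<lambda>a. \<Oplus>T\<in>{T. T \<subseteq> I \<and> card T = k}. \<Otimes>t\<in>T. a (s, t))"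
  proof (intro pfun_sum pfun_prod)
    fix T assume T: "T \<in> {T. T \<subseteq> I \<and> card T = k}"
    show "finite T" using T assms(1) finite_subset by blast
    show "(\<Sum>i\<in>T. w) \<le> d" using T assms(3) by (simp add: mult.commute)
    show "pfun R wt V w (\<lambda>a. a (s, i)) (\<lambda>a. a (s, i))" if "i \<in> T" for i
      using T that assms(2) by (intro pfun.var) auto
  qed (use assms(1) in auto)
  then show ?thesis unfolding esym_def by blast
qed

text \<open>The factor \<open>w\<close> is 1 in the fundamental theorem, where \<open>e_k\<close>
  has weight \<open>k\<close>, and 0 where weights are ignored.\<close>

lemma pfun_esub:
  assumes "pfun R wt V d F G" "\<And>i. i < N \<Longrightarrow> wt' (s, i) \<le> w"
    "\<And>k. (s, k) \<in> V \<Longrightarrow> w * k \<le> wt (s, k)" "\<And>t k. t \<noteq> s \<Longrightarrow> (t, k) \<in> V \<Longrightarrow> wt' (t, k) \<le> wt (t, k)"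
  shows "\<exists>G. pfun R wt' ({v\<in>V. fst v \<noteq> s} \<union> {s} \<times> {..<N}) d (\<lambda>a. F (esub s N a)) G"
proof -
  let ?V = "{v\<in>V. fst v \<noteq> s} \<union> {s} \<times> {..<N}"
  have "\<exists>Q. pfun R wt' ?V (wt v) (\<lambda>a. esub s N a v) Q" if v: "v \<in> V" for v
  proof (cases "fst v = s")
    case True
    then obtain k where k: "v = (s, k)" by (cases v) auto
    show ?thesis unfolding k esub_simps
      by (rule pfun_esym[where w = w]) (use assms(2,3) v k in auto)
  next
    case False
    then obtain t k where k: "v = (t, k)" "t \<noteq> s" by (cases v) auto
    have "pfun R wt' ?V (wt v) (\<lambda>a. a v) (\<lambda>a. a v)"
      by (rule pfun.var) (use assms(4) k v in auto)
    then show ?thesis using k by auto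
  qed
  then have "\<forall>v\<in>V. \<exists>Q. pfun R wt' ?V (wt v) (\<lambda>a. esub s N a v) Q" by blast
  from bchoice[OF this] obtain Q where "\<And>v. v \<in> V \<Longrightarrow> pfun R wt' ?V (wt v) (\<lambda>a. esub s N a v) (Q v)" by blast
  from pfun_compose[OF assms(1) this] show ?thesis by auto
qed

text \<open>Algebraic independence of the elementary symmetric polynomials.  The induction on the
  number of variables puts the last variable to 0; what remains is divisible by the last
  elementary symmetric polynomial.\<close>

lemma esub_independent:
  assumes "pfun R wt V d F G" "\<And>a. F (esub s N a) = 0"
    "a (s, 0) = 1" "\<And>k. k > N \<Longrightarrow> a (s, k) = 0"
  shows "F a = 0"
proof -
  obtain d' where "pfun R (\<lambda>_. 1) V d' F G" using pfun_degree[OF assms(1)] by blast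
  from this assms(2-) show ?thesis
  proof (induction N arbitrary: V d' F G a)
    case 0
    \<comment> \<open>In no variables \<open>e_0\<close> is 1 and the other \<open>e_k\<close> are
      0, exactly the values prescribed for \<open>a\<close>.\<close>
    have "a = esub s 0 a" using 0 by (auto simp: esub_def)
    then show ?case using "0.prems"(2) by metis
  next
    case (Suc N)
    from Suc.prems show ?case
    proof (induction d' arbitrary: F G a rule: less_induct)
      case (less d)
      let ?v = "(s, Suc N)"
      obtain F0 G0 F1 G1 where A: "pfun R (\<lambda>_. 1) (V - {?v}) d F0 G0"
        "F1 = (\<lambda>a. 0) \<and> G1 = (\<lambda>a. \<zero>) \<or> 1 \<le> d \<and> pfun R (\<lambda>_. 1) V (d - 1) F1 G1"
        "\<And>a. F a = F0 a + a ?v * F1 a"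
        by (rule pfun_divide[OF less.prems(1), of ?v]) blast
      have F0': "F0 (b(?v := t)) = F0 b" for b t by (rule pfun_agree[OF A(1)]) auto
      have "F0 (esub s N b) = 0" for b
      proof -
        have "F (esub s N b) = 0" using less.prems(2)[of "b((s, N) := 0)"] by (simp only: esub_upd)
        moreover have "esub s N b ?v = 0" by (simp add: esym_eq_0)
        ultimately show ?thesis using A(3) by simp
      qed
      then have F0N: "F0 b = 0" if "b (s, 0) = 1" "\<And>k. k > N \<Longrightarrow> b (s, k) = 0" for b
        using Suc.IH[OF A(1)] that by blast
      have F0: "F0 b = 0" if "b (s, 0) = 1" "\<And>k. k > Suc N \<Longrightarrow> b (s, k) = 0" for b
        using F0N[of "b(?v := 0)"] that F0'[of b 0] by (simp add: Suc_lessI)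
      show ?case
      proof (cases "F1 = (\<lambda>a. 0) \<and> G1 = (\<lambda>a. \<zero>)")
        case True
        then show ?thesis using A(3)[of a] F0[of a] less.prems(3,4) by simp
      next
        case False
        then have d: "1 \<le> d" and p: "pfun R (\<lambda>_. 1) V (d - 1) F1 G1" using A(2) by auto
        obtain K where K: "pfun R (\<lambda>_. 0) ({v\<in>V. fst v \<noteq> s} \<union> {s} \<times> {..<Suc N}) 0
             (\<lambda>a. F1 (esub s (Suc N) a)) K"
          using pfun_esub[OF pfun_unweighted[OF p], of "Suc N" "\<lambda>_. 0" s 0] by auto
        have F1: "F1 (esub s (Suc N) b) = 0" for b
        proof (rule pfun_density[OF K, of "{s} \<times> {..<Suc N}"])
          fix b :: "_ \<Rightarrow> int" assume b: "\<forall>v\<in>{s} \<times> {..<Suc N}. b v \<noteq> 0"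
          have "F0 (esub s (Suc N) b) = 0" by (rule F0) (auto simp: esym_eq_0)
          then have "esub s (Suc N) b ?v * F1 (esub s (Suc N) b) = 0"
            using A(3)[of "esub s (Suc N) b"] less.prems(2)[of b] by simp
          then show "F1 (esub s (Suc N) b) = 0" using b by (auto simp: esym_top)
        qed simp
        have "F1 a = 0" by (rule less.IH[OF _ p]) (use d F1 less.prems(3,4) in auto)
        then show ?thesis using A(3)[of a] F0[of a] less.prems(3,4) by simp
      qed
    qed
  qed
qed

end

definition vperm :: "'s \<Rightarrow> (nat \<Rightarrow> nat) \<Rightarrow> ('s \<times> nat \<Rightarrow> int) \<Rightarrow> 's \<times> nat \<Rightarrow> int" where
  "vperm s p a = (\<lambda>(t, i). a (t, if t = s then p i else i))"

lemma vperm_simps [simp]: "vperm s p a (s, i) = a (s, p i)" "t \<noteq> s \<Longrightarrow> vperm s p a (t, i) = a (t, i)"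
  by (auto simp: vperm_def)

lemma esub_vperm: "p permutes {..<N} \<Longrightarrow> esub s N (vperm s p a) = esub s N a"
  by (auto simp: esub_def vperm_def esym_permute[of p "{..<N}" _ "\<lambda>i. a (s, i)"])

context cring
begin

text \<open>The variables are divided out one at a time; by density the quotient still vanishes on
  the remaining coordinate hyperplanes. \<open>F = 0\<close> is a separate case because the product
  over \<open>X\<close> may outweigh \<open>d\<close>.\<close>

lemma pfun_divide_prod:
  assumes "finite X" "pfun R wt V d F G" "\<And>v. v \<in> X \<Longrightarrow> wt v = 1"
    "\<And>v a. v \<in> X \<Longrightarrow> a v = 0 \<Longrightarrow> F a = 0"
  shows "F = (\<lambda>a. 0) \<or> (\<exists>H K. card X \<le> d \<and> pfun R wt V (d - card X) H K \<and>
    (\<forall>a. F a = (\<Prod>v\<in>X. a v) * H a))"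
  using assms
proof (induction X arbitrary: d F G rule: finite_induct)
  case empty
  then show ?case by (intro disjI2 exI[of _ F] exI[of _ G]) simp
next
  case (insert v X)
  obtain F0 G0 F1 G1 where A: "pfun R wt (V - {v}) d F0 G0"
    "F1 = (\<lambda>a. 0) \<and> G1 = (\<lambda>a. \<zero>) \<or> wt v \<le> d \<and> pfun R wt V (d - wt v) F1 G1"
    "\<And>a. F a = F0 a + a v * F1 a"
    by (rule pfun_divide[OF insert.prems(1), of v]) blast
  have F0: "F0 b = 0" for b
  proof -
    have "F0 b = F0 (b(v := 0))" by (rule pfun_agree[OF A(1)]) auto
    then show ?thesis using A(3)[of "b(v := 0)"] insert.prems(3)[of v "b(v := 0)"] by simp
  qed
  show ?case
  proof (cases "F1 = (\<lambda>a. 0)")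
    case True
    then show ?thesis using A(3) F0 by auto
  next
    case False
    then have d: "1 \<le> d" and p: "pfun R wt V (d - 1) F1 G1" using A(2) insert.prems(2)[of v] by auto
    have "F1 a = 0" if u: "u \<in> X" "a u = 0" for u a
    proof -
      have "F1 (b(u := 0)) = 0" for b
      proof (rule pfun_density[OF pfun_set_zero[OF p], of "{v}"])
        fix b :: "_ \<Rightarrow> int" assume b: "\<forall>x\<in>{v}. b x \<noteq> 0"
        have "F (b(u := 0)) = 0" by (rule insert.prems(3)[of u]) (use u in auto)
        moreover have "v \<noteq> u" using insert.hyps u by auto
        ultimately show "F1 (b(u := 0)) = 0" using A(3)[of "b(u := 0)"] F0 b by simp
      qed simp
      from this[of a] u show ?thesis by (simp add: fun_upd_idem)
    qed
    then have "F1 = (\<lambda>a. 0) \<or> (\<exists>H K. card X \<le> d - 1 \<and> pfun R wt V (d - 1 - card X) H K \<and>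
      (\<forall>a. F1 a = (\<Prod>v\<in>X. a v) * H a))"
      by (intro insert.IH[OF p]) (use insert.prems(2) in auto)
    with False obtain H K where H: "card X \<le> d - 1" "pfun R wt V (d - 1 - card X) H K"
      "\<And>a. F1 a = (\<Prod>v\<in>X. a v) * H a" by blast
    show ?thesis
      by (intro disjI2 exI[of _ H] exI[of _ K])
        (use H d insert.hyps A(3) F0 in \<open>auto simp: mult.assoc\<close>)
  qed
qed

lemma pfun_vperm:
  assumes "pfun R wt (U \<union> {s} \<times> {..<N}) d F G" "p permutes {..<N}" "\<And>i. wt (s, i) = w"
    "\<And>v. v \<in> U \<Longrightarrow> fst v \<noteq> s"
  shows "\<exists>G. pfun R wt (U \<union> {s} \<times> {..<N}) d (\<lambda>a. F (vperm s p a)) G"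
proof -
  have "pfun R wt (U \<union> {s} \<times> {..<N}) (wt v) (\<lambda>a. vperm s p a v) (\<lambda>a. a (fst v, if fst v = s then p (snd v) else snd v))"
    if "v \<in> U \<union> {s} \<times> {..<N}" for v
  proof (cases "fst v = s")
    case True
    then obtain i where i: "v = (s, i)" by (cases v) auto
    then have "p i < N" using that assms(4)[of v] permutes_in_image[OF assms(2), of i] by auto
    then show ?thesis using i assms(3) by (auto intro!: pfun.var)
  next
    case False
    then obtain t i where i: "v = (t, i)" "t \<noteq> s" by (cases v) auto
    then show ?thesis using that by (auto intro!: pfun.var)
  qed
  from pfun_compose[OF assms(1) this] show ?thesis by auto
qed

text \<open>The fundamental theorem on symmetric polynomials, for polynomials symmetric in one group
  of variables.  After putting the last variable to 0, induction provides a polynomial in the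
  elementary symmetric ones; the difference is divisible by the product of all variables.\<close>

theorem symmetric_polynomial:
  assumes "pfun R wt (U \<union> {s} \<times> {..<N}) d f g" "\<And>v. v \<in> U \<Longrightarrow> fst v \<noteq> s"
    "\<And>k. wt (s, k) = 1"
    "\<And>p a. p permutes {..<N} \<Longrightarrow> f (vperm s p a) = f a"
  shows "\<exists>F G. pfun R (\<lambda>(t, k). if t = s then k else wt (t, k)) (U \<union> {s} \<times> {1..d}) d F G \<and>
    (\<forall>a. f a = F (esub s N a))"
  using assms(1,4)
proof (induction N arbitrary: d f g)
  case 0
  have "pfun R (\<lambda>(t, k). if t = s then k else wt (t, k)) U d f g"
    by (rule pfun_wt_cong[where wt = wt]) (use 0 assms(2) in \<open>auto split: if_splits\<close>)
  then have "pfun R (\<lambda>(t, k). if t = s then k else wt (t, k)) (U \<union> {s} \<times> {1..d}) d f g"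
    by (rule pfun_mono) auto
  moreover have "f a = f (esub s 0 a)" for a
    by (rule pfun_agree[OF "0.prems"(1)]) (use assms(2) in \<open>force simp: esub_def\<close>)
  ultimately show ?case by blast
next
  case (Suc N)
  let ?wt = "\<lambda>(t, k). if t = s then k else wt (t, k)"
  let ?V = "U \<union> {s} \<times> {..<Suc N}"
  from Suc.prems show ?case
  proof (induction d arbitrary: f g rule: less_induct)
    case (less d)
    have V: "U \<union> {s} \<times> {..<Suc N} - {(s, N)} = U \<union> {s} \<times> {..<N}" using assms(2)[of "(s, N)"] by auto
    have p0: "pfun R wt (U \<union> {s} \<times> {..<N}) d (\<lambda>a. f (a((s, N) := 0))) (\<lambda>a. g (a((s, N) := \<zero>)))"
      using pfun_set_zero[OF less.prems(1), of "(s, N)"] unfolding V .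
    have "f ((vperm s p a)((s, N) := 0)) = f (a((s, N) := 0))" if p: "p permutes {..<N}" for p a
    proof -
      have pN: "p N = N" using p by (simp add: permutes_def)
      have inj: "p i = N \<longleftrightarrow> i = N" for i using permutes_inj[OF p] pN by (metis injD)
      have "(vperm s p a)((s, N) := 0) = vperm s p (a((s, N) := 0))"
        by (auto simp: vperm_def inj)
      moreover have "p permutes {..<Suc N}" using p by (rule permutes_subset) auto
      ultimately show ?thesis using less.prems(2)[of p "a((s, N) := 0)"] by (simp only:)
    qed
    then obtain F0 G0 where F0: "pfun R ?wt (U \<union> {s} \<times> {1..d}) d F0 G0"
      "\<And>a. f (a((s, N) := 0)) = F0 (esub s N a)"
      using Suc.IH[OF p0] by blast
    have "\<exists>K. pfun R wt ({v \<in> U \<union> {s} \<times> {1..d}. fst v \<noteq> s} \<union> {s} \<times> {..<Suc N}) d (\<lambda>a. F0 (esub s (Suc N) a)) K"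
      by (rule pfun_esub[OF F0(1), where w = 1]) (use assms(3) in auto)
    then obtain K0 where "pfun R wt ({v \<in> U \<union> {s} \<times> {1..d}. fst v \<noteq> s} \<union> {s} \<times> {..<Suc N}) d (\<lambda>a. F0 (esub s (Suc N) a)) K0" ..
    then have K0: "pfun R wt ?V d (\<lambda>a. F0 (esub s (Suc N) a)) K0"
      by (rule pfun_mono) auto
    define h where "h = (\<lambda>a. f a - F0 (esub s (Suc N) a))"
    have ph: "pfun R wt ?V d h (\<lambda>a. g a \<ominus> K0 a)"
      unfolding h_def by (rule pfun_diff[OF less.prems(1) K0])
    have h_perm: "h (vperm s p a) = h a" if "p permutes {..<Suc N}" for p a
      unfolding h_def by (simp only: less.prems(2)[OF that] esub_vperm[OF that])
    have hN: "h a = 0" if "a (s, N) = 0" for a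
      using F0(2)[of a] that by (simp add: h_def esub_zero fun_upd_idem)
    have h0: "h a = 0" if v: "v \<in> {s} \<times> {..<Suc N}" "a v = 0" for v a
    proof -
      obtain i where i: "v = (s, i)" "i < Suc N" using v by auto
      \<comment> \<open>A transposition carries the vanishing at the last variable over to variable
        \<open>i\<close>.\<close>
      have t: "transpose i N permutes {..<Suc N}" by (rule permutes_swap_id) (use i in auto)
      have "h (vperm s (transpose i N) a) = 0" by (rule hN) (use i v in simp)
      then show ?thesis using h_perm[OF t] by simp
    qed
    have "h = (\<lambda>a. 0) \<or> (\<exists>H K. card ({s} \<times> {..<Suc N}) \<le> d \<and> pfun R wt ?V (d - card ({s} \<times> {..<Suc N})) H K \<and>
      (\<forall>a. h a = (\<Prod>v\<in>{s} \<times> {..<Suc N}. a v) * H a))"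
      by (rule pfun_divide_prod[OF _ ph]) (use assms(3) h0 in auto)
    then show ?case
    proof
      assume "h = (\<lambda>a. 0)"
      then have "f a = F0 (esub s (Suc N) a)" for a unfolding h_def by (auto dest: fun_cong[of _ _ a])
      then show ?thesis using F0(1) by blast
    next
      assume "\<exists>H K. card ({s} \<times> {..<Suc N}) \<le> d \<and> pfun R wt ?V (d - card ({s} \<times> {..<Suc N})) H K \<and>
      (\<forall>a. h a = (\<Prod>v\<in>{s} \<times> {..<Suc N}. a v) * H a)"
      moreover have "card ({s} \<times> {..<Suc N}) = Suc N" by (simp add: card_cartesian_product)
      moreover have "(\<Prod>v\<in>{s} \<times> {..<Suc N}. a v) = (\<Prod>i<Suc N. a (s, i))" for a :: "'c \<times> nat \<Rightarrow> int"
      proof -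
        have "{s} \<times> {..<Suc N} = Pair s ` {..<Suc N}" by auto
        then show ?thesis by (simp add: prod.reindex inj_on_def del: lessThan_Suc)
      qed
      ultimately obtain H K where H: "Suc N \<le> d" "pfun R wt ?V (d - Suc N) H K"
        "\<And>a. h a = (\<Prod>i<Suc N. a (s, i)) * H a" by auto
      have "H (vperm s p a) = H a" if p: "p permutes {..<Suc N}" for p a
      proof -
        obtain K' where K': "pfun R wt ?V (d - Suc N) (\<lambda>a. H (vperm s p a)) K'"
          using pfun_vperm[OF H(2) p, of 1] assms(2,3) by auto
        \<comment> \<open>Symmetry of \<open>h\<close> and of the product gives that of
          \<open>H\<close> only where the product is non-zero; density removes the
          exception.\<close>
        have "H (vperm s p a) - H a = 0"
        proof (rule pfun_density[OF pfun_diff[OF K' H(2)], of "{s} \<times> {..<Suc N}"])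
          fix a :: "_ \<Rightarrow> int" assume a: "\<forall>v\<in>{s} \<times> {..<Suc N}. a v \<noteq> 0"
          have "(\<Prod>i<Suc N. a (s, p i)) = (\<Prod>i<Suc N. a (s, i))"
            using prod.permute[OF p, of "\<lambda>i. a (s, i)"] by (simp add: o_def)
          then have "(\<Prod>i<Suc N. a (s, i)) * H (vperm s p a) = (\<Prod>i<Suc N. a (s, i)) * H a"
            using h_perm[OF p, of a] by (simp only: H(3) vperm_simps)
          moreover have "(\<Prod>i<Suc N. a (s, i)) \<noteq> 0" using a by (auto simp: prod_zero_iff)
          ultimately show "H (vperm s p a) - H a = 0" by (simp only: mult_cancel_left) simp
        qed simp
        then show ?thesis by simp
      qed
      \<comment> \<open>The quotient has weight \<open>d - Suc N\<close>, so the induction on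
        \<open>d\<close> applies; the factor \<open>e_(N+1)\<close>, of weight \<open>Suc N\<close>,
        restores the bound.\<close>
      then obtain F1 G1 where F1: "pfun R ?wt (U \<union> {s} \<times> {1..d - Suc N}) (d - Suc N) F1 G1"
        "\<And>a. H a = F1 (esub s (Suc N) a)"
        using less.IH[OF _ H(2)] H(1) by force
      have p1: "pfun R ?wt (U \<union> {s} \<times> {1..d}) (d - Suc N) F1 G1"
        by (rule pfun_mono[OF F1(1)]) auto
      have p2: "pfun R ?wt (U \<union> {s} \<times> {1..d}) (Suc N) (\<lambda>a. a (s, Suc N)) (\<lambda>a. a (s, Suc N))"
        by (rule pfun.var) (use H(1) in auto)
      have "pfun R ?wt (U \<union> {s} \<times> {1..d}) d (\<lambda>a. a (s, Suc N) * F1 a) (\<lambda>a. a (s, Suc N) \<otimes> G1 a)"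
        by (rule pfun.mult[OF p2 p1]) (use H(1) in auto)
      then have "pfun R ?wt (U \<union> {s} \<times> {1..d}) d (\<lambda>a. F0 a + a (s, Suc N) * F1 a) (\<lambda>a. G0 a \<oplus> a (s, Suc N) \<otimes> G1 a)"
        by (rule pfun.add[OF F0(1)]) simp
      moreover have "f a = F0 (esub s (Suc N) a) + esub s (Suc N) a (s, Suc N) * F1 (esub s (Suc N) a)" for a
        using H(3)[of a] F1(2)[of a] by (simp add: h_def esym_top del: lessThan_Suc prod.lessThan_Suc)
      ultimately show ?thesis by (intro exI conjI allI)
    qed
  qed
qed

end

section \<open>The universal polynomials\<close>

definition cut :: "'s \<Rightarrow> nat \<Rightarrow> ('s \<times> nat \<Rightarrow> int) \<Rightarrow> 's \<times> nat \<Rightarrow> int" where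
  "cut s N a = (\<lambda>(t, i). if t = s \<and> N \<le> i then 0 else a (t, i))"

lemma cut_simps [simp]: "i < N \<Longrightarrow> cut s N a (s, i) = a (s, i)" "N \<le> i \<Longrightarrow> cut s N a (s, i) = 0"
  "t \<noteq> s \<Longrightarrow> cut s N a (t, i) = a (t, i)"
  by (auto simp: cut_def)

lemma esub_cut: "N \<le> M \<Longrightarrow> esub s M (cut s N a) = esub s N a"
proof
  fix v :: "'a \<times> nat"
  assume "N \<le> M"
  have "esym k {..<M} (\<lambda>i. cut s N a (s, i)) = esym k {..<N} (\<lambda>i. a (s, i))" for k
  proof -
    have "esym k {..<M} (\<lambda>i. cut s N a (s, i)) = esym k {..<N} (\<lambda>i. cut s N a (s, i))"
      by (rule esym_mono_neutral) (use \<open>N \<le> M\<close> in auto)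
    also have "\<dots> = esym k {..<N} (\<lambda>i. a (s, i))" by (rule esym_cong) auto
    finally show ?thesis .
  qed
  then show "esub s M (cut s N a) v = esub s N a v"
    by (cases v; cases "fst v = s") auto
qed

context cring
begin

text \<open>Indices outside 1, ..., N do not occur, so the point may be changed there to the values
  that \<open>e_0\<close> and the \<open>e_k\<close> with \<open>k > N\<close> take.\<close>

lemma esub_independent':
  assumes "pfun R wt V d F G" "\<And>a. F (esub s N a) = 0" "\<And>k. (s, k) \<in> V \<Longrightarrow> 1 \<le> k \<and> k \<le> N"
  shows "F a = 0"
proof -
  let ?b = "\<lambda>(t, k). if t = s then if k = 0 then 1 else if k \<le> N then a (t, k) else 0 else a (t, k)"
  have "F a = F ?b" by (rule pfun_agree[OF assms(1)]) (use assms(3) in \<open>force split: if_splits\<close>)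
  also have "\<dots> = 0" by (rule esub_independent[OF assms(1,2)]) auto
  finally show ?thesis .
qed

text \<open>By the weight bound only the first \<open>n\<close> elementary symmetric polynomials occur, so by
  independence the polynomial obtained for \<open>n\<close> variables serves for every number of variables.\<close>

lemma symmetric_family:
  assumes f: "\<And>N. \<exists>g. pfun R wt (U \<union> {s} \<times> {..<N}) n (f N) g" and U: "\<And>v. v \<in> U \<Longrightarrow> fst v \<noteq> s"
    and wt: "\<And>k. wt (s, k) = 1"
    and sym: "\<And>N p a. p permutes {..<N} \<Longrightarrow> f N (vperm s p a) = f N a"
    and pad: "\<And>N a. a (s, N) = 0 \<Longrightarrow> f (Suc N) a = f N a"
  shows "\<exists>F G. pfun R (\<lambda>_. 0) (U \<union> {s} \<times> {1..n}) 0 F G \<and> (\<forall>N a. f N a = F (esub s N a))"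
proof -
  let ?wt = "\<lambda>(t, k). if t = s then k else wt (t, k)"
  have "\<exists>F G. pfun R ?wt (U \<union> {s} \<times> {1..n}) n F G \<and> (\<forall>a. f N a = F (esub s N a))" for N
  proof -
    obtain g where "pfun R wt (U \<union> {s} \<times> {..<N}) n (f N) g" using f by blast
    then show ?thesis by (rule symmetric_polynomial) (use U wt sym in auto)
  qed
  then have "\<forall>N. \<exists>F. (\<exists>G. pfun R ?wt (U \<union> {s} \<times> {1..n}) n F G) \<and> (\<forall>a. f N a = F (esub s N a))" by blast
  from choice[OF this] obtain F where F: "\<And>N. \<exists>G. pfun R ?wt (U \<union> {s} \<times> {1..n}) n (F N) G"
    "\<And>N a. f N a = F N (esub s N a)" by blast
  have fcut: "f M (cut s N a) = f N a" if "N \<le> M" for M N a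
    using that
  proof (induction M rule: dec_induct)
    case base
    obtain g where "pfun R wt (U \<union> {s} \<times> {..<N}) n (f N) g" using f by blast
    then show ?case by (rule pfun_agree) (use U in \<open>force simp: cut_def\<close>)
  next
    case (step M)
    then show ?case by (simp add: pad)
  qed
  have "f N a = F n (esub s N a)" for N a
  proof (cases "N \<le> n")
    case True
    then show ?thesis using F(2)[of n "cut s N a"] by (simp add: fcut esub_cut)
  next
    case False
    \<comment> \<open>With more than \<open>n\<close> variables, points with at most
      \<open>n\<close> non-zero coordinates already decide equality, because no index above
      \<open>n\<close> occurs.\<close>
    obtain G G' where "pfun R ?wt (U \<union> {s} \<times> {1..n}) n (F N) G" "pfun R ?wt (U \<union> {s} \<times> {1..n}) n (F n) G'"
      using F(1) by blast
    note p = pfun_diff[OF this]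
    have "F N b - F n b = 0" for b
    proof (rule esub_independent'[OF p])
      show "F N (esub s n a) - F n (esub s n a) = 0" for a
        using F(2)[of N "cut s n a"] F(2)[of n a] False by (simp add: fcut esub_cut)
    qed (use U in \<open>force+\<close>)
    then show ?thesis using F(2) by simp
  qed
  moreover obtain G where "pfun R ?wt (U \<union> {s} \<times> {1..n}) n (F n) G"
    using F(1)[of n] by blast
  note pfun_unweighted[OF this]
  ultimately show ?thesis by blast
qed

section \<open>Polynomials as lists of monomials and as functions\<close>

lemma pfun_ieval:
  assumes "finite V"
  shows "pfun R (\<lambda>_. 0) V 0 (ieval V Q) (reval R V Q)"
proof -
  have "pfun R (\<lambda>_. 0) V 0 (\<lambda>a. fst (Q ! i) * (\<Prod>v\<in>V. a v ^ snd (Q ! i) v))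
      (\<lambda>a. [fst (Q ! i)] \<cdot> (\<Otimes>v\<in>V. a v [^] snd (Q ! i) v))" for i
  proof (rule pfun.mult[where ?d1.0 = 0 and ?d2.0 = 0])
    show "pfun R (\<lambda>_. 0) V 0 (\<lambda>a. fst (Q ! i)) (\<lambda>a. [fst (Q ! i)] \<cdot> \<one>)" by (rule pfun.const) simp
    show "pfun R (\<lambda>_. 0) V 0 (\<lambda>a. \<Prod>v\<in>V. a v ^ snd (Q ! i) v) (\<lambda>a. \<Otimes>v\<in>V. a v [^] snd (Q ! i) v)"
      by (rule pfun_prod[where e = "\<lambda>_. 0"]) (use assms in \<open>auto intro!: pfun_power[where e = 0] pfun.var\<close>)
    show "[fst (Q ! i)] \<cdot> (\<Otimes>v\<in>V. a v [^] snd (Q ! i) v)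
        = ([fst (Q ! i)] \<cdot> \<one>) \<otimes> (\<Otimes>v\<in>V. a v [^] snd (Q ! i) v)" if "\<forall>v\<in>V. a v \<in> carrier R" for a
    proof -
      have "(\<Otimes>v\<in>V. a v [^] snd (Q ! i) v) \<in> carrier R" using that by (intro finprod_closed) auto
      then show ?thesis by (simp add: add_pow_ldistr_int)
    qed
  qed simp
  then have "pfun R (\<lambda>_. 0) V 0 (\<lambda>a. ieval V Q a) (\<lambda>a. reval R V Q a)"
    unfolding ieval_def reval_def by (intro pfun_sum) auto
  then show ?thesis by simp
qed

end

lemma ieval_sum_list: "ieval V Q a = (\<Sum>q\<leftarrow>Q. fst q * (\<Prod>v\<in>V. a v ^ snd q v))"
  unfolding ieval_def by (simp add: sum_list_sum_nth atLeast0LessThan)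

lemma ieval_mult:
  "ieval V (concat (map (\<lambda>q. map (\<lambda>q'. (fst q * fst q', \<lambda>v. snd q v + snd q' v)) Q') Q)) a
    = ieval V Q a * ieval V Q' a"
proof (induction Q)
  case Nil
  then show ?case by (simp add: ieval_sum_list)
next
  case (Cons q Q)
  have "(\<Sum>x\<leftarrow>Q'. fst q * fst x * (\<Prod>v\<in>V. a v ^ (snd q v + snd x v)))
      = fst q * (\<Prod>v\<in>V. a v ^ snd q v) * ieval V Q' a"
    by (simp add: ieval_sum_list sum_list_const_mult[symmetric] power_add prod.distrib ac_simps)
  then show ?case using Cons
    by (simp add: ieval_sum_list o_def distrib_right)
qed

text \<open>Returns from functions to lists of monomials, the form in which the axioms quantify over
  universal polynomials.\<close>

lemma pfun_imp_ieval:
  assumes "pfun R wt V d F G" "finite V"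
  shows "\<exists>Q. ieval V Q = F"
  using assms(1)
proof (induction rule: pfun.induct)
  case (const G c d)
  have "ieval V [(c, \<lambda>_. 0)] = (\<lambda>_. c)" by (auto simp: ieval_def)
  then show ?case by blast
next
  case (var v d G)
  have "(\<Prod>u\<in>V. a u ^ (if u = v then 1 else 0)) = a v" for a :: "_ \<Rightarrow> int"
    using assms(2) var(1) by (subst prod.remove[of _ v]) auto
  then have "ieval V [(1, \<lambda>u. if u = v then 1 else 0)] = (\<lambda>a. a v)" by (auto simp: ieval_def)
  then show ?case by blast
next
  case (add d F G F' G' H)
  then obtain Q Q' where "F = ieval V Q" "F' = ieval V Q'" by blast
  then have "ieval V (Q @ Q') = (\<lambda>a. F a + F' a)" by (auto simp: ieval_sum_list)
  then show ?case by blast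
next
  case (mult d1 F G d2 F' G' d H)
  then obtain Q Q' where "F = ieval V Q" "F' = ieval V Q'" by blast
  then show ?case using ieval_mult[of V Q' Q] by blast
qed

section \<open>The universal polynomials for products and for compositions\<close>

lemma esym_scale: "finite I \<Longrightarrow> esym k I (\<lambda>i. c * f i) = c ^ k * esym k I f"
  unfolding esym_def sum_distrib_left by (intro sum.cong refl) (auto simp: prod.distrib)

text \<open>For fixed \<open>j\<close> the product over \<open>i\<close> is the series of the
  \<open>x i\<close> with \<open>y j t\<close> in place of \<open>t\<close>. Hence the
  \<open>x i\<close> enter only through their elementary symmetric functions, and the fundamental
  theorem is needed for the \<open>y j\<close> alone.\<close>

lemma esym_times:
  assumes "finite I" "finite J"
  shows "esym n (I \<times> J) (\<lambda>(i, j). x i * y j)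
    = fps_nth (\<Prod>j\<in>J. Abs_fps (\<lambda>k. esym k I x * y j ^ k)) n"
proof -
  have "(\<Prod>p\<in>I \<times> J. lin (case p of (i, j) \<Rightarrow> x i * y j)) = (\<Prod>j\<in>J. \<Prod>i\<in>I. lin (y j * x i))"
    by (subst prod.swap) (simp add: prod.cartesian_product case_prod_unfold mult.commute)
  also have "\<dots> = (\<Prod>j\<in>J. Abs_fps (\<lambda>k. esym k I x * y j ^ k))"
  proof (rule prod.cong[OF refl], rule fps_ext)
    fix j k
    show "fps_nth (\<Prod>i\<in>I. lin (y j * x i)) k = fps_nth (Abs_fps (\<lambda>k. esym k I x * y j ^ k)) k"
      using esym_fps[OF assms(1), of "\<lambda>i. y j * x i" k] esym_scale[OF assms(1), of k "y j" x]
      by (simp only: fps_nth_Abs_fps mult.commute)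
  qed
  finally show ?thesis using esym_fps[of "I \<times> J" "\<lambda>(i, j). x i * y j" n] assms by simp
qed

lemma exists_bij_lessThan: "finite I \<Longrightarrow> \<exists>h. bij_betw h {..<card I} I"
  using ex_bij_betw_nat_finite[of I] by (simp add: atLeast0LessThan)

definition prod_point :: "(nat \<Rightarrow> 'a) \<Rightarrow> (nat \<Rightarrow> 'a) \<Rightarrow> bool \<times> nat \<Rightarrow> 'a" where
  "prod_point a b = (\<lambda>(s, k). if s then b k else a k)"

context cring
begin

text \<open>The \<open>e_k(x)\<close> are treated as variables of weight 0 and the
  \<open>y j\<close> as variables of weight 1. Coefficient \<open>n\<close> then has weight
  \<open>n\<close>, and \<open>symmetric_family\<close> yields one \<open>F\<close> for all numbers
  of roots.\<close>

lemma Pprod_function: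
  "\<exists>F G. pfun R (\<lambda>_. 0) (UNIV \<times> {1..n}) 0 F G \<and>
    (\<forall>I J (x :: 'i \<Rightarrow> int) (y :: 'j \<Rightarrow> int). finite I \<longrightarrow> finite J \<longrightarrow>
      F (prod_point (\<lambda>k. esym k I x) (\<lambda>k. esym k J y)) = esym n (I \<times> J) (\<lambda>(i, j). x i * y j))"
proof -
  \<comment> \<open>Index 0 is not among the variables: the place of \<open>e_0(x)\<close> is filled
    by 1.\<close>
  define A where "A = (\<lambda>(a :: bool \<times> nat \<Rightarrow> int) k. if k = 0 then 1 else a (False, k))"
  define f where "f = (\<lambda>N a. fps_nth (\<Prod>j<N. Abs_fps (\<lambda>k. A a k * a (True, j) ^ k)) n)"
  let ?wt = "\<lambda>(t, k::nat). if t then 1 else 0 :: nat"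
  have "\<exists>F G. pfun R (\<lambda>_. 0) ({False} \<times> {1..n} \<union> {True} \<times> {1..n}) 0 F G \<and> (\<forall>N a. f N a = F (esub True N a))"
  proof (rule symmetric_family[where wt = ?wt])
    fix N
    \<comment> \<open>A further factor mixes all lower coefficients, so the induction covers every
      \<open>m \<le> n\<close>; the bound keeps the indices that arise among the variables.\<close>
    have "m \<le> n \<Longrightarrow> \<exists>g. pfun R ?wt ({False} \<times> {1..n} \<union> {True} \<times> {..<N}) m
      (\<lambda>a. fps_nth (\<Prod>j<N. Abs_fps (\<lambda>k. A a k * a (True, j) ^ k)) m) g" for m
    proof (induction N arbitrary: m)
      case 0
      have "pfun R ?wt ({False} \<times> {1..n} \<union> {True} \<times> {..<0}) m (\<lambda>a. if m = 0 then 1 else 0)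
          (\<lambda>a. [(if m = 0 then 1 else 0 :: int)] \<cdot> \<one>)" by (rule pfun.const) simp
      then show ?case by auto
    next
      case (Suc N)
      let ?V = "{False} \<times> {1..n} \<union> {True} \<times> {..<Suc N}"
      have "\<forall>k\<in>{0..m}. \<exists>g. pfun R ?wt ?V (m - k)
        (\<lambda>a. fps_nth (\<Prod>j<N. Abs_fps (\<lambda>k. A a k * a (True, j) ^ k)) (m - k)) g"
      proof
        fix k assume "k \<in> {0..m}"
        then have "m - k \<le> n" using Suc.prems by auto
        then obtain g where "pfun R ?wt ({False} \<times> {1..n} \<union> {True} \<times> {..<N}) (m - k)
           (\<lambda>a. fps_nth (\<Prod>j<N. Abs_fps (\<lambda>k. A a k * a (True, j) ^ k)) (m - k)) g"
          using Suc.IH by blast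
        then have "pfun R ?wt ?V (m - k)
           (\<lambda>a. fps_nth (\<Prod>j<N. Abs_fps (\<lambda>k. A a k * a (True, j) ^ k)) (m - k)) g"
          by (rule pfun_mono) auto
        then show "\<exists>g. pfun R ?wt ?V (m - k)
        (\<lambda>a. fps_nth (\<Prod>j<N. Abs_fps (\<lambda>k. A a k * a (True, j) ^ k)) (m - k)) g" by blast
      qed
      from bchoice[OF this] obtain g where g: "\<And>k. k \<in> {0..m} \<Longrightarrow> pfun R ?wt ?V (m - k)
        (\<lambda>a. fps_nth (\<Prod>j<N. Abs_fps (\<lambda>k. A a k * a (True, j) ^ k)) (m - k)) (g k)" by blast
      define B where "B = (\<lambda>(a :: bool \<times> nat \<Rightarrow> 'a) k. if k = 0 then \<one> else a (False, k))"
      have pA: "pfun R ?wt ?V 0 (\<lambda>a. A a k) (\<lambda>a. B a k)" if "k \<in> {0..m}" for k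
      proof (cases "k = 0")
        case False
        then show ?thesis using that Suc.prems unfolding A_def B_def by (auto intro: pfun.var)
      qed (simp add: A_def B_def pfun_one)
      have pk: "pfun R ?wt ?V k (\<lambda>a. a (True, N) ^ k) (\<lambda>a. a (True, N) [^] k)" for k
        by (rule pfun_power[where e = 1]) (auto intro!: pfun.var)
      have pAk: "pfun R ?wt ?V k (\<lambda>a. A a k * a (True, N) ^ k) (\<lambda>a. B a k \<otimes> a (True, N) [^] k)" if "k \<in> {0..m}" for k
        by (rule pfun.mult[OF pA[OF that] pk]) auto
      have "pfun R ?wt ?V m
        (\<lambda>a. A a k * a (True, N) ^ k * fps_nth (\<Prod>j<N. Abs_fps (\<lambda>k. A a k * a (True, j) ^ k)) (m - k))
        (\<lambda>a. B a k \<otimes> a (True, N) [^] k \<otimes> g k a)" if "k \<in> {0..m}" for k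
        by (rule pfun.mult[OF pAk[OF that] g[OF that]]) (use that in auto)
      then have "pfun R ?wt ?V m (\<lambda>a. \<Sum>k\<in>{0..m}. A a k * a (True, N) ^ k *
          fps_nth (\<Prod>j<N. Abs_fps (\<lambda>k. A a k * a (True, j) ^ k)) (m - k))
        (\<lambda>a. \<Oplus>k\<in>{0..m}. B a k \<otimes> a (True, N) [^] k \<otimes> g k a)" by (intro pfun_sum) auto
      moreover have "fps_nth (\<Prod>j<Suc N. Abs_fps (\<lambda>k. A a k * a (True, j) ^ k)) m
        = (\<Sum>k\<in>{0..m}. A a k * a (True, N) ^ k *
          fps_nth (\<Prod>j<N. Abs_fps (\<lambda>k. A a k * a (True, j) ^ k)) (m - k))" for a
        by (simp add: mult.commute[of "prod _ _"] fps_mult_nth)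
      ultimately show ?case by auto
    qed
    then show "\<exists>g. pfun R ?wt ({False} \<times> {1..n} \<union> {True} \<times> {..<N}) n (f N) g"
      unfolding f_def by blast
  next
    fix N and p :: "nat \<Rightarrow> nat" and a :: "bool \<times> nat \<Rightarrow> int" assume p: "p permutes {..<N}"
    have "A (vperm True p a) = A a" by (auto simp: A_def)
    then show "f N (vperm True p a) = f N a"
      using prod.permute[OF p, of "\<lambda>j. Abs_fps (\<lambda>k. A a k * a (True, j) ^ k)"]
      by (simp add: f_def o_def)
  next
    fix N and a :: "bool \<times> nat \<Rightarrow> int" assume "a (True, N) = 0"
    then have "Abs_fps (\<lambda>k. A a k * a (True, N) ^ k) = 1"
      by (auto intro!: fps_ext simp: A_def)
    then show "f (Suc N) a = f N a" by (simp add: f_def)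
  qed auto
  moreover have "{False} \<times> {1..n} \<union> {True} \<times> {1..n} = UNIV \<times> {1..n}" by auto
  ultimately obtain F G where F: "pfun R (\<lambda>_. 0) (UNIV \<times> {1..n}) 0 F G" "\<And>N a. f N a = F (esub True N a)"
    by auto
  have "F (prod_point (\<lambda>k. esym k I x) (\<lambda>k. esym k J y)) = esym n (I \<times> J) (\<lambda>(i, j). x i * y j)"
    if fin: "finite I" "finite J" for I J and x :: "'i \<Rightarrow> int" and y :: "'j \<Rightarrow> int"
  proof -
    obtain h where h: "bij_betw h {..<card J} J" using exists_bij_lessThan[OF fin(2)] ..
    define a where "a = (\<lambda>(t, k). if t then y (h k) else esym k I x)"
    have J: "esym k J y = esym k {..<card J} (\<lambda>i. y (h i))" for k
      using esym_reindex[of h "{..<card J}" k y] h by (simp add: bij_betw_def)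
    have "A a = (\<lambda>k. esym k I x)" using fin by (auto simp: A_def a_def)
    then have "f (card J) a = fps_nth (\<Prod>j<card J. Abs_fps (\<lambda>k. esym k I x * y (h j) ^ k)) n"
      unfolding f_def by (simp add: a_def)
    also have "(\<Prod>j<card J. Abs_fps (\<lambda>k. esym k I x * y (h j) ^ k)) = (\<Prod>j\<in>J. Abs_fps (\<lambda>k. esym k I x * y j ^ k))"
      by (rule prod.reindex_bij_betw[OF h])
    also have "esub True (card J) a = prod_point (\<lambda>k. esym k I x) (\<lambda>k. esym k J y)"
      by (auto simp: esub_def prod_point_def a_def J)
    ultimately show ?thesis using F(2) esym_times[OF fin] by metis
  qed
  with F(1) show ?thesis by blast
qed

end

lemma finite_subsets_card: "finite I \<Longrightarrow> finite {S. S \<subseteq> I \<and> card S = n}"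
  by (rule finite_subset[of _ "Pow I"]) auto

lemma is_Pprod_iff: "is_Pprod n Q \<longleftrightarrow> (\<forall>x y. ieval (UNIV \<times> {1..n}) Q
    (prod_point (\<lambda>k. esym k {..<n} x) (\<lambda>k. esym k {..<n} y)) = esym n ({..<n} \<times> {..<n}) (\<lambda>(i, j). x i * y j))"
  unfolding is_Pprod_def prod_point_def by blast

context cring
begin

text \<open>Independence is applied once for each group of roots, first for those in the group
  \<open>True\<close>, then for those in \<open>False\<close>.\<close>

lemma Pprod_unique:
  assumes "is_Pprod n Q" "pfun R (\<lambda>_. 0) (UNIV \<times> {1..n}) 0 F G"
    "\<And>x y :: nat \<Rightarrow> int. F (prod_point (\<lambda>k. esym k {..<n} x) (\<lambda>k. esym k {..<n} y))
      = esym n ({..<n} \<times> {..<n}) (\<lambda>(i, j). x i * y j)"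
  shows "ieval (UNIV \<times> {1..n}) Q a = F a"
proof -
  define D where "D = (\<lambda>a. ieval (UNIV \<times> {1..n}) Q a - F a)"
  have pD: "pfun R (\<lambda>_. 0) (UNIV \<times> {1..n}) 0 D (\<lambda>a. reval R (UNIV \<times> {1..n}) Q a \<ominus> G a)"
    unfolding D_def by (rule pfun_diff[OF pfun_ieval assms(2)]) simp
  obtain K where K: "pfun R (\<lambda>_. 0) ({v\<in>UNIV \<times> {1..n}. fst v \<noteq> False} \<union> {False} \<times> {..<n}) 0
      (\<lambda>a. D (esub False n a)) K"
    using pfun_esub[OF pD, of n "\<lambda>_. 0" False 0] by auto
  have "D (esub False n b) = 0" for b
  proof (rule esub_independent'[OF K])
    fix a :: "bool \<times> nat \<Rightarrow> int"
    have "esub False n (esub True n a)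
      = prod_point (\<lambda>k. esym k {..<n} (\<lambda>i. a (False, i))) (\<lambda>k. esym k {..<n} (\<lambda>i. a (True, i)))"
      by (auto simp: esub_def prod_point_def)
    then show "D (esub False n (esub True n a)) = 0"
      using assms(1,3) by (simp add: D_def is_Pprod_iff)
  qed auto
  then have "D a = 0" by (rule esub_independent'[OF pD]) auto
  then show ?thesis by (simp add: D_def)
qed

lemma Pcomp_function:
  "\<exists>F G. pfun R (\<lambda>_. 0) {1..m * n} 0 F G \<and> (\<forall>(N :: nat) x.
      F (\<lambda>k. esym k {..<N} x) = esym m {S. S \<subseteq> {..<N} \<and> card S = n} (\<lambda>S. \<Prod>i\<in>S. x i))"
proof -
  \<comment> \<open>There is a single group of roots; \<open>unit\<close> supplies the group index
    that \<open>symmetric_family\<close> expects.\<close>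
  define f where "f = (\<lambda>N (a :: unit \<times> nat \<Rightarrow> int). esym m {S. S \<subseteq> {..<N} \<and> card S = n} (\<lambda>S. \<Prod>i\<in>S. a ((), i)))"
  have "\<exists>F G. pfun R (\<lambda>_. 0) ({} \<union> {()} \<times> {1..m * n}) 0 F G \<and> (\<forall>N a. f N a = F (esub () N a))"
  proof (rule symmetric_family[where wt = "\<lambda>_. 1"])
    fix N :: nat
    let ?S = "{S. S \<subseteq> {..<N} \<and> card S = n}"
    have "pfun R (\<lambda>_. 1) ({()} \<times> {..<N}) (m * n)
       (\<lambda>a. \<Sum>T\<in>{T. T \<subseteq> ?S \<and> card T = m}. \<Prod>S\<in>T. \<Prod>i\<in>S. a ((), i))
       (\<lambda>a. \<Oplus>T\<in>{T. T \<subseteq> ?S \<and> card T = m}. \<Otimes>S\<in>T. \<Otimes>i\<in>S. a ((), i))"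
    proof (intro pfun_sum)
      show "finite {T. T \<subseteq> ?S \<and> card T = m}" by (intro finite_subsets_card) simp
      fix T assume "T \<in> {T. T \<subseteq> ?S \<and> card T = m}"
      then have T: "T \<subseteq> ?S" "card T = m" by auto
      have S: "finite S" "card S = n" "S \<subseteq> {..<N}" if "S \<in> T" for S
        using that T finite_subset[of S "{..<N}"] by auto
      show "pfun R (\<lambda>_. 1) ({()} \<times> {..<N}) (m * n) (\<lambda>a. \<Prod>S\<in>T. \<Prod>i\<in>S. a ((), i)) (\<lambda>a. \<Otimes>S\<in>T. \<Otimes>i\<in>S. a ((), i))"
      proof (rule pfun_prod[where e = "\<lambda>_. n"])
        show "finite T" using T(1) by (rule finite_subset) simp
        show "(\<Sum>S\<in>T. n) \<le> m * n" using T by simp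
        fix S assume "S \<in> T"
        then show "pfun R (\<lambda>_. 1) ({()} \<times> {..<N}) n (\<lambda>a. \<Prod>i\<in>S. a ((), i)) (\<lambda>a. \<Otimes>i\<in>S. a ((), i))"
          by (intro pfun_prod[where e = "\<lambda>_. 1"] pfun.var) (use S[of S] in auto)
      qed
    qed
    then show "\<exists>g. pfun R (\<lambda>_. 1) ({} \<union> {()} \<times> {..<N}) (m * n) (f N) g"
      unfolding f_def esym_def by auto
  next
    fix N and p :: "nat \<Rightarrow> nat" and a :: "unit \<times> nat \<Rightarrow> int" assume p: "p permutes {..<N}"
    let ?S = "{S. S \<subseteq> {..<N} \<and> card S = n}"
    have inj: "inj_on p S" for S using p by (rule permutes_inj_on)
    have img: "(`) p ` ?S = ?S"
    proof (intro equalityI subsetI)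
      fix S assume S: "S \<in> ?S"
      have "p ` (inv_into UNIV p ` S) = S" using p by (simp add: permutes_surj surj_f_inv_f image_comp)
      moreover have "inv_into UNIV p ` S \<in> ?S"
        using S permutes_in_image[OF permutes_inv[OF p]] permutes_inj_on[OF permutes_inv[OF p]]
        by (auto simp: card_image)
      ultimately show "S \<in> (`) p ` ?S" by (metis imageI)
    qed (use permutes_in_image[OF p] inj in \<open>auto simp: card_image\<close>)
    have "f N a = esym m ((`) p ` ?S) (\<lambda>S. \<Prod>i\<in>S. a ((), i))" unfolding f_def img ..
    also have "\<dots> = esym m ?S (\<lambda>S. \<Prod>i\<in>p ` S. a ((), i))"
      by (rule esym_reindex) (auto simp: inj_on_def inj_image_eq_iff[OF permutes_inj[OF p]])
    also have "\<dots> = f N (vperm () p a)"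
      unfolding f_def by (rule esym_cong) (auto simp: prod.reindex inj)
    finally show "f N (vperm () p a) = f N a" ..
  next
    fix N and a :: "unit \<times> nat \<Rightarrow> int" assume a: "a ((), N) = 0"
    show "f (Suc N) a = f N a" unfolding f_def
    proof (rule esym_mono_neutral)
      fix S assume S: "S \<in> {S. S \<subseteq> {..<Suc N} \<and> card S = n} - {S. S \<subseteq> {..<N} \<and> card S = n}"
      then have "N \<in> S" "finite S" by (auto simp: less_Suc_eq intro: finite_subset[of S "{..<Suc N}"])
      then show "(\<Prod>i\<in>S. a ((), i)) = 0" using a by (intro prod_zero) auto
    qed auto
  qed auto
  then obtain F G where F: "pfun R (\<lambda>_. 0) ({()} \<times> {1..m * n}) 0 F G" "\<And>N a. f N a = F (esub () N a)"
    by auto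
  let ?F = "\<lambda>a. F (\<lambda>v. a (snd v))"
  have "pfun R (\<lambda>_. 0) {1..m * n} 0 ?F (\<lambda>a. G (\<lambda>v. a (snd v)))"
    by (rule pfun_compose[OF F(1)]) (auto intro: pfun.var)
  moreover have "?F (\<lambda>k. esym k {..<N} x) = esym m {S. S \<subseteq> {..<N} \<and> card S = n} (\<lambda>S. \<Prod>i\<in>S. x i)" for N :: nat and x
  proof -
    have "esub () N (\<lambda>v. x (snd v)) = (\<lambda>v. esym (snd v) {..<N} x)" by (auto simp: esub_def)
    then show ?thesis using F(2)[of N "\<lambda>v. x (snd v)"] by (simp add: f_def)
  qed
  ultimately show ?thesis by blast
qed

lemma Pcomp_unique:
  assumes "is_Pcomp m n Q" "pfun R (\<lambda>_. 0) {1..m * n} 0 F G"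
    "\<And>x :: nat \<Rightarrow> int. F (\<lambda>k. esym k {..<m * n} x)
      = esym m {S. S \<subseteq> {..<m * n} \<and> card S = n} (\<lambda>S. \<Prod>i\<in>S. x i)"
  shows "ieval {1..m * n} Q a = F a"
proof -
  define D where "D = (\<lambda>a :: unit \<times> nat \<Rightarrow> int. ieval {1..m * n} Q (\<lambda>k. a ((), k)) - F (\<lambda>k. a ((), k)))"
  have "pfun R (\<lambda>_. 0) {1..m * n} 0 (\<lambda>a. ieval {1..m * n} Q a - F a) (\<lambda>a. reval R {1..m * n} Q a \<ominus> G a)"
    by (rule pfun_diff[OF pfun_ieval assms(2)]) simp
  then have "pfun R (\<lambda>_. 0) (UNIV \<times> {1..m * n}) 0 D (\<lambda>a. reval R {1..m * n} Q (\<lambda>k. a ((), k)) \<ominus> G (\<lambda>k. a ((), k)))"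
    unfolding D_def by (rule pfun_compose) (auto intro: pfun.var)
  then have "D (\<lambda>v. a (snd v)) = 0"
  proof (rule esub_independent')
    show "D (esub () (m * n) b) = 0" for b
      using assms(1,3) by (simp add: D_def is_Pcomp_def)
  qed auto
  then show ?thesis by (simp add: D_def)
qed

end

section \<open>Existence, and validity for arbitrary finite families of roots\<close>

lemma Pprod_exists: "\<exists>Q. is_Pprod n Q"
proof -
  \<comment> \<open>Only the integer function matters; \<open>INTEG\<close> supplies the ring that
    \<open>pfun\<close> carries along.\<close>
  obtain F G where F: "pfun INTEG (\<lambda>_. 0) (UNIV \<times> {1..n}) 0 F G"
    "\<And>I J (x :: nat \<Rightarrow> int) (y :: nat \<Rightarrow> int). finite I \<Longrightarrow> finite J \<Longrightarrow>
      F (prod_point (\<lambda>k. esym k I x) (\<lambda>k. esym k J y)) = esym n (I \<times> J) (\<lambda>(i, j). x i * y j)"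
    using cring.Pprod_function[OF INTEG_cring] by blast
  obtain Q where Q: "ieval (UNIV \<times> {1..n}) Q = F" using pfun_imp_ieval[OF F(1)] by auto
  then have "is_Pprod n Q" unfolding is_Pprod_iff using F(2) by simp
  then show ?thesis ..
qed

lemma Pcomp_exists: "\<exists>Q. is_Pcomp m n Q"
proof -
  obtain F G where F: "pfun INTEG (\<lambda>_. 0) {1..m * n} 0 F G"
    "\<And>(N :: nat) x. F (\<lambda>k. esym k {..<N} x) = esym m {S. S \<subseteq> {..<N} \<and> card S = n} (\<lambda>S. \<Prod>i\<in>S. x i)"
    using cring.Pcomp_function[OF INTEG_cring] by blast
  obtain Q where Q: "ieval {1..m * n} Q = F" using pfun_imp_ieval[OF F(1)] by auto
  then have "is_Pcomp m n Q" unfolding is_Pcomp_def using F(2) by simp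
  then show ?thesis ..
qed

text \<open>\<open>is_Pprod\<close> tests exactly \<open>n\<close> roots in each group. Uniqueness
  identifies \<open>Q\<close> with the polynomial function that serves all numbers of roots, and
  enumerations of \<open>I\<close> and \<open>J\<close> do the rest.\<close>

lemma Pprod_eval:
  assumes "is_Pprod n Q" "finite I" "finite J"
  shows "ieval (UNIV \<times> {1..n}) Q (prod_point (\<lambda>k. esym k I x) (\<lambda>k. esym k J y))
    = esym n (I \<times> J) (\<lambda>(i, j). x i * y j)"
proof -
  obtain F G where F: "pfun INTEG (\<lambda>_. 0) (UNIV \<times> {1..n}) 0 F G"
    "\<And>I J (x :: nat \<Rightarrow> int) (y :: nat \<Rightarrow> int). finite I \<Longrightarrow> finite J \<Longrightarrow>
      F (prod_point (\<lambda>k. esym k I x) (\<lambda>k. esym k J y)) = esym n (I \<times> J) (\<lambda>(i, j). x i * y j)"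
    using cring.Pprod_function[OF INTEG_cring] by blast
  have Q: "ieval (UNIV \<times> {1..n}) Q a = F a" for a
    by (rule cring.Pprod_unique[OF INTEG_cring assms(1) F(1)]) (rule F(2); simp)
  obtain g h where g: "bij_betw g {..<card I} I" and h: "bij_betw h {..<card J} J"
    using exists_bij_lessThan assms by metis
  have inj: "inj_on g {..<card I}" "inj_on h {..<card J}" and img: "g ` {..<card I} = I" "h ` {..<card J} = J"
    using g h by (auto simp: bij_betw_def)
  have "esym n (I \<times> J) (\<lambda>(i, j). x i * y j) = esym n (map_prod g h ` ({..<card I} \<times> {..<card J})) (\<lambda>(i, j). x i * y j)"
    using img by (simp add: map_prod_surj_on[OF refl refl])
  also have "\<dots> = esym n ({..<card I} \<times> {..<card J}) (\<lambda>p. case map_prod g h p of (i, j) \<Rightarrow> x i * y j)"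
    by (rule esym_reindex) (use inj in \<open>auto intro: map_prod_inj_on\<close>)
  also have "\<dots> = esym n ({..<card I} \<times> {..<card J}) (\<lambda>(i, j). x (g i) * y (h j))"
    by (rule esym_cong) auto
  also have "\<dots> = F (prod_point (\<lambda>k. esym k {..<card I} (\<lambda>i. x (g i))) (\<lambda>k. esym k {..<card J} (\<lambda>i. y (h i))))"
    by (simp add: F(2))
  also have "(\<lambda>k. esym k {..<card I} (\<lambda>i. x (g i))) = (\<lambda>k. esym k I x)"
    using esym_reindex[OF inj(1), of _ x] img by auto
  also have "(\<lambda>k. esym k {..<card J} (\<lambda>i. y (h i))) = (\<lambda>k. esym k J y)"
    using esym_reindex[OF inj(2), of _ y] img by auto
  finally show ?thesis using Q by simp
qed

lemma Pcomp_eval: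
  assumes "is_Pcomp m n Q" "finite I"
  shows "ieval {1..m * n} Q (\<lambda>k. esym k I x) = esym m {S. S \<subseteq> I \<and> card S = n} (\<lambda>S. \<Prod>i\<in>S. x i)"
proof -
  obtain F G where F: "pfun INTEG (\<lambda>_. 0) {1..m * n} 0 F G"
    "\<And>(N :: nat) x. F (\<lambda>k. esym k {..<N} x) = esym m {S. S \<subseteq> {..<N} \<and> card S = n} (\<lambda>S. \<Prod>i\<in>S. x i)"
    using cring.Pcomp_function[OF INTEG_cring] by blast
  have Q: "ieval {1..m * n} Q a = F a" for a
    by (rule cring.Pcomp_unique[OF INTEG_cring assms(1) F(1)]) (rule F(2))
  obtain h where h: "bij_betw h {..<card I} I" using exists_bij_lessThan[OF assms(2)] ..
  then have inj: "inj_on h {..<card I}" and img: "h ` {..<card I} = I" by (auto simp: bij_betw_def)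
  let ?S = "{S. S \<subseteq> {..<card I} \<and> card S = n}"
  have injS: "inj_on h S" if "S \<subseteq> {..<card I}" for S using inj that by (rule inj_on_subset)
  have "(`) h ` ?S = {S. S \<subseteq> I \<and> card S = n}"
  proof (intro equalityI subsetI)
    fix S assume S: "S \<in> {S. S \<subseteq> I \<and> card S = n}"
    then obtain T where "T \<subseteq> {..<card I}" "S = h ` T"
      using img by (metis (mono_tags, lifting) mem_Collect_eq subset_imageE)
    then show "S \<in> (`) h ` ?S" using S injS by (auto simp: card_image)
  qed (use img injS in \<open>auto simp: card_image\<close>)
  then have "esym m {S. S \<subseteq> I \<and> card S = n} (\<lambda>S. \<Prod>i\<in>S. x i) = esym m ((`) h ` ?S) (\<lambda>S. \<Prod>i\<in>S. x i)" by simp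
  also have "\<dots> = esym m ?S (\<lambda>S. \<Prod>i\<in>h ` S. x i)"
    by (rule esym_reindex) (auto simp: inj_on_def inj_on_image_eq_iff[OF inj] finite_subsets_card)
  also have "\<dots> = esym m ?S (\<lambda>S. \<Prod>i\<in>S. x (h i))"
    by (rule esym_cong) (auto simp: prod.reindex injS)
  also have "\<dots> = F (\<lambda>k. esym k {..<card I} (\<lambda>i. x (h i)))" by (simp add: F(2))
  also have "(\<lambda>k. esym k {..<card I} (\<lambda>i. x (h i))) = (\<lambda>k. esym k I x)"
    using esym_reindex[OF inj, of _ x] img by auto
  finally show ?thesis using Q by simp
qed

section \<open>Identities between the universal polynomials\<close>

definition esubs :: "'s set \<Rightarrow> nat \<Rightarrow> ('s \<times> nat \<Rightarrow> int) \<Rightarrow> 's \<times> nat \<Rightarrow> int" where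
  "esubs T N a = (\<lambda>(t, k). if t \<in> T then esym k {..<N} (\<lambda>i. a (t, i)) else a (t, k))"

lemma esubs_insert: "s \<notin> T \<Longrightarrow> esubs (insert s T) N a = esub s N (esubs T N a)"
  by (auto simp: esubs_def esub_def)

definition conv :: "('a, 'm) ring_scheme \<Rightarrow> (nat \<Rightarrow> 'a) \<Rightarrow> (nat \<Rightarrow> 'a) \<Rightarrow> nat \<Rightarrow> 'a" where
  "conv R a b n = (\<Oplus>\<^bsub>R\<^esub> i\<in>{..n}. a i \<otimes>\<^bsub>R\<^esub> b (n - i))"

definition delta :: "('a, 'm) ring_scheme \<Rightarrow> nat \<Rightarrow> 'a" where
  "delta R n = (if n = 0 then \<one>\<^bsub>R\<^esub> else \<zero>\<^bsub>R\<^esub>)"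

text \<open>The multiplicative group of power series with constant term 1.\<close>

definition seqs :: "('a, 'm) ring_scheme \<Rightarrow> (nat \<Rightarrow> 'a) monoid" where
  "seqs R = \<lparr>carrier = {a. a 0 = \<one>\<^bsub>R\<^esub> \<and> (\<forall>n. a n \<in> carrier R)}, monoid.mult = conv R, one = delta R\<rparr>"

text \<open>Substitution of \<open>u t\<close> for \<open>t\<close>; on the total operation of
  \<open>x\<close> this is the effect of multiplying \<open>x\<close> by a line element
  \<open>u\<close>.\<close>

definition scale :: "('a, 'm) ring_scheme \<Rightarrow> 'a \<Rightarrow> (nat \<Rightarrow> 'a) \<Rightarrow> nat \<Rightarrow> 'a" where
  "scale R u a n = u [^]\<^bsub>R\<^esub> n \<otimes>\<^bsub>R\<^esub> a n"

definition Pprod :: "nat \<Rightarrow> (bool \<times> nat) ipoly" where "Pprod n = (SOME Q. is_Pprod n Q)"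
definition Pcomp :: "nat \<Rightarrow> nat \<Rightarrow> nat ipoly" where "Pcomp m n = (SOME Q. is_Pcomp m n Q)"

lemma is_Pprod: "is_Pprod n (Pprod n)"
  unfolding Pprod_def by (rule someI_ex[OF Pprod_exists])

lemma is_Pcomp: "is_Pcomp m n (Pcomp m n)"
  unfolding Pcomp_def by (rule someI_ex[OF Pcomp_exists])

text \<open>The product of the ring of power series with constant term 1 whose addition is
  \<open>conv\<close>: roots multiply pairwise.\<close>

definition prd :: "('a, 'm) ring_scheme \<Rightarrow> (nat \<Rightarrow> 'a) \<Rightarrow> (nat \<Rightarrow> 'a) \<Rightarrow> nat \<Rightarrow> 'a" where
  "prd R a b n = reval R (UNIV \<times> {1..n}) (Pprod n) (prod_point a b)"

text \<open>The order of arguments makes \<open>cmp R a n\<close> a series, the total operation of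
  \<open>\<lambda>^n(x)\<close> when \<open>a\<close> is that of \<open>x\<close>.\<close>

definition cmp :: "('a, 'm) ring_scheme \<Rightarrow> (nat \<Rightarrow> 'a) \<Rightarrow> nat \<Rightarrow> nat \<Rightarrow> 'a" where
  "cmp R a n m = reval R {1..m * n} (Pcomp m n) a"

text \<open>The integer counterparts live on \<open>fps\<close>, where the ring laws for power
  series are at hand.\<close>

definition iprd :: "int fps \<Rightarrow> int fps \<Rightarrow> int fps" where
  "iprd f g = Abs_fps (\<lambda>n. ieval (UNIV \<times> {1..n}) (Pprod n) (prod_point (fps_nth f) (fps_nth g)))"

definition icmp :: "int fps \<Rightarrow> nat \<Rightarrow> int fps" where
  "icmp f n = Abs_fps (\<lambda>m. ieval {1..m * n} (Pcomp m n) (fps_nth f))"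

definition efps :: "'i set \<Rightarrow> ('i \<Rightarrow> int) \<Rightarrow> int fps" where
  "efps I x = Abs_fps (\<lambda>k. esym k I x)"

lemma efps_nth [simp]: "fps_nth (efps I x) k = esym k I x"
  by (simp add: efps_def)

lemma efps_prod: "finite I \<Longrightarrow> efps I x = (\<Prod>i\<in>I. lin (x i))"
  by (rule fps_ext) (simp add: esym_fps)

lemma efps_union: "finite I \<Longrightarrow> finite J \<Longrightarrow> I \<inter> J = {} \<Longrightarrow> efps (I \<union> J) x = efps I x * efps J x"
  by (simp add: efps_prod prod.union_disjoint)

lemma efps_reindex: "inj_on h I \<Longrightarrow> finite I \<Longrightarrow> efps (h ` I) x = efps I (\<lambda>i. x (h i))"
  by (rule fps_ext) (simp add: esym_reindex)

lemma efps_cong: "I = J \<Longrightarrow> (\<And>i. i \<in> J \<Longrightarrow> x i = y i) \<Longrightarrow> efps I x = efps J y"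
  unfolding efps_def by (intro arg_cong[of _ _ Abs_fps] ext esym_cong)

text \<open>Because \<open>Pprod_eval\<close> holds for all finite families, identities between
  universal polynomials reduce to bijections between index sets of roots.\<close>

lemma iprd_efps:
  "finite I \<Longrightarrow> finite J \<Longrightarrow> iprd (efps I x) (efps J y) = efps (I \<times> J) (\<lambda>(i, j). x i * y j)"
  by (rule fps_ext) (simp add: iprd_def efps_def fps_nth_Abs_fps[abs_def] Pprod_eval[OF is_Pprod] del: One_nat_def)

lemma icmp_efps:
  assumes "finite I"
  shows "icmp (efps I x) n = efps {S. S \<subseteq> I \<and> card S = n} (\<lambda>S. \<Prod>i\<in>S. x i)"
  by (rule fps_ext) (use assms in \<open>simp add: icmp_def efps_def fps_nth_Abs_fps[abs_def] Pcomp_eval[OF is_Pcomp] del: One_nat_def\<close>)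

lemma conv_cong: "(\<And>k. a k = a' k) \<Longrightarrow> (\<And>k. b k = b' k) \<Longrightarrow> conv R a b n = conv R a' b' n"
  by (simp add: conv_def)

section \<open>Reduction of identities in a commutative ring to split series\<close>

context cring
begin

lemma minus_eq_zero_iff:
  assumes "a \<in> carrier R" "b \<in> carrier R"
  shows "a \<ominus> b = \<zero> \<longleftrightarrow> a = b"
  using assms by (metis a_minus_def add.inv_closed minus_equality r_neg)

lemma esubs_independent:
  assumes "finite T" "pfun R (\<lambda>_. 0) V 0 F G" "\<And>t k. t \<in> T \<Longrightarrow> (t, k) \<in> V \<Longrightarrow> 1 \<le> k \<and> k \<le> N"
    "\<And>a. F (esubs T N a) = 0"
  shows "F a = 0"
  using assms
proof (induction T arbitrary: V F G a rule: finite_induct)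
  case empty
  then show ?case by (simp add: esubs_def)
next
  case (insert s T)
  obtain K where K: "pfun R (\<lambda>_. 0) ({v\<in>V. fst v \<noteq> s} \<union> {s} \<times> {..<N}) 0 (\<lambda>a. F (esub s N a)) K"
    using pfun_esub[OF insert.prems(1), of N "\<lambda>_. 0" s 0] by auto
  have "F (esub s N b) = 0" for b
    by (rule insert.IH[OF K]) (use insert.prems(2,3) insert.hyps in \<open>auto simp: esubs_insert\<close>)
  then show ?case by (rule esub_independent'[OF insert.prems(1)]) (use insert.prems(2) in auto)
qed

text \<open>The variable \<open>(s, k)\<close> stands for coefficient \<open>k\<close> of the
  unknown series number \<open>s\<close>. The finite set of variables is hidden because it grows
  under composition.\<close>

definition pf :: "((nat \<times> nat \<Rightarrow> int) \<Rightarrow> int) \<Rightarrow> ((nat \<times> nat \<Rightarrow> 'a) \<Rightarrow> 'a) \<Rightarrow> bool" where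
  "pf F G \<longleftrightarrow> (\<exists>V. finite V \<and> pfun R (\<lambda>_. 0) V 0 F G)"

text \<open>Split series suffice as tests: with enough roots their coefficients are algebraically
  independent up to any given index, and an identity of integer polynomials passes to
  \<open>R\<close>. Constant coefficients are 1 on both sides and are substituted, not left
  free.\<close>

theorem pf_transfer:
  assumes "pf F G" "pf F' G'"
    "\<And>x N :: nat. F (\<lambda>(s, k). esym k {..<N} (x s)) = F' (\<lambda>(s, k). esym k {..<N} (x s))"
    "\<And>v. a v \<in> carrier R" "\<And>s. a (s, 0) = \<one>"
  shows "G a = G' a"
proof -
  obtain V1 V2 where V12: "finite V1" "pfun R (\<lambda>_. 0) V1 0 F G" "finite V2" "pfun R (\<lambda>_. 0) V2 0 F' G'"
    using assms(1,2) unfolding pf_def by blast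
  let ?V = "V1 \<union> V2"
  let ?W = "{v\<in>?V. snd v \<noteq> 0}"
  have "pfun R (\<lambda>_. 0) ?V 0 F G" "pfun R (\<lambda>_. 0) ?V 0 F' G'"
    using V12 by (auto intro: pfun_mono)
  then have pD: "pfun R (\<lambda>_. 0) ?V 0 (\<lambda>a. F a - F' a) (\<lambda>a. G a \<ominus> G' a)"
    by (rule pfun_diff)
  let ?n = "\<lambda>a v. if snd v = 0 then 1 else a v"
  have p0: "pfun R (\<lambda>_. 0) ?W 0 (\<lambda>a. F (?n a) - F' (?n a)) (\<lambda>a. G (\<lambda>v. if snd v = 0 then \<one> else a v) \<ominus> G' (\<lambda>v. if snd v = 0 then \<one> else a v))"
  proof (rule pfun_compose[OF pD])
    show "pfun R (\<lambda>_. 0) ?W 0 (\<lambda>a. if snd v = 0 then 1 else a v) (\<lambda>a. if snd v = 0 then \<one> else a v)"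
      if "v \<in> ?V" for v
      using that by (cases "snd v = 0") (simp_all add: pfun_one pfun.var)
  qed
  have "finite ?W" using V12 by auto
  \<comment> \<open>As many roots in each group as the largest index that occurs, so that
    independence covers all variables.\<close>
  define N where "N = Max (insert 0 (snd ` ?V))"
  have N: "snd v \<le> N" if "v \<in> ?V" for v
    unfolding N_def by (rule Max_ge) (use that V12 in auto)
  have "F (?n b) - F' (?n b) = 0" for b
  proof (rule esubs_independent[OF _ p0])
    show "finite (fst ` ?V)" using V12 by auto
    show "1 \<le> k \<and> k \<le> N" if "(t, k) \<in> ?W" for t k using that N[of "(t, k)"] by auto
    fix b :: "nat \<times> nat \<Rightarrow> int"
    let ?e = "\<lambda>(s, k). esym k {..<N} (\<lambda>i. b (s, i))"
    have "?n (esubs (fst ` ?V) N b) v = ?e v" if "v \<in> ?V" for v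
    proof (cases "snd v = 0")
      case False
      then show ?thesis using that by (force simp: esubs_def split: prod.split)
    qed (simp add: case_prod_unfold)
    then have "F (?n (esubs (fst ` ?V) N b)) - F' (?n (esubs (fst ` ?V) N b)) = F ?e - F' ?e"
      by (rule pfun_agree[OF pD])
    then show "F (?n (esubs (fst ` ?V) N b)) - F' (?n (esubs (fst ` ?V) N b)) = 0"
      using assms(3)[of N "\<lambda>s i. b (s, i)"] by simp
  qed
  then have "G (\<lambda>v. if snd v = 0 then \<one> else a v) \<ominus> G' (\<lambda>v. if snd v = 0 then \<one> else a v) = \<zero>"
    using pfun_transfer[OF p0 \<open>finite ?W\<close>] assms(4) by auto
  moreover have "(\<lambda>v. if snd v = 0 then \<one> else a v) = a" using assms(5) by (auto simp: fun_eq_iff)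
  moreover have "G a \<in> carrier R" "G' a \<in> carrier R"
    using pfun_closed[OF V12(2)] pfun_closed[OF V12(4)] assms(4) by auto
  ultimately show ?thesis by (simp add: minus_eq_zero_iff)
qed

lemma pf_zero: "pf (\<lambda>a. 0) (\<lambda>a. \<zero>)"
  unfolding pf_def by (intro exI[of _ "{}"] conjI pfun_zero) simp

lemma pf_one: "pf (\<lambda>a. 1) (\<lambda>a. \<one>)"
  unfolding pf_def by (intro exI[of _ "{}"] conjI pfun_one) simp

lemma pf_var: "pf (\<lambda>a. a v) (\<lambda>a. a v)"
  unfolding pf_def by (intro exI[of _ "{v}"]) (auto intro: pfun.var)

lemma pf_compose:
  assumes "finite V" "pfun R (\<lambda>_. 0) V 0 F G" "\<And>v. v \<in> V \<Longrightarrow> pf (P v) (Q v)"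
  shows "pf (\<lambda>a. F (\<lambda>v. P v a)) (\<lambda>a. G (\<lambda>v. Q v a))"
proof -
  have "\<forall>v\<in>V. \<exists>W. finite W \<and> pfun R (\<lambda>_. 0) W 0 (P v) (Q v)" using assms(3) unfolding pf_def by blast
  from bchoice[OF this] obtain W where W: "\<And>v. v \<in> V \<Longrightarrow> finite (W v) \<and> pfun R (\<lambda>_. 0) (W v) 0 (P v) (Q v)"
    by blast
  have "pfun R (\<lambda>_. 0) (\<Union>v\<in>V. W v) 0 (\<lambda>a. F (\<lambda>v. P v a)) (\<lambda>a. G (\<lambda>v. Q v a))"
  proof (rule pfun_compose[OF assms(2)])
    show "pfun R (\<lambda>_. 0) (\<Union>v\<in>V. W v) 0 (P v) (Q v)" if "v \<in> V" for v
      using W[OF that] by (auto intro: pfun_mono that)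
  qed
  moreover have "finite (\<Union>v\<in>V. W v)" using assms(1) W by auto
  ultimately show ?thesis unfolding pf_def by blast
qed

lemma pf_mult:
  assumes "pf F G" "pf F' G'" shows "pf (\<lambda>a. F a * F' a) (\<lambda>a. G a \<otimes> G' a)"
proof -
  obtain V1 V2 where "finite V1" "pfun R (\<lambda>_. 0) V1 0 F G" "finite V2" "pfun R (\<lambda>_. 0) V2 0 F' G'"
    using assms unfolding pf_def by blast
  then have *: "finite (V1 \<union> V2)" "pfun R (\<lambda>_. 0) (V1 \<union> V2) 0 F G" "pfun R (\<lambda>_. 0) (V1 \<union> V2) 0 F' G'"
    by (auto intro: pfun_mono)
  have "pfun R (\<lambda>_. 0) (V1 \<union> V2) 0 (\<lambda>a. F a * F' a) (\<lambda>a. G a \<otimes> G' a)"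
    by (rule pfun.mult[OF *(2,3)]) simp_all
  with *(1) show ?thesis unfolding pf_def by (intro exI conjI)
qed

lemma pf_sum:
  assumes "finite I" "\<And>i. i \<in> I \<Longrightarrow> pf (F i) (G i)"
  shows "pf (\<lambda>a. \<Sum>i\<in>I. F i a) (\<lambda>a. \<Oplus>i\<in>I. G i a)"
  by (rule pf_compose[where F = "\<lambda>b. \<Sum>i\<in>I. b i" and G = "\<lambda>b. \<Oplus>i\<in>I. b i" and V = I])
    (use assms in \<open>auto intro!: pfun_sum pfun.var\<close>)

lemma pf_power: "pf F G \<Longrightarrow> pf (\<lambda>a. F a ^ n) (\<lambda>a. G a [^] n)"
  unfolding pf_def using pfun_power[of _ _ 0 F G n 0] by force

lemma pf_conv:
  assumes "\<And>k. pf (\<lambda>a. fps_nth (F a) k) (\<lambda>a. G a k)" "\<And>k. pf (\<lambda>a. fps_nth (F' a) k) (\<lambda>a. G' a k)"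
  shows "pf (\<lambda>a. fps_nth (F a * F' a) n) (\<lambda>a. conv R (G a) (G' a) n)"
  unfolding conv_def fps_mult_nth atLeast0AtMost by (intro pf_sum pf_mult assms) auto

lemma pf_prd:
  assumes "\<And>k. pf (\<lambda>a. fps_nth (F a) k) (\<lambda>a. G a k)" "\<And>k. pf (\<lambda>a. fps_nth (F' a) k) (\<lambda>a. G' a k)"
  shows "pf (\<lambda>a. fps_nth (iprd (F a) (F' a)) n) (\<lambda>a. prd R (G a) (G' a) n)"
proof -
  have "pf (\<lambda>a. ieval (UNIV \<times> {1..n}) (Pprod n) (\<lambda>v. prod_point (fps_nth (F a)) (fps_nth (F' a)) v))
      (\<lambda>a. reval R (UNIV \<times> {1..n}) (Pprod n) (\<lambda>v. prod_point (G a) (G' a) v))"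
  proof (rule pf_compose[OF _ pfun_ieval])
    show "pf (\<lambda>a. prod_point (fps_nth (F a)) (fps_nth (F' a)) v) (\<lambda>a. prod_point (G a) (G' a) v)" for v
      by (cases v; cases "fst v") (simp_all add: prod_point_def assms)
  qed simp_all
  then show ?thesis by (simp add: iprd_def prd_def)
qed

lemma pf_cmp:
  assumes "\<And>k. pf (\<lambda>a. fps_nth (F a) k) (\<lambda>a. G a k)"
  shows "pf (\<lambda>a. fps_nth (icmp (F a) n) m) (\<lambda>a. cmp R (G a) n m)"
proof -
  have "pf (\<lambda>a. ieval {1..m * n} (Pcomp m n) (\<lambda>v. fps_nth (F a) v)) (\<lambda>a. reval R {1..m * n} (Pcomp m n) (\<lambda>v. G a v))"
    by (rule pf_compose[OF _ pfun_ieval]) (use assms in auto)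
  then show ?thesis by (simp add: icmp_def cmp_def)
qed

lemma pf_delta: "pf (\<lambda>a. fps_nth 1 k) (\<lambda>a. delta R k)"
  by (cases "k = 0") (simp_all add: delta_def pf_one pf_zero)

definition sq :: "nat \<Rightarrow> (nat \<times> nat \<Rightarrow> int) \<Rightarrow> int fps" where "sq s a = Abs_fps (\<lambda>k. a (s, k))"

lemma pf_seq: "pf (\<lambda>a. fps_nth (sq s a) k) (\<lambda>a. a (s, k))"
  by (simp add: sq_def pf_var)

text \<open>Tagging the roots by \<open>s\<close> keeps the root sets of different series disjoint,
  as the product formula for unions requires.\<close>

lemma sq_esym: "sq s (\<lambda>(s, k). esym k {..<N :: nat} (x s)) = efps ({s} \<times> {..<N}) (\<lambda>(s, i). x s i)"
proof -
  have "{s} \<times> {..<N} = Pair s ` {..<N}" by auto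
  then show ?thesis by (auto simp: sq_def efps_def esym_reindex inj_on_def)
qed

lemma seqsI: "a 0 = \<one> \<Longrightarrow> (\<And>n. a n \<in> carrier R) \<Longrightarrow> a \<in> carrier (seqs R)"
  by (simp add: seqs_def)

lemma seqsD: "a \<in> carrier (seqs R) \<Longrightarrow> a 0 = \<one>" "a \<in> carrier (seqs R) \<Longrightarrow> a n \<in> carrier R"
  by (simp_all add: seqs_def)

lemma seqs_mult: "a \<otimes>\<^bsub>seqs R\<^esub> b = conv R a b" and seqs_one: "\<one>\<^bsub>seqs R\<^esub> = delta R"
  by (simp_all add: seqs_def)

lemma delta_closed: "delta R \<in> carrier (seqs R)"
  by (auto simp: seqs_def delta_def)

lemma conv_closed: "a \<in> carrier (seqs R) \<Longrightarrow> b \<in> carrier (seqs R) \<Longrightarrow> conv R a b \<in> carrier (seqs R)"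
  by (auto simp: seqs_def conv_def intro!: finsum_closed)

text \<open>The value \<one> beyond the list meets both demands of \<open>pf_transfer\<close>: all
  values lie in the carrier, and all constant coefficients are \<one>.\<close>

definition pack :: "(nat \<Rightarrow> 'a) list \<Rightarrow> nat \<times> nat \<Rightarrow> 'a" where
  "pack as = (\<lambda>(s, k). if s < length as then (as ! s) k else \<one>)"

lemma pack_closed: "set as \<subseteq> carrier (seqs R) \<Longrightarrow> pack as v \<in> carrier R"
  "set as \<subseteq> carrier (seqs R) \<Longrightarrow> pack as (s, 0) = \<one>"
  by (auto simp: pack_def seqs_def subset_iff split: prod.split)

lemma conv_comm:
  assumes "a \<in> carrier (seqs R)" "b \<in> carrier (seqs R)"
  shows "conv R a b = conv R b a"
proof
  fix n
  have "conv R (\<lambda>k. pack [a, b] (0, k)) (\<lambda>k. pack [a, b] (1, k)) n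
      = conv R (\<lambda>k. pack [a, b] (1, k)) (\<lambda>k. pack [a, b] (0, k)) n"
    by (rule pf_transfer[OF pf_conv[OF pf_seq[of 0] pf_seq[of 1]] pf_conv[OF pf_seq[of 1] pf_seq[of 0]]])
      (use assms in \<open>auto simp: mult.commute pack_closed\<close>)
  then show "conv R a b n = conv R b a n" by (simp add: pack_def)
qed

lemma conv_assoc:
  assumes "a \<in> carrier (seqs R)" "b \<in> carrier (seqs R)" "c \<in> carrier (seqs R)"
  shows "conv R (conv R a b) c = conv R a (conv R b c)"
proof
  fix n
  let ?p = "pack [a, b, c]"
  have "conv R (conv R (\<lambda>k. ?p (0, k)) (\<lambda>k. ?p (1, k))) (\<lambda>k. ?p (2, k)) n
      = conv R (\<lambda>k. ?p (0, k)) (conv R (\<lambda>k. ?p (1, k)) (\<lambda>k. ?p (2, k))) n"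
    by (rule pf_transfer[OF pf_conv[OF pf_conv[OF pf_seq[of 0] pf_seq[of 1]] pf_seq[of 2]]
          pf_conv[OF pf_seq[of 0] pf_conv[OF pf_seq[of 1] pf_seq[of 2]]]])
      (use assms in \<open>auto simp: mult.assoc pack_closed\<close>)
  then show "conv R (conv R a b) c n = conv R a (conv R b c) n" by (simp add: pack_def)
qed

lemma conv_delta:
  assumes "a \<in> carrier (seqs R)"
  shows "conv R (delta R) a = a"
proof
  fix n
  let ?p = "pack [a]"
  have "conv R (delta R) (\<lambda>k. ?p (0, k)) n = ?p (0, n)"
    by (rule pf_transfer[OF pf_conv[OF pf_delta pf_seq[of 0]] pf_seq[of 0]])
      (use assms in \<open>auto simp: pack_closed\<close>)
  then show "conv R (delta R) a n = a n" by (simp add: pack_def)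
qed

lemma seqs_comm_monoid: "comm_monoid (seqs R)"
proof (rule comm_monoidI)
  fix a b c assume "a \<in> carrier (seqs R)" "b \<in> carrier (seqs R)" "c \<in> carrier (seqs R)"
  then show "a \<otimes>\<^bsub>seqs R\<^esub> b \<otimes>\<^bsub>seqs R\<^esub> c = a \<otimes>\<^bsub>seqs R\<^esub> (b \<otimes>\<^bsub>seqs R\<^esub> c)"
    "\<one>\<^bsub>seqs R\<^esub> \<otimes>\<^bsub>seqs R\<^esub> a = a" "a \<otimes>\<^bsub>seqs R\<^esub> b \<in> carrier (seqs R)"
    by (simp_all add: seqs_mult seqs_one conv_assoc conv_closed conv_delta)
next
  fix a b assume "a \<in> carrier (seqs R)" "b \<in> carrier (seqs R)"
  then show "a \<otimes>\<^bsub>seqs R\<^esub> b = b \<otimes>\<^bsub>seqs R\<^esub> a"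
    by (simp add: seqs_mult conv_comm)
qed (simp add: seqs_one delta_closed)

end

text \<open>Codes a ring element as a series with constant term 1, so that it can be packed together
  with other series; it is read off at index 1.\<close>

definition useq :: "('a, 'm) ring_scheme \<Rightarrow> 'a \<Rightarrow> nat \<Rightarrow> 'a" where
  "useq R u k = (if k = 0 then \<one>\<^bsub>R\<^esub> else u)"

text \<open>The total \<open>\<lambda>\<close>-operation of a line element.\<close>

definition line :: "('a, 'm) ring_scheme \<Rightarrow> 'a \<Rightarrow> nat \<Rightarrow> 'a" where
  "line R u k = (if k = 0 then \<one>\<^bsub>R\<^esub> else if k = 1 then u else \<zero>\<^bsub>R\<^esub>)"

fun convs :: "('a, 'm) ring_scheme \<Rightarrow> (nat \<Rightarrow> nat \<Rightarrow> 'a) \<Rightarrow> nat \<Rightarrow> nat \<Rightarrow> 'a" where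
  "convs R f 0 = delta R"
| "convs R f (Suc n) = conv R (convs R f n) (f n)"

section \<open>Identities for split integer series\<close>

definition iscale :: "int \<Rightarrow> int fps \<Rightarrow> int fps" where
  "iscale c f = Abs_fps (\<lambda>k. c ^ k * fps_nth f k)"

lemma iscale_efps: "finite I \<Longrightarrow> iscale c (efps I x) = efps I (\<lambda>i. c * x i)"
  by (rule fps_ext) (simp add: iscale_def esym_scale)

lemma efps_empty [simp]: "efps {} x = 1"
  by (rule fps_ext) simp

lemma iprd_conv:
  assumes "finite I" "finite J" "finite K" "I \<inter> J = {}"
  shows "iprd (efps I x * efps J x) (efps K y) = iprd (efps I x) (efps K y) * iprd (efps J x) (efps K y)"
proof -
  have "iprd (efps I x * efps J x) (efps K y) = efps (I \<times> K \<union> J \<times> K) (\<lambda>(i, j). x i * y j)"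
    using assms by (simp add: efps_union[symmetric] iprd_efps Times_Un_distrib1)
  also have "\<dots> = efps (I \<times> K) (\<lambda>(i, j). x i * y j) * efps (J \<times> K) (\<lambda>(i, j). x i * y j)"
    by (rule efps_union) (use assms in auto)
  finally show ?thesis using assms by (simp add: iprd_efps)
qed

lemma iprd_comm:
  assumes "finite I" "finite J"
  shows "iprd (efps I x) (efps J y) = iprd (efps J y) (efps I x)"
proof -
  have "efps (I \<times> J) (\<lambda>(i, j). x i * y j) = efps (prod.swap ` (J \<times> I)) (\<lambda>(i, j). x i * y j)"
    by (rule efps_cong) auto
  also have "\<dots> = efps (J \<times> I) (\<lambda>p. case prod.swap p of (i, j) \<Rightarrow> x i * y j)"
    by (rule efps_reindex) (use assms in auto)
  also have "\<dots> = efps (J \<times> I) (\<lambda>(i, j). y i * x j)"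
    by (rule efps_cong) (auto simp: mult.commute)
  finally show ?thesis using assms by (simp add: iprd_efps)
qed

lemma iprd_scale:
  assumes "finite I" "finite J"
  shows "iprd (iscale c (efps I x)) (iscale d (efps J y)) = iscale (c * d) (iprd (efps I x) (efps J y))"
proof -
  have "efps (I \<times> J) (\<lambda>(i, j). c * x i * (d * y j)) = efps (I \<times> J) (\<lambda>p. c * d * (case p of (i, j) \<Rightarrow> x i * y j))"
    by (rule efps_cong) auto
  then show ?thesis using assms by (simp add: iscale_efps iprd_efps)
qed

lemma icmp_scale:
  assumes "finite I"
  shows "icmp (iscale c (efps I x)) n = iscale (c ^ n) (icmp (efps I x) n)"
proof -
  have "efps {S. S \<subseteq> I \<and> card S = n} (\<lambda>S. \<Prod>i\<in>S. c * x i)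
      = efps {S. S \<subseteq> I \<and> card S = n} (\<lambda>S. c ^ n * (\<Prod>i\<in>S. x i))"
    by (rule efps_cong) (auto simp: prod.distrib)
  then show ?thesis using assms by (simp add: iscale_efps icmp_efps finite_subsets_card)
qed

text \<open>A subset of the disjoint union splits uniquely into its parts in \<open>I\<close> and
  \<open>J\<close>. This is the addition formula for \<open>\<lambda>^n\<close>; its sum over
  \<open>i\<close> appears as a product because total operations of sums multiply.\<close>

lemma icmp_conv:
  assumes "finite I" "finite J" "I \<inter> J = {}"
  shows "icmp (efps I x * efps J x) n = (\<Prod>i<Suc n. iprd (icmp (efps I x) i) (icmp (efps J x) (n - i)))"
proof -
  let ?S = "\<lambda>I k. {S. S \<subseteq> I \<and> card S = k}"
  let ?u = "\<lambda>(S, T). S \<union> T"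
  have fin: "finite S" if "S \<subseteq> I \<or> S \<subseteq> J" for S using that assms finite_subset by blast
  have inj: "inj_on ?u (?S I i \<times> ?S J k)" for i k
  proof (rule inj_onI)
    fix p q assume p: "p \<in> ?S I i \<times> ?S J k" and q: "q \<in> ?S I i \<times> ?S J k" and eq: "?u p = ?u q"
    obtain S T S' T' where pq: "p = (S, T)" "q = (S', T')" by (cases p, cases q)
    have "S = (S \<union> T) \<inter> I" "S' = (S' \<union> T') \<inter> I" "T = (S \<union> T) \<inter> J" "T' = (S' \<union> T') \<inter> J"
      using p q pq assms(3) by auto
    moreover have "S \<union> T = S' \<union> T'" using eq pq by simp
    ultimately show "p = q" using pq by metis
  qed
  have dis: "(?u ` (?S I i \<times> ?S J (n - i))) \<inter> (?u ` (?S I k \<times> ?S J (n - k))) = {}" if "i \<noteq> k" for i k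
  proof -
    have c: "card (W \<inter> I) = i" if "W \<in> ?u ` (?S I i \<times> ?S J (n - i))" for W i
    proof -
      from that obtain p where p: "p \<in> ?S I i \<times> ?S J (n - i)" "W = ?u p" by blast
      obtain S T where ST: "p = (S, T)" by (cases p)
      have "W \<inter> I = S" using p ST assms(3) by auto
      then show ?thesis using p ST by simp
    qed
    show ?thesis
    proof (rule equals0I)
      fix W assume "W \<in> ?u ` (?S I i \<times> ?S J (n - i)) \<inter> ?u ` (?S I k \<times> ?S J (n - k))"
      from c[OF IntD1[OF this]] c[OF IntD2[OF this]] show False using that by simp
    qed
  qed
  have eq: "?S (I \<union> J) n = (\<Union>i\<in>{..<Suc n}. ?u ` (?S I i \<times> ?S J (n - i)))"
  proof (intro equalityI subsetI)
    fix W assume W: "W \<in> ?S (I \<union> J) n"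
    have U: "W = (W \<inter> I) \<union> (W \<inter> J)" using W by auto
    have "card ((W \<inter> I) \<union> (W \<inter> J)) = card (W \<inter> I) + card (W \<inter> J)"
      by (rule card_Un_disjoint) (use assms in auto)
    then have "card W = card (W \<inter> I) + card (W \<inter> J)" by (simp only: U[symmetric])
    then have c: "card (W \<inter> I) < Suc n" "card (W \<inter> J) = n - card (W \<inter> I)" using W by auto
    then have "(W \<inter> I, W \<inter> J) \<in> ?S I (card (W \<inter> I)) \<times> ?S J (n - card (W \<inter> I))" by auto
    moreover have "?u (W \<inter> I, W \<inter> J) = W" using U by auto
    ultimately have "W \<in> ?u ` (?S I (card (W \<inter> I)) \<times> ?S J (n - card (W \<inter> I)))" by (rule rev_image_eqI[OF _ sym])
    then show "W \<in> (\<Union>i\<in>{..<Suc n}. ?u ` (?S I i \<times> ?S J (n - i)))" using c(1) by blast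
  next
    fix W assume "W \<in> (\<Union>i\<in>{..<Suc n}. ?u ` (?S I i \<times> ?S J (n - i)))"
    then obtain i p where i: "i < Suc n" "p \<in> ?S I i \<times> ?S J (n - i)" "W = ?u p" by blast
    obtain S T where "p = (S, T)" by (cases p)
    with i have *: "i < Suc n" "S \<subseteq> I" "card S = i" "T \<subseteq> J" "card T = n - i" "W = S \<union> T" by auto
    have "card (S \<union> T) = card S + card T"
      by (rule card_Un_disjoint) (use * assms fin in auto)
    then show "W \<in> ?S (I \<union> J) n" using * by auto
  qed
  have finS: "finite (?S I i)" "finite (?S J i)" for i using assms by (auto simp: finite_subsets_card)
  have "icmp (efps I x * efps J x) n = efps (?S (I \<union> J) n) (\<lambda>S. \<Prod>i\<in>S. x i)"
    using assms by (simp add: efps_union[symmetric] icmp_efps)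
  also have "\<dots> = (\<Prod>S\<in>(\<Union>i\<in>{..<Suc n}. ?u ` (?S I i \<times> ?S J (n - i))). lin (\<Prod>i\<in>S. x i))"
    using assms by (simp only: efps_prod finite_subsets_card finite_UnI flip: eq)
  also have "\<dots> = (\<Prod>i<Suc n. \<Prod>S\<in>?u ` (?S I i \<times> ?S J (n - i)). lin (\<Prod>i\<in>S. x i))"
    by (rule prod.UNION_disjoint) (use finS dis in auto)
  also have "\<dots> = (\<Prod>i<Suc n. iprd (icmp (efps I x) i) (icmp (efps J x) (n - i)))"
  proof (rule prod.cong[OF refl])
    fix i
    have "(\<Prod>S\<in>?u ` (?S I i \<times> ?S J (n - i)). lin (\<Prod>i\<in>S. x i))
      = efps (?u ` (?S I i \<times> ?S J (n - i))) (\<lambda>S. \<Prod>i\<in>S. x i)"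
      by (rule efps_prod[symmetric]) (use finS in auto)
    also have "\<dots> = efps (?S I i \<times> ?S J (n - i)) (\<lambda>p. \<Prod>i\<in>?u p. x i)"
      by (rule efps_reindex[OF inj]) (use finS in auto)
    also have "\<dots> = efps (?S I i \<times> ?S J (n - i)) (\<lambda>(S, T). (\<Prod>i\<in>S. x i) * (\<Prod>i\<in>T. x i))"
    proof (rule efps_cong[OF refl])
      fix p assume "p \<in> ?S I i \<times> ?S J (n - i)"
      moreover obtain S T where "p = (S, T)" by (cases p)
      ultimately show "(\<Prod>i\<in>?u p. x i) = (case p of (S, T) \<Rightarrow> (\<Prod>i\<in>S. x i) * (\<Prod>i\<in>T. x i))"
        using assms(3) fin by (auto intro!: prod.union_disjoint)
    qed
    also have "\<dots> = iprd (icmp (efps I x) i) (icmp (efps J x) (n - i))"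
      using assms by (simp add: icmp_efps iprd_efps finite_subsets_card)
    finally show "(\<Prod>S\<in>?u ` (?S I i \<times> ?S J (n - i)). lin (\<Prod>i\<in>S. x i))
      = iprd (icmp (efps I x) i) (icmp (efps J x) (n - i))" .
  qed
  finally show ?thesis .
qed

lemma iprd_one: "finite I \<Longrightarrow> iprd (efps I x) 1 = 1"
  using iprd_efps[of I "{}" x] by simp

lemma lin_efps: "lin c = efps {0::nat} (\<lambda>_. c)"
  by (simp add: efps_prod)

text \<open>A single root has no subsets of two or more elements.\<close>

lemma icmp_lin: "2 \<le> n \<Longrightarrow> icmp (lin c) n = 1"
proof -
  assume n: "2 \<le> n"
  have "{S. S \<subseteq> {0::nat} \<and> card S = n} = {}"
  proof -
    have "card S \<noteq> n" if "S \<subseteq> {0}" for S :: "nat set" using card_mono[OF _ that] n by auto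
    then show ?thesis by blast
  qed
  then show ?thesis unfolding lin_efps by (simp only: icmp_efps finite.emptyI finite_insert efps_empty)
qed

section \<open>The same identities over an arbitrary commutative ring\<close>

context cring
begin

lemma pf_iscale:
  assumes "pf F G" "\<And>k. pf (\<lambda>a. fps_nth (H a) k) (\<lambda>a. K a k)"
  shows "pf (\<lambda>a. fps_nth (iscale (F a) (H a)) k) (\<lambda>a. scale R (G a) (K a) k)"
  by (simp add: iscale_def scale_def pf_mult pf_power assms)

lemma pf_lin:
  assumes "pf F G" shows "pf (\<lambda>a. fps_nth (lin (F a)) k) (\<lambda>a. line R (G a) k)"
proof -
  consider "k = 0" | "k = 1" | "k \<ge> 2" by linarith
  then show ?thesis
    by cases (use assms in \<open>simp_all add: line_def pf_one pf_zero\<close>)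
qed

lemma pf_convs:
  assumes "\<And>i k. pf (\<lambda>a. fps_nth (F i a) k) (\<lambda>a. G i a k)"
  shows "pf (\<lambda>a. fps_nth (\<Prod>i<n. F i a) k) (\<lambda>a. convs R (\<lambda>i. G i a) n k)"
proof (induction n arbitrary: k)
  case 0
  show ?case using pf_delta by simp
next
  case (Suc n)
  show ?case using pf_conv[OF Suc assms] by simp
qed

lemma useq_closed: "u \<in> carrier R \<Longrightarrow> useq R u \<in> carrier (seqs R)"
  by (auto simp: useq_def seqs_def)

lemma line_closed: "u \<in> carrier R \<Longrightarrow> line R u \<in> carrier (seqs R)"
  by (auto simp: line_def seqs_def)

lemma scale_closed: "u \<in> carrier R \<Longrightarrow> a \<in> carrier (seqs R) \<Longrightarrow> scale R u a \<in> carrier (seqs R)"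
  by (auto simp: scale_def seqs_def)

lemma convs_closed: "(\<And>i. f i \<in> carrier (seqs R)) \<Longrightarrow> convs R f n \<in> carrier (seqs R)"
  by (induction n) (auto intro: conv_closed delta_closed)

lemmas sq0 = pf_seq[of 0] and sq1 = pf_seq[of 1] and sq2 = pf_seq[of 2] and sq3 = pf_seq[of 3]

lemma finite_group: "finite ({s} \<times> {..<N :: nat})" by simp

lemma prd_conv:
  assumes "a \<in> carrier (seqs R)" "b \<in> carrier (seqs R)" "c \<in> carrier (seqs R)"
  shows "prd R (conv R a b) c = conv R (prd R a c) (prd R b c)"
proof
  fix n
  let ?p = "pack [a, b, c]"
  have "prd R (conv R (\<lambda>k. ?p (0, k)) (\<lambda>k. ?p (1, k))) (\<lambda>k. ?p (2, k)) n
      = conv R (prd R (\<lambda>k. ?p (0, k)) (\<lambda>k. ?p (2, k))) (prd R (\<lambda>k. ?p (1, k)) (\<lambda>k. ?p (2, k))) n"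
  proof (rule pf_transfer[OF pf_prd[OF pf_conv[OF sq0 sq1] sq2] pf_conv[OF pf_prd[OF sq0 sq2] pf_prd[OF sq1 sq2]]])
    fix x and N :: nat
    show "fps_nth (iprd (sq 0 (\<lambda>(s, k). esym k {..<N} (x s)) * sq 1 (\<lambda>(s, k). esym k {..<N} (x s)))
        (sq 2 (\<lambda>(s, k). esym k {..<N} (x s)))) n
      = fps_nth (iprd (sq 0 (\<lambda>(s, k). esym k {..<N} (x s))) (sq 2 (\<lambda>(s, k). esym k {..<N} (x s))) *
        iprd (sq 1 (\<lambda>(s, k). esym k {..<N} (x s))) (sq 2 (\<lambda>(s, k). esym k {..<N} (x s)))) n"
      unfolding sq_esym by (subst iprd_conv) auto
  qed (use assms in \<open>auto simp: pack_closed\<close>)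
  then show "prd R (conv R a b) c n = conv R (prd R a c) (prd R b c) n" by (simp add: pack_def)
qed

lemma prd_comm:
  assumes "a \<in> carrier (seqs R)" "b \<in> carrier (seqs R)"
  shows "prd R a b = prd R b a"
proof
  fix n
  let ?p = "pack [a, b]"
  have "prd R (\<lambda>k. ?p (0, k)) (\<lambda>k. ?p (1, k)) n = prd R (\<lambda>k. ?p (1, k)) (\<lambda>k. ?p (0, k)) n"
  proof (rule pf_transfer[OF pf_prd[OF sq0 sq1] pf_prd[OF sq1 sq0]])
    fix x and N :: nat
    show "fps_nth (iprd (sq 0 (\<lambda>(s, k). esym k {..<N} (x s))) (sq 1 (\<lambda>(s, k). esym k {..<N} (x s)))) n
      = fps_nth (iprd (sq 1 (\<lambda>(s, k). esym k {..<N} (x s))) (sq 0 (\<lambda>(s, k). esym k {..<N} (x s)))) n"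
      unfolding sq_esym by (subst iprd_comm) (rule finite_group refl)+
  qed (use assms in \<open>auto simp: pack_closed\<close>)
  then show "prd R a b n = prd R b a n" by (simp add: pack_def)
qed

lemma prd_scale:
  assumes "a \<in> carrier (seqs R)" "b \<in> carrier (seqs R)" "u \<in> carrier R" "v \<in> carrier R"
  shows "prd R (scale R u a) (scale R v b) = scale R (u \<otimes> v) (prd R a b)"
proof
  fix n
  let ?p = "pack [a, b, useq R u, useq R v]"
  have "prd R (scale R (?p (2, 1)) (\<lambda>k. ?p (0, k))) (scale R (?p (3, 1)) (\<lambda>k. ?p (1, k))) n
      = scale R (?p (2, 1) \<otimes> ?p (3, 1)) (prd R (\<lambda>k. ?p (0, k)) (\<lambda>k. ?p (1, k))) n"
    by (rule pf_transfer[OF pf_prd[OF pf_iscale[OF pf_var sq0] pf_iscale[OF pf_var sq1]]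
          pf_iscale[OF pf_mult[OF pf_var pf_var] pf_prd[OF sq0 sq1]]])
      (use assms in \<open>auto simp: pack_closed useq_closed sq_esym iprd_scale\<close>)
  then show "prd R (scale R u a) (scale R v b) n = scale R (u \<otimes> v) (prd R a b) n"
    by (simp add: pack_def useq_def)
qed

lemma cmp_scale:
  assumes "a \<in> carrier (seqs R)" "u \<in> carrier R"
  shows "cmp R (scale R u a) n = scale R (u [^] n) (cmp R a n)"
proof
  fix m
  let ?p = "pack [a, useq R u]"
  have "cmp R (scale R (?p (1, 1)) (\<lambda>k. ?p (0, k))) n m = scale R (?p (1, 1) [^] n) (cmp R (\<lambda>k. ?p (0, k)) n) m"
    by (rule pf_transfer[OF pf_cmp[OF pf_iscale[OF pf_var sq0]] pf_iscale[OF pf_power[OF pf_var] pf_cmp[OF sq0]]])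
      (use assms in \<open>auto simp: pack_closed useq_closed sq_esym icmp_scale\<close>)
  then show "cmp R (scale R u a) n m = scale R (u [^] n) (cmp R a n) m"
    by (simp add: pack_def useq_def)
qed

lemma cmp_conv:
  assumes "a \<in> carrier (seqs R)" "b \<in> carrier (seqs R)"
  shows "cmp R (conv R a b) n = convs R (\<lambda>i. prd R (cmp R a i) (cmp R b (n - i))) (Suc n)"
proof
  fix m
  let ?p = "pack [a, b]"
  have "cmp R (conv R (\<lambda>k. ?p (0, k)) (\<lambda>k. ?p (1, k))) n m
    = convs R (\<lambda>i. prd R (cmp R (\<lambda>k. ?p (0, k)) i) (cmp R (\<lambda>k. ?p (1, k)) (n - i))) (Suc n) m"
  proof (rule pf_transfer[OF pf_cmp[OF pf_conv[OF sq0 sq1]] pf_convs[OF pf_prd[OF pf_cmp[OF sq0] pf_cmp[OF sq1]]]])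
    fix x and N :: nat
    show "fps_nth (icmp (sq 0 (\<lambda>(s, k). esym k {..<N} (x s)) * sq 1 (\<lambda>(s, k). esym k {..<N} (x s))) n) m
      = fps_nth (\<Prod>i<Suc n. iprd (icmp (sq 0 (\<lambda>(s, k). esym k {..<N} (x s))) i)
          (icmp (sq 1 (\<lambda>(s, k). esym k {..<N} (x s))) (n - i))) m"
      unfolding sq_esym by (subst icmp_conv) auto
  qed (use assms in \<open>auto simp: pack_closed\<close>)
  then show "cmp R (conv R a b) n m = convs R (\<lambda>i. prd R (cmp R a i) (cmp R b (n - i))) (Suc n) m"
    by (simp add: pack_def)
qed

lemma prd_delta:
  assumes "a \<in> carrier (seqs R)"
  shows "prd R a (delta R) = delta R"
proof
  fix n
  let ?p = "pack [a]"
  have "prd R (\<lambda>k. ?p (0, k)) (delta R) n = delta R n"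
    by (rule pf_transfer[OF pf_prd[OF sq0 pf_delta] pf_delta])
      (use assms in \<open>auto simp: pack_closed sq_esym iprd_one\<close>)
  then show "prd R a (delta R) n = delta R n" by (simp add: pack_def)
qed

lemma cmp_line:
  assumes "u \<in> carrier R" "2 \<le> n"
  shows "cmp R (line R u) n = delta R"
proof
  fix m
  let ?p = "pack [useq R u]"
  have "cmp R (line R (?p (0, 1))) n m = delta R m"
    by (rule pf_transfer[OF pf_cmp[OF pf_lin[OF pf_var]] pf_delta])
      (use assms in \<open>auto simp: pack_closed useq_closed icmp_lin\<close>)
  then show "cmp R (line R u) n m = delta R m" by (simp add: pack_def useq_def)
qed

text \<open>Two lists that represent the universal polynomial agree as integer polynomials, hence
  also in \<open>R\<close>. This serves the axioms, which admit every such list.\<close>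

lemma reval_Pprod_unique:
  assumes "is_Pprod n Q" "a \<in> carrier (seqs R)" "b \<in> carrier (seqs R)"
  shows "reval R (UNIV \<times> {1..n}) Q (prod_point a b) = prd R a b n"
proof -
  have "ieval (UNIV \<times> {1..n}) Q c - ieval (UNIV \<times> {1..n}) (Pprod n) c = 0" for c
    using Pprod_unique[OF assms(1) pfun_ieval[of _ "Pprod n"]] is_Pprod[of n] by (simp add: is_Pprod_iff)
  moreover have "\<forall>v\<in>UNIV \<times> {1..n}. prod_point a b v \<in> carrier R"
    using assms by (auto simp: prod_point_def seqs_def)
  ultimately have "reval R (UNIV \<times> {1..n}) Q (prod_point a b) \<ominus> reval R (UNIV \<times> {1..n}) (Pprod n) (prod_point a b) = \<zero>"
    by (intro pfun_transfer[OF pfun_diff[OF pfun_ieval pfun_ieval]]) auto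
  moreover have "reval R (UNIV \<times> {1..n}) Q' (prod_point a b) \<in> carrier R" for Q'
    by (rule pfun_closed[OF pfun_ieval]) (use \<open>\<forall>v\<in>UNIV \<times> {1..n}. prod_point a b v \<in> carrier R\<close> in auto)
  ultimately show ?thesis unfolding prd_def by (simp add: minus_eq_zero_iff)
qed

lemma reval_Pcomp_unique:
  assumes "is_Pcomp m n Q" "a \<in> carrier (seqs R)"
  shows "reval R {1..m * n} Q a = cmp R a n m"
proof -
  have "ieval {1..m * n} Q c - ieval {1..m * n} (Pcomp m n) c = 0" for c
    using Pcomp_unique[OF assms(1) pfun_ieval[of _ "Pcomp m n"]] is_Pcomp[of m n] by (simp add: is_Pcomp_def)
  moreover have "\<forall>v\<in>{1..m * n}. a v \<in> carrier R" using assms by (auto simp: seqs_def)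
  ultimately have "reval R {1..m * n} Q a \<ominus> reval R {1..m * n} (Pcomp m n) a = \<zero>"
    by (intro pfun_transfer[OF pfun_diff[OF pfun_ieval pfun_ieval]]) auto
  moreover have "reval R {1..m * n} Q' a \<in> carrier R" for Q'
    by (rule pfun_closed[OF pfun_ieval]) (use \<open>\<forall>v\<in>{1..m * n}. a v \<in> carrier R\<close> in auto)
  ultimately show ?thesis unfolding cmp_def by (simp add: minus_eq_zero_iff)
qed

end

section \<open>Lambda-rings\<close>

lemma (in ring_hom_cring) hom_add_pow:
  assumes "x \<in> carrier R" shows "h ([(k :: int)] \<cdot>\<^bsub>R\<^esub> x) = [k] \<cdot>\<^bsub>S\<^esub> h x"
proof -
  have "h \<in> hom (add_monoid R) (add_monoid S)" by (auto simp: hom_def)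
  from hom_int_pow[OF this] show ?thesis
    using assms R.add.is_group S.add.is_group unfolding add_pow_def by simp
qed

lemma (in ring_hom_cring) hom_reval:
  assumes "\<And>v. v \<in> V \<Longrightarrow> a v \<in> carrier R" "\<And>v. v \<in> V \<Longrightarrow> h (a v) = b v"
  shows "h (reval R V Q a) = reval S V Q b"
proof -
  have c: "(\<Otimes>v\<in>V. a v [^] e v) \<in> carrier R" for e :: "_ \<Rightarrow> nat"
    by (rule R.finprod_closed) (use assms(1) in auto)
  have p: "h (\<Otimes>v\<in>V. a v [^] e v) = (\<Otimes>\<^bsub>S\<^esub>v\<in>V. b v [^]\<^bsub>S\<^esub> e v)" for e :: "_ \<Rightarrow> nat"
  proof -
    have "h (\<Otimes>v\<in>V. a v [^] e v) = (\<Otimes>\<^bsub>S\<^esub>v\<in>V. (h \<circ> (\<lambda>v. a v [^] e v)) v)"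
      by (subst hom_finprod) (use assms(1) in \<open>auto simp: o_def\<close>)
    also have "\<dots> = (\<Otimes>\<^bsub>S\<^esub>v\<in>V. b v [^]\<^bsub>S\<^esub> e v)"
    proof (rule S.finprod_cong')
      show "(\<lambda>v. b v [^]\<^bsub>S\<^esub> e v) \<in> V \<rightarrow> carrier S" using assms by (auto simp: assms(2)[symmetric])
    qed (use assms in auto)
    finally show ?thesis .
  qed
  have "h (reval R V Q a) = (\<Oplus>\<^bsub>S\<^esub>i\<in>{..<length Q}. (h \<circ> (\<lambda>i. [fst (Q ! i)] \<cdot>\<^bsub>R\<^esub> (\<Otimes>v\<in>V. a v [^] snd (Q ! i) v))) i)"
    unfolding reval_def by (subst hom_finsum) (use c in \<open>auto simp: o_def\<close>)
  then show ?thesis unfolding reval_def using c by (simp add: hom_add_pow p o_def)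
qed

lemma (in ring_hom_cring) hom_seqs:
  "a \<in> carrier (seqs R) \<Longrightarrow> (\<lambda>n. h (a n)) \<in> carrier (seqs S)"
  by (simp add: seqs_def)

lemma (in ring_hom_cring) hom_delta: "(\<lambda>n. h (delta R n)) = delta S"
  by (auto simp: delta_def)

lemma (in ring_hom_cring) hom_conv:
  assumes "a \<in> carrier (seqs R)" "b \<in> carrier (seqs R)"
  shows "(\<lambda>n. h (conv R a b n)) = conv S (\<lambda>n. h (a n)) (\<lambda>n. h (b n))"
  unfolding conv_def
  by (rule ext, subst hom_finsum) (use assms in \<open>auto simp: o_def seqs_def intro!: S.finsum_cong'\<close>)

lemma (in ring_hom_cring) hom_prd:
  assumes "a \<in> carrier (seqs R)" "b \<in> carrier (seqs R)"
  shows "(\<lambda>n. h (prd R a b n)) = prd S (\<lambda>n. h (a n)) (\<lambda>n. h (b n))"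
  unfolding prd_def
  by (rule ext, rule hom_reval) (use assms in \<open>auto simp: prod_point_def seqs_def\<close>)

lemma (in ring_hom_cring) hom_cmp:
  assumes "a \<in> carrier (seqs R)"
  shows "(\<lambda>m. h (cmp R a n m)) = cmp S (\<lambda>n. h (a n)) n"
  unfolding cmp_def
  by (rule ext, rule hom_reval) (use assms in \<open>auto simp: seqs_def\<close>)

context cring
begin

text \<open>Since \<open>c 0\<close> is \<one>, coefficient \<open>n\<close> of the product
  determines \<open>a n\<close> from the earlier ones. Cancellation takes the place of inverse
  series.\<close>

lemma seqs_cancel:
  assumes "a \<in> carrier (seqs R)" "b \<in> carrier (seqs R)" "c \<in> carrier (seqs R)"
    "conv R a c = conv R b c"
  shows "a = b"
proof
  fix n
  show "a n = b n"
  proof (induction n rule: less_induct)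
    case (less n)
    have c: "a i \<in> carrier R" "b i \<in> carrier R" "c i \<in> carrier R" for i
      using assms by (auto simp: seqs_def)
    have split: "conv R d c n = d n \<oplus> (\<Oplus>i\<in>{..<n}. d i \<otimes> c (n - i))" if "\<And>i. d i \<in> carrier R" for d
    proof -
      have "{..n} = insert n {..<n}" by auto
      then show ?thesis unfolding conv_def using that c assms(3)
        by (simp add: finsum_insert Pi_def seqs_def)
    qed
    have "(\<Oplus>i\<in>{..<n}. a i \<otimes> c (n - i)) = (\<Oplus>i\<in>{..<n}. b i \<otimes> c (n - i))"
      by (rule finsum_cong') (use less c in auto)
    moreover have "(\<Oplus>i\<in>{..<n}. b i \<otimes> c (n - i)) \<in> carrier R"
      by (rule finsum_closed) (use c in auto)
    ultimately show ?case
      using fun_cong[OF assms(4), of n] split[of a] split[of b] c by simp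
  qed
qed

lemma conv_scale:
  assumes "a \<in> carrier (seqs R)" "b \<in> carrier (seqs R)" "u \<in> carrier R"
  shows "scale R u (conv R a b) = conv R (scale R u a) (scale R u b)"
proof
  fix n
  let ?p = "pack [a, b, useq R u]"
  have "scale R (?p (2, 1)) (conv R (\<lambda>k. ?p (0, k)) (\<lambda>k. ?p (1, k))) n
    = conv R (scale R (?p (2, 1)) (\<lambda>k. ?p (0, k))) (scale R (?p (2, 1)) (\<lambda>k. ?p (1, k))) n"
  proof (rule pf_transfer[OF pf_iscale[OF pf_var pf_conv[OF sq0 sq1]]
      pf_conv[OF pf_iscale[OF pf_var sq0] pf_iscale[OF pf_var sq1]]])
    fix x and N :: nat
    have "iscale c (f * g) = iscale c f * iscale c g" for c f g
      by (rule fps_ext)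
        (auto simp: iscale_def fps_mult_nth sum_distrib_left power_add[symmetric] ac_simps intro!: sum.cong)
    then show "fps_nth (iscale (case (2, 1) of (s, k) \<Rightarrow> esym k {..<N} (x s))
          (sq 0 (\<lambda>(s, k). esym k {..<N} (x s)) * sq 1 (\<lambda>(s, k). esym k {..<N} (x s)))) n
      = fps_nth (iscale (case (2, 1) of (s, k) \<Rightarrow> esym k {..<N} (x s)) (sq 0 (\<lambda>(s, k). esym k {..<N} (x s))) *
          iscale (case (2, 1) of (s, k) \<Rightarrow> esym k {..<N} (x s)) (sq 1 (\<lambda>(s, k). esym k {..<N} (x s)))) n"
      by (simp only:)
  qed (use assms in \<open>auto simp: pack_closed useq_closed\<close>)
  then show "scale R u (conv R a b) n = conv R (scale R u a) (scale R u b) n"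
    by (simp add: pack_def useq_def)
qed

lemma convs_conv:
  assumes "\<And>i. f i \<in> carrier (seqs R)" "\<And>i. g i \<in> carrier (seqs R)"
  shows "convs R (\<lambda>i. conv R (f i) (g i)) n = conv R (convs R f n) (convs R g n)"
proof (induction n)
  case 0
  show ?case by (simp add: conv_delta delta_closed)
next
  case (Suc n)
  interpret M: comm_monoid "seqs R" by (rule seqs_comm_monoid)
  have "convs R f n \<in> carrier (seqs R)" "convs R g n \<in> carrier (seqs R)"
    using assms by (auto intro: convs_closed)
  then show ?case using assms Suc by (simp add: M.m_ac flip: seqs_mult)
qed

lemma conv_1: "a \<in> carrier (seqs R) \<Longrightarrow> b \<in> carrier (seqs R) \<Longrightarrow> conv R a b 1 = a 1 \<oplus> b 1"
proof -
  assume ab: "a \<in> carrier (seqs R)" "b \<in> carrier (seqs R)"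
  have "{..1} = {0, 1 :: nat}" by auto
  then have "conv R a b 1 = a 0 \<otimes> b 1 \<oplus> a 1 \<otimes> b 0"
    unfolding conv_def using ab by (simp add: finsum_insert Pi_def seqs_def)
  then show ?thesis using ab by (simp add: seqs_def a_comm)
qed

lemma convs_cong: "(\<And>i. i < n \<Longrightarrow> f i = g i) \<Longrightarrow> convs R f n = convs R g n"
  by (induction n) auto

end

text \<open>The axioms as equations between total operations, with the universal polynomials fixed
  through \<open>prd\<close> and \<open>cmp\<close>; homomorphisms and the laws of
  \<open>seqs\<close> then apply to whole series.\<close>

locale lam_ring = cring +
  fixes lam :: "nat \<Rightarrow> 'a \<Rightarrow> 'a"
  assumes lam_seqs: "x \<in> carrier R \<Longrightarrow> (\<lambda>n. lam n x) \<in> carrier (seqs R)"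
    and lam_1: "x \<in> carrier R \<Longrightarrow> lam 1 x = x"
    and lam_add: "x \<in> carrier R \<Longrightarrow> y \<in> carrier R \<Longrightarrow>
      (\<lambda>n. lam n (x \<oplus> y)) = conv R (\<lambda>n. lam n x) (\<lambda>n. lam n y)"
    and lam_one: "1 < n \<Longrightarrow> lam n \<one> = \<zero>"
    and lam_mult: "x \<in> carrier R \<Longrightarrow> y \<in> carrier R \<Longrightarrow>
      (\<lambda>n. lam n (x \<otimes> y)) = prd R (\<lambda>n. lam n x) (\<lambda>n. lam n y)"
    and lam_lam: "x \<in> carrier R \<Longrightarrow> (\<lambda>m. lam m (lam n x)) = cmp R (\<lambda>n. lam n x) n"
begin

lemma lam_closed: "x \<in> carrier R \<Longrightarrow> lam n x \<in> carrier R" and lam_0: "x \<in> carrier R \<Longrightarrow> lam 0 x = \<one>"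
  using lam_seqs[of x] by (auto simp: seqs_def)

text \<open>As zero plus zero is zero, the series is idempotent, and under cancellation only the
  trivial series is.\<close>

lemma lam_zero: "(\<lambda>n. lam n \<zero>) = delta R"
proof (rule seqs_cancel)
  show "conv R (\<lambda>n. lam n \<zero>) (\<lambda>n. lam n \<zero>) = conv R (delta R) (\<lambda>n. lam n \<zero>)"
    using lam_add[of \<zero> \<zero>] by (simp add: conv_delta lam_seqs)
qed (auto intro: lam_seqs delta_closed)

end

text \<open>Forwards, \<open>Q\<close> is instantiated by the chosen polynomials, which takes their
  existence. Backwards, every admissible \<open>Q\<close> must be served, which takes
  uniqueness.\<close>

lemma lambda_ring_iff: "lambda_ring R lam \<longleftrightarrow> lam_ring R lam"
proof
  assume L: "lambda_ring R lam"
  then interpret cring R by (simp add: lambda_ring_def)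
  have s: "(\<lambda>n. lam n x) \<in> carrier (seqs R)" if "x \<in> carrier R" for x
    using L that by (intro seqsI) (auto simp: lambda_ring_def)
  show "lam_ring R lam"
  proof (unfold_locales, goal_cases)
    case (1 x) then show ?case by (rule s)
  next
    case (2 x) then show ?case using L by (simp add: lambda_ring_def)
  next
    case (3 x y)
    have "lam n (x \<oplus>\<^bsub>R\<^esub> y) = conv R (\<lambda>n. lam n x) (\<lambda>n. lam n y) n" for n
      using L 3 unfolding lambda_ring_def conv_def by blast
    then show ?case by blast
  next
    case (4 n) then show ?case using L by (simp add: lambda_ring_def)
  next
    case (5 x y)
    have "lam n (x \<otimes>\<^bsub>R\<^esub> y) = prd R (\<lambda>n. lam n x) (\<lambda>n. lam n y) n" for n
      using L 5 is_Pprod[of n] unfolding lambda_ring_def prd_def prod_point_def by blast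
    then show ?case by blast
  next
    case (6 x n)
    have "lam m (lam n x) = cmp R (\<lambda>n. lam n x) n m" for m
      using L 6 is_Pcomp[of m n] unfolding lambda_ring_def cmp_def by blast
    then show ?case by blast
  qed
next
  assume "lam_ring R lam"
  then interpret lam_ring R lam .
  show "lambda_ring R lam"
    unfolding lambda_ring_def
  proof (intro conjI ballI allI impI)
    show "lam n (x \<oplus>\<^bsub>R\<^esub> y) = (\<Oplus>\<^bsub>R\<^esub>i\<in>{..n}. lam i x \<otimes>\<^bsub>R\<^esub> lam (n - i) y)"
      if "x \<in> carrier R" "y \<in> carrier R" for n x y
      using fun_cong[OF lam_add[OF that], of n] by (simp add: conv_def)
    show "lam n (x \<otimes>\<^bsub>R\<^esub> y) = reval R (UNIV \<times> {1..n}) Q (\<lambda>(s, k). if s then lam k y else lam k x)"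
      if "is_Pprod n Q" "x \<in> carrier R" "y \<in> carrier R" for n Q x y
      using fun_cong[OF lam_mult[OF that(2,3)], of n] that lam_seqs
      by (simp add: reval_Pprod_unique[OF that(1), symmetric] prod_point_def)
    show "lam m (lam n x) = reval R {1..m * n} Q (\<lambda>k. lam k x)"
      if "is_Pcomp m n Q" "x \<in> carrier R" for m n Q x
      using fun_cong[OF lam_lam[OF that(2), of n], of m]
      by (simp only: reval_Pcomp_unique[OF that(1) lam_seqs[OF that(2)]])
  qed (auto simp: is_cring lam_closed lam_0 lam_1[simplified] lam_one)
qed

text \<open>Two preimages differ by an element of the kernel, whose total operation becomes trivial,
  so the choice made by \<open>SOME\<close> is immaterial. A surjection is used instead of a factor
  ring because the quotient is later replaced by a copy on lists.\<close>

lemma lam_ring_quotient: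
  fixes R (structure)
  assumes "lam_ring R lam" "cring T" "h \<in> ring_hom R T" "h ` carrier R = carrier T"
    "\<And>u. u \<in> carrier R \<Longrightarrow> h u = \<zero>\<^bsub>T\<^esub> \<Longrightarrow> (\<lambda>n. h (lam n u)) = delta T"
  shows "\<exists>lam'. lam_ring T lam' \<and> (\<forall>u\<in>carrier R. \<forall>n. lam' n (h u) = h (lam n u))"
proof -
  interpret lam_ring R lam by (rule assms(1))
  interpret T: cring T by (rule assms(2))
  interpret ring_hom_cring R T h by unfold_locales (rule assms(3))
  have hs: "(\<lambda>n. h (lam n u)) \<in> carrier (seqs T)" if "u \<in> carrier R" for u
    by (rule hom_seqs[OF lam_seqs[OF that]])
  have compat: "(\<lambda>n. h (lam n u)) = (\<lambda>n. h (lam n v))" if "u \<in> carrier R" "v \<in> carrier R" "h u = h v" for u v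
  proof -
    have d: "u \<ominus> v \<in> carrier R" "u = (u \<ominus> v) \<oplus> v" "h (u \<ominus> v) = \<zero>\<^bsub>T\<^esub>"
      using that by (auto simp: a_minus_def a_assoc l_neg T.r_neg)
    have "(\<lambda>n. h (lam n u)) = (\<lambda>n. h (lam n ((u \<ominus> v) \<oplus> v)))" using d(2) by simp
    also have "\<dots> = conv T (\<lambda>n. h (lam n (u \<ominus> v))) (\<lambda>n. h (lam n v))"
      using fun_cong[OF lam_add[OF d(1) that(2)]] hom_conv[OF lam_seqs[OF d(1)] lam_seqs[OF that(2)]] by simp
    also have "\<dots> = (\<lambda>n. h (lam n v))"
      using assms(5)[OF d(1,3)] hs[OF that(2)] by (simp add: T.conv_delta)
    finally show ?thesis .
  qed
  define lam' where "lam' = (\<lambda>n t. h (lam n (SOME u. u \<in> carrier R \<and> h u = t)))"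
  have l: "lam' n (h u) = h (lam n u)" if "u \<in> carrier R" for n u
  proof -
    let ?v = "SOME v. v \<in> carrier R \<and> h v = h u"
    have "?v \<in> carrier R \<and> h ?v = h u" by (rule someI[of _ u]) (use that in simp)
    then have "(\<lambda>n. h (lam n ?v)) = (\<lambda>n. h (lam n u))" using compat that by blast
    then show ?thesis unfolding lam'_def by (rule fun_cong)
  qed
  have ex: "\<exists>u\<in>carrier R. t = h u" if "t \<in> carrier T" for t using that assms(4) by auto
  have "lam_ring T lam'"
  proof (unfold_locales, goal_cases)
    case (1 x)
    then show ?case using ex[of x] hs by (auto simp: l)
  next
    case (2 x)
    then obtain u where "u \<in> carrier R" "x = h u" using ex by blast
    then show ?case using l[of u 1] lam_1[of u] by simp
  next
    case (3 x y)
    then obtain u v where uv: "u \<in> carrier R" "x = h u" "v \<in> carrier R" "y = h v" using ex by meson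
    then have "lam' n (x \<oplus>\<^bsub>T\<^esub> y) = h (lam n (u \<oplus> v))" for n using l[of "u \<oplus> v" n] by simp
    then show ?case
      using fun_cong[OF lam_add[OF uv(1,3)]] hom_conv[OF lam_seqs[OF uv(1)] lam_seqs[OF uv(3)]] uv by (simp add: l)
  next
    case (4 n)
    then show ?case using l[of \<one> n] lam_one[of n] by simp
  next
    case (5 x y)
    then obtain u v where uv: "u \<in> carrier R" "x = h u" "v \<in> carrier R" "y = h v" using ex by meson
    then have "lam' n (x \<otimes>\<^bsub>T\<^esub> y) = h (lam n (u \<otimes> v))" for n using l[of "u \<otimes> v" n] by simp
    then show ?case
      using fun_cong[OF lam_mult[OF uv(1,3)]] hom_prd[OF lam_seqs[OF uv(1)] lam_seqs[OF uv(3)]] uv by (simp add: l)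
  next
    case (6 x n)
    then obtain u where u: "u \<in> carrier R" "x = h u" using ex by meson
    then show ?case
      using fun_cong[OF lam_lam[OF u(1), of n]] hom_cmp[OF lam_seqs[OF u(1)], of n] by (simp add: l lam_closed)
  qed
  then show ?thesis using l by blast
qed

section \<open>Adjoining a line element\<close>

text \<open>As \<open>X\<close> is to be a line element, the monomial \<open>r X^k\<close> must have
  the total operation of \<open>r\<close> with \<open>X^k t\<close> in place of
  \<open>t\<close>.\<close>

definition uterm :: "('a, 'm) ring_scheme \<Rightarrow> (nat \<Rightarrow> 'a \<Rightarrow> 'a) \<Rightarrow> 'a \<Rightarrow> nat \<Rightarrow> nat \<Rightarrow> nat \<Rightarrow> 'a" where
  "uterm R lam r k = scale (UP R) (up_ring.monom (UP R) \<one>\<^bsub>R\<^esub> k) (\<lambda>n. up_ring.monom (UP R) (lam n r) 0)"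

text \<open>Additivity forces the product over the monomials. \<open>convs\<close> multiplies the
  factors below its bound, hence \<open>Suc (deg R p)\<close>.\<close>

definition ulam :: "('a, 'm) ring_scheme \<Rightarrow> (nat \<Rightarrow> 'a \<Rightarrow> 'a) \<Rightarrow> nat \<Rightarrow> (nat \<Rightarrow> 'a) \<Rightarrow> nat \<Rightarrow> 'a" where
  "ulam R lam n p = convs (UP R) (\<lambda>k. uterm R lam (up_ring.coeff (UP R) p k) k) (Suc (deg R p)) n"

context lam_ring
begin

interpretation UP_cring R "UP R" by unfold_locales

interpretation C: ring_hom_cring R "UP R" "\<lambda>r. up_ring.monom (UP R) r 0"
  by unfold_locales (rule const_ring_hom)

lemma uterm_closed: "r \<in> carrier R \<Longrightarrow> uterm R lam r k \<in> carrier (seqs (UP R))"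
  unfolding uterm_def by (rule P.scale_closed) (auto intro: C.hom_seqs lam_seqs)

lemma uterm_zero: "uterm R lam \<zero> k = delta (UP R)"
proof -
  have "(\<lambda>n. up_ring.monom (UP R) (lam n \<zero>) 0) = delta (UP R)"
    using C.hom_delta unfolding lam_zero[symmetric] .
  then show ?thesis by (auto simp: uterm_def scale_def delta_def)
qed

lemma uterm_add:
  assumes "r \<in> carrier R" "s \<in> carrier R"
  shows "uterm R lam (r \<oplus> s) k = conv (UP R) (uterm R lam r k) (uterm R lam s k)"
proof -
  have "(\<lambda>n. up_ring.monom (UP R) (lam n (r \<oplus> s)) 0)
      = conv (UP R) (\<lambda>n. up_ring.monom (UP R) (lam n r) 0) (\<lambda>n. up_ring.monom (UP R) (lam n s) 0)"
    using fun_cong[OF lam_add[OF assms]] C.hom_conv[OF lam_seqs lam_seqs] assms by simp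
  then show ?thesis unfolding uterm_def
    using assms by (simp add: P.conv_scale C.hom_seqs lam_seqs)
qed

lemma uterm_mult:
  assumes "r \<in> carrier R" "s \<in> carrier R"
  shows "uterm R lam (r \<otimes> s) (j + k) = prd (UP R) (uterm R lam r j) (uterm R lam s k)"
proof -
  have "(\<lambda>n. up_ring.monom (UP R) (lam n (r \<otimes> s)) 0)
      = prd (UP R) (\<lambda>n. up_ring.monom (UP R) (lam n r) 0) (\<lambda>n. up_ring.monom (UP R) (lam n s) 0)"
    using fun_cong[OF lam_mult[OF assms]] C.hom_prd[OF lam_seqs lam_seqs] assms by simp
  moreover have "up_ring.monom (UP R) \<one> j \<otimes>\<^bsub>UP R\<^esub> up_ring.monom (UP R) \<one> k = up_ring.monom (UP R) \<one> (j + k)"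
    using monom_mult[of \<one> \<one> j k] by simp
  ultimately show ?thesis unfolding uterm_def
    using assms by (simp add: P.prd_scale C.hom_seqs lam_seqs)
qed

lemma uterm_nth:
  assumes "r \<in> carrier R"
  shows "uterm R lam r k n = up_ring.monom (UP R) (lam n r) (k * n)"
proof -
  have "up_ring.monom (UP R) \<one> k [^]\<^bsub>UP R\<^esub> n = up_ring.monom (UP R) \<one> (k * n)"
    using monom_pow[of \<one> k n] by simp
  then show ?thesis unfolding uterm_def scale_def
    using monom_mult[of \<one> "lam n r" "k * n" 0] assms by (simp add: lam_closed del: monom_mult)
qed

lemma uterm_cmp:
  assumes "r \<in> carrier R"
  shows "uterm R lam (lam n r) (k * n) = cmp (UP R) (uterm R lam r k) n"
proof -
  have "(\<lambda>m. up_ring.monom (UP R) (lam m (lam n r)) 0) = cmp (UP R) (\<lambda>n. up_ring.monom (UP R) (lam n r) 0) n"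
    using fun_cong[OF lam_lam[OF assms, of n]] C.hom_cmp[OF lam_seqs[OF assms], of n] by simp
  moreover have "up_ring.monom (UP R) \<one> k [^]\<^bsub>UP R\<^esub> n = up_ring.monom (UP R) \<one> (k * n)"
    using monom_pow[of \<one> k n] by simp
  ultimately show ?thesis unfolding uterm_def
    using assms by (simp add: P.cmp_scale C.hom_seqs lam_seqs)
qed

text \<open>Coefficients above the degree contribute the trivial series, so polynomials of different
  degrees can share one bound.\<close>

lemma ulam_eq_convs:
  assumes "p \<in> carrier (UP R)" "deg R p < d"
  shows "(\<lambda>n. ulam R lam n p) = convs (UP R) (\<lambda>k. uterm R lam (up_ring.coeff (UP R) p k) k) d"
proof -
  have "Suc (deg R p) \<le> d" using assms(2) by simp
  then show ?thesis
  proof (induction d rule: dec_induct)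
    case base
    show ?case by (simp add: ulam_def)
  next
    case (step d)
    then have "up_ring.coeff (UP R) p d = \<zero>" using assms(1) by (intro deg_aboveD) auto
    moreover have "convs (UP R) (\<lambda>k. uterm R lam (up_ring.coeff (UP R) p k) k) d \<in> carrier (seqs (UP R))"
      by (rule P.convs_closed) (use assms(1) in \<open>auto intro: uterm_closed\<close>)
    ultimately show ?case
      using step by (simp add: uterm_zero P.conv_delta P.conv_comm[OF _ P.delta_closed])
  qed
qed

lemma ulam_closed: "p \<in> carrier (UP R) \<Longrightarrow> (\<lambda>n. ulam R lam n p) \<in> carrier (seqs (UP R))"
  by (subst ulam_eq_convs[OF _ lessI]) (auto intro!: P.convs_closed uterm_closed simp del: convs.simps)

lemma ulam_add:
  assumes "p \<in> carrier (UP R)" "q \<in> carrier (UP R)"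
  shows "(\<lambda>n. ulam R lam n (p \<oplus>\<^bsub>UP R\<^esub> q)) = conv (UP R) (\<lambda>n. ulam R lam n p) (\<lambda>n. ulam R lam n q)"
proof -
  define d where "d = Suc (deg R p + deg R q + deg R (p \<oplus>\<^bsub>UP R\<^esub> q))"
  have "(\<lambda>n. ulam R lam n (p \<oplus>\<^bsub>UP R\<^esub> q))
      = convs (UP R) (\<lambda>k. conv (UP R) (uterm R lam (up_ring.coeff (UP R) p k) k) (uterm R lam (up_ring.coeff (UP R) q k) k)) d"
    using assms ulam_eq_convs[of "p \<oplus>\<^bsub>UP R\<^esub> q" d] by (simp add: d_def uterm_add del: convs.simps)
  also have "\<dots> = conv (UP R) (\<lambda>n. ulam R lam n p) (\<lambda>n. ulam R lam n q)"
    using assms by (subst P.convs_conv)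
      (auto simp: uterm_closed d_def ulam_eq_convs[of p d] ulam_eq_convs[of q d] simp del: convs.simps)
  finally show ?thesis .
qed

lemma ulam_monom:
  assumes "r \<in> carrier R"
  shows "(\<lambda>n. ulam R lam n (up_ring.monom (UP R) r k)) = uterm R lam r k"
proof -
  have "convs (UP R) (\<lambda>i. uterm R lam (if k = i then r else \<zero>) i) d = (if k < d then uterm R lam r k else delta (UP R))" for d
  proof (induction d)
    case (Suc d)
    consider "d < k" | "d = k" | "k < d" by linarith
    then show ?case
      by cases (use Suc P.conv_comm[OF uterm_closed[OF assms] P.delta_closed] in
        \<open>simp_all add: uterm_zero P.conv_delta P.delta_closed uterm_closed assms\<close>)
  qed simp
  moreover have "deg R (up_ring.monom (UP R) r k) < Suc k" using deg_monom_le[OF assms] by (simp add: less_Suc_eq_le)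
  ultimately show ?thesis
    using assms ulam_eq_convs[of "up_ring.monom (UP R) r k" "Suc k"] by (simp del: convs.simps)
qed

lemma UP_monom_induct [consumes 1, case_names monom add]:
  assumes "p \<in> carrier (UP R)" "\<And>r k. r \<in> carrier R \<Longrightarrow> Q (up_ring.monom (UP R) r k)"
    "\<And>p q. p \<in> carrier (UP R) \<Longrightarrow> q \<in> carrier (UP R) \<Longrightarrow> Q p \<Longrightarrow> Q q \<Longrightarrow> Q (p \<oplus>\<^bsub>UP R\<^esub> q)"
  shows "Q p"
proof -
  let ?m = "\<lambda>i. up_ring.monom (UP R) (up_ring.coeff (UP R) p i) i"
  have m: "?m i \<in> carrier (UP R)" for i using assms(1) by simp
  have "Q (\<Oplus>\<^bsub>UP R\<^esub>i\<in>{..d}. ?m i)" for d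
  proof (induction d)
    case 0
    then show ?case using assms(1,2) m by (simp add: P.finsum_insert)
  next
    case (Suc d)
    have "(\<Oplus>\<^bsub>UP R\<^esub>i\<in>{..d}. ?m i) \<in> carrier (UP R)" using m by (intro P.finsum_closed) auto
    then show ?case using Suc assms(1-3) m by (simp add: P.finsum_Suc2 Pi_def)
  qed
  then show ?thesis using up_repr[OF assms(1)] by metis
qed

lemma ulam_finsum:
  assumes "\<And>i. f i \<in> carrier (UP R)"
  shows "(\<lambda>n. ulam R lam n (\<Oplus>\<^bsub>UP R\<^esub>i\<in>{..m :: nat}. f i)) = convs (UP R) (\<lambda>i n. ulam R lam n (f i)) (Suc m)"
proof (induction m)
  case 0
  show ?case using assms by (simp add: P.conv_delta ulam_closed P.finsum_insert)
next
  case (Suc m)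
  have "(\<Oplus>\<^bsub>UP R\<^esub>i\<in>{..m}. f i) \<in> carrier (UP R)" using assms by (intro P.finsum_closed) auto
  moreover have "(\<Oplus>\<^bsub>UP R\<^esub>i\<in>{..Suc m}. f i) = (\<Oplus>\<^bsub>UP R\<^esub>i\<in>{..m}. f i) \<oplus>\<^bsub>UP R\<^esub> f (Suc m)"
    unfolding atMost_Suc using assms calculation by (subst P.finsum_insert) (auto simp: P.a_comm)
  ultimately show ?case using assms Suc by (simp add: ulam_add)
qed

text \<open>Both sides are additive in each factor, by \<open>prd_conv\<close> and, for the second
  factor, \<open>prd_comm\<close>. This leaves monomials, where \<open>uterm_mult\<close>
  applies.\<close>

lemma ulam_mult:
  assumes "p \<in> carrier (UP R)" "q \<in> carrier (UP R)"
  shows "(\<lambda>n. ulam R lam n (p \<otimes>\<^bsub>UP R\<^esub> q)) = prd (UP R) (\<lambda>n. ulam R lam n p) (\<lambda>n. ulam R lam n q)"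
  using assms(1,2)
proof (induction p rule: UP_monom_induct)
  case (monom r j)
  from monom(2,1) show ?case
  proof (induction q rule: UP_monom_induct)
    case (monom s k)
    then show ?case using ulam_monom[of "r \<otimes> s" "j + k"] by (simp add: ulam_monom uterm_mult)
  next
    case (add p q)
    let ?m = "up_ring.monom (UP R) r j"
    have m: "?m \<in> carrier (UP R)" using add by simp
    have "(\<lambda>n. ulam R lam n (?m \<otimes>\<^bsub>UP R\<^esub> (p \<oplus>\<^bsub>UP R\<^esub> q)))
      = (\<lambda>n. ulam R lam n (?m \<otimes>\<^bsub>UP R\<^esub> p \<oplus>\<^bsub>UP R\<^esub> ?m \<otimes>\<^bsub>UP R\<^esub> q))"
      using add m by (simp add: P.r_distr)
    also have "\<dots> = conv (UP R) (prd (UP R) (\<lambda>n. ulam R lam n p) (\<lambda>n. ulam R lam n ?m))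
       (prd (UP R) (\<lambda>n. ulam R lam n q) (\<lambda>n. ulam R lam n ?m))"
      using add m ulam_add[of "?m \<otimes>\<^bsub>UP R\<^esub> p" "?m \<otimes>\<^bsub>UP R\<^esub> q"]
        P.prd_comm[OF ulam_closed[OF m] ulam_closed[OF add(1)]] P.prd_comm[OF ulam_closed[OF m] ulam_closed[OF add(2)]]
      by simp
    also have "\<dots> = prd (UP R) (\<lambda>n. ulam R lam n (p \<oplus>\<^bsub>UP R\<^esub> q)) (\<lambda>n. ulam R lam n ?m)"
      using add m by (simp add: ulam_add P.prd_conv ulam_closed)
    also have "\<dots> = prd (UP R) (\<lambda>n. ulam R lam n ?m) (\<lambda>n. ulam R lam n (p \<oplus>\<^bsub>UP R\<^esub> q))"
      using add m by (intro P.prd_comm ulam_closed) auto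
    finally show ?case .
  qed
next
  case (add p p')
  have "(\<lambda>n. ulam R lam n ((p \<oplus>\<^bsub>UP R\<^esub> p') \<otimes>\<^bsub>UP R\<^esub> q))
      = (\<lambda>n. ulam R lam n (p \<otimes>\<^bsub>UP R\<^esub> q \<oplus>\<^bsub>UP R\<^esub> p' \<otimes>\<^bsub>UP R\<^esub> q))"
    using add by (simp add: P.l_distr)
  also have "\<dots> = conv (UP R) (prd (UP R) (\<lambda>n. ulam R lam n p) (\<lambda>n. ulam R lam n q))
       (prd (UP R) (\<lambda>n. ulam R lam n p') (\<lambda>n. ulam R lam n q))"
    using add ulam_add[of "p \<otimes>\<^bsub>UP R\<^esub> q" "p' \<otimes>\<^bsub>UP R\<^esub> q"] by simp
  also have "\<dots> = prd (UP R) (\<lambda>n. ulam R lam n (p \<oplus>\<^bsub>UP R\<^esub> p')) (\<lambda>n. ulam R lam n q)"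
    using add by (simp add: ulam_add P.prd_conv ulam_closed)
  finally show ?case .
qed

text \<open>For a monomial, \<open>\<lambda>^n\<close> is again a monomial and
  \<open>uterm_cmp\<close> applies. For a sum, \<open>\<lambda>^n\<close> expands into products,
  whose total operations \<open>ulam_mult\<close> gives; \<open>cmp_conv\<close> is the same
  expansion for the universal polynomials.\<close>

lemma ulam_ulam:
  assumes "p \<in> carrier (UP R)"
  shows "(\<lambda>m. ulam R lam m (ulam R lam n p)) = cmp (UP R) (\<lambda>n. ulam R lam n p) n"
  using assms
proof (induction p arbitrary: n rule: UP_monom_induct)
  case (monom r k)
  then show ?case
    using fun_cong[OF ulam_monom[of r k], of n]
    by (simp add: uterm_nth ulam_monom lam_closed uterm_cmp)
next
  case (add p q)
  have c: "ulam R lam i p \<in> carrier (UP R)" "ulam R lam i q \<in> carrier (UP R)" for i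
    using ulam_closed add(1,2) by (auto simp: seqs_def)
  have "(\<lambda>m. ulam R lam m (ulam R lam n (p \<oplus>\<^bsub>UP R\<^esub> q)))
    = (\<lambda>m. ulam R lam m (\<Oplus>\<^bsub>UP R\<^esub>i\<in>{..n}. ulam R lam i p \<otimes>\<^bsub>UP R\<^esub> ulam R lam (n - i) q))"
    using fun_cong[OF ulam_add[OF add(1,2)], of n] by (simp add: conv_def)
  also have "\<dots> = convs (UP R) (\<lambda>i n'. ulam R lam n' (ulam R lam i p \<otimes>\<^bsub>UP R\<^esub> ulam R lam (n - i) q)) (Suc n)"
    by (rule ulam_finsum) (use c in auto)
  also have "\<dots> = convs (UP R) (\<lambda>i. prd (UP R) (cmp (UP R) (\<lambda>n. ulam R lam n p) i) (cmp (UP R) (\<lambda>n. ulam R lam n q) (n - i))) (Suc n)"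
    by (rule P.convs_cong) (use c add in \<open>simp add: ulam_mult\<close>)
  also have "\<dots> = cmp (UP R) (\<lambda>n. ulam R lam n (p \<oplus>\<^bsub>UP R\<^esub> q)) n"
    using add by (simp add: ulam_add P.cmp_conv ulam_closed del: convs.simps)
  finally show ?case .
qed

theorem lam_ring_UP: "lam_ring (UP R) (ulam R lam)"
proof (intro lam_ring.intro lam_ring_axioms.intro)
  show "cring (UP R)" by (rule UP_cring)
  show "ulam R lam 1 p = p" if "p \<in> carrier (UP R)" for p
    using that
  proof (induction p rule: UP_monom_induct)
    case (monom r k)
    then show ?case using fun_cong[OF ulam_monom[of r k], of 1] lam_1[of r] by (simp add: uterm_nth)
  next
    case (add p q)
    then show ?case using fun_cong[OF ulam_add[OF add(1,2)], of 1]
      P.conv_1[OF ulam_closed[OF add(1)] ulam_closed[OF add(2)]] by simp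
  qed
  show "ulam R lam n \<one>\<^bsub>UP R\<^esub> = \<zero>\<^bsub>UP R\<^esub>" if "1 < n" for n
    using fun_cong[OF ulam_monom[of \<one> 0], of n] that by (simp add: uterm_nth lam_one)
qed (auto simp: ulam_closed ulam_add ulam_mult ulam_ulam)

lemma ulam_const: "r \<in> carrier R \<Longrightarrow> ulam R lam n (up_ring.monom (UP R) r 0) = up_ring.monom (UP R) (lam n r) 0"
  using fun_cong[OF ulam_monom[of r 0], of n] by (simp add: uterm_nth)

lemma ulam_X: "(\<lambda>n. ulam R lam n (up_ring.monom (UP R) \<one> 1)) = line (UP R) (up_ring.monom (UP R) \<one> 1)"
proof
  fix n :: nat
  consider "n = 0" | "n = 1" | "1 < n" by linarith
  then show "ulam R lam n (up_ring.monom (UP R) \<one> 1) = line (UP R) (up_ring.monom (UP R) \<one> 1) n"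
    using fun_cong[OF ulam_monom[of \<one> 1], of n] lam_0[of \<one>] lam_1[of \<one>]
    by cases (simp_all add: uterm_nth lam_one line_def)
qed

end

section \<open>The extension\<close>

text \<open>The trivial series is the zero of the ring formed by \<open>conv\<close> and
  \<open>prd\<close>, so being sent to it is inherited by sums and multiples. To recognise a
  \<lambda>-ideal it is then enough to look at generators.\<close>

lemma (in lam_ring) lambda_ideal:
  assumes "cring S" "h \<in> ring_hom R S"
  shows "ideal {u \<in> carrier R. (\<lambda>n. h (lam n u)) = delta S} R"
proof -
  interpret S: cring S by (rule assms(1))
  interpret ring_hom_cring R S h by unfold_locales (rule assms(2))
  let ?I = "{u \<in> carrier R. (\<lambda>n. h (lam n u)) = delta S}"
  have hs: "(\<lambda>n. h (lam n u)) \<in> carrier (seqs S)" if "u \<in> carrier R" for u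
    by (rule hom_seqs[OF lam_seqs[OF that]])
  have add: "(\<lambda>n. h (lam n (u \<oplus> v))) = conv S (\<lambda>n. h (lam n u)) (\<lambda>n. h (lam n v))"
    if "u \<in> carrier R" "v \<in> carrier R" for u v
    using fun_cong[OF lam_add[OF that]] hom_conv[OF lam_seqs[OF that(1)] lam_seqs[OF that(2)]] by simp
  have zero: "(\<lambda>n. h (lam n \<zero>)) = delta S"
    using fun_cong[OF lam_zero] hom_delta by simp
  have mult: "x \<otimes> u \<in> ?I" if "u \<in> ?I" "x \<in> carrier R" for u x
  proof -
    have u: "u \<in> carrier R" "(\<lambda>n. h (lam n u)) = delta S" using that by auto
    have "(\<lambda>n. h (lam n (x \<otimes> u))) = prd S (\<lambda>n. h (lam n x)) (\<lambda>n. h (lam n u))"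
      using fun_cong[OF lam_mult[OF that(2) u(1)]] hom_prd[OF lam_seqs[OF that(2)] lam_seqs[OF u(1)]] by simp
    also have "\<dots> = delta S" unfolding u(2) by (rule S.prd_delta[OF hs[OF that(2)]])
    finally show ?thesis using u that(2) by simp
  qed
  show ?thesis
  proof (rule idealI[OF ring_axioms])
    show "subgroup ?I (add_monoid R)"
    proof (rule group.subgroupI[OF a_group])
      show "?I \<noteq> {}" using zero by auto
      show "inv\<^bsub>add_monoid R\<^esub> u \<in> ?I" if u: "u \<in> ?I" for u
      proof -
        have "delta S = (\<lambda>n. h (lam n (u \<oplus> \<ominus> u)))" using u by (simp add: zero r_neg)
        also have "\<dots> = (\<lambda>n. h (lam n (\<ominus> u)))" using u add[of u "\<ominus> u"] hs by (simp add: S.conv_delta)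
        finally have "\<ominus> u \<in> ?I" using u by simp
        then show ?thesis unfolding a_inv_def .
      qed
      show "u \<otimes>\<^bsub>add_monoid R\<^esub> v \<in> ?I" if "u \<in> ?I" "v \<in> ?I" for u v
        using that add[of u v] by (simp add: S.conv_delta S.delta_closed)
    qed auto
  qed (use mult in \<open>simp_all add: m_comm\<close>)
qed

section \<open>The hook relation and the quadratic extension\<close>

lemma (in cring) conv_line:
  assumes "a \<in> carrier (seqs R)" "u \<in> carrier R"
  shows "conv R a (line R u) (Suc n) = a (Suc n) \<oplus> a n \<otimes> u"
proof -
  have c: "a i \<in> carrier R" "line R u i \<in> carrier R" for i
    using assms line_closed[OF assms(2)] by (auto simp: seqs_def)
  have "{..Suc n} = insert (Suc n) (insert n {..<n})" by auto
  moreover have "(\<Oplus>i\<in>{..<n}. a i \<otimes> line R u (Suc n - i)) = (\<Oplus>i\<in>{..<n}. \<zero>)"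
    by (rule finsum_cong') (use c in \<open>auto simp: line_def\<close>)
  ultimately show ?thesis
    unfolding conv_def using c assms(2) by (simp add: finsum_insert Pi_def) (simp add: line_def)
qed

text \<open>The partition \<open>(2, 1, ..., 1)\<close> with \<open>n + 1\<close> ones has the
  conjugate \<open>(n + 2, 1)\<close>, so the dual Jacobi-Trudi determinant is 2 by 2:
  \<open>\<lambda>^(n+2) \<lambda>^1 - \<lambda>^(n+3) \<lambda>^0\<close>.\<close>

lemma schur_hook:
  assumes "lam_ring R lam" "x \<in> carrier R" "schur_finite R lam [2, 1] x"
  shows "lam (n + 3) x = lam (n + 2) x \<otimes>\<^bsub>R\<^esub> x"
proof -
  interpret lam_ring R lam by (rule assms(1))
  define p :: "nat list" where "p = 2 # replicate (Suc n) 1"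
  have "sorted_wrt (\<lambda>a b. b \<le> a) (replicate m (Suc 0))" for m by (induction m) auto
  then have "is_partition p" by (auto simp: is_partition_def p_def)
  moreover have "diagram_contains p [2, 1]"
    by (auto simp: diagram_contains_def p_def nth_Cons' less_Suc_eq)
  ultimately have s: "schur R lam p x = \<zero>\<^bsub>R\<^esub>" using assms(3) by (auto simp: schur_finite_def)
  have "{i. i < length p \<and> 0 < p ! i} = {..<n + 2}" by (auto simp: p_def nth_Cons')
  then have c0: "conj_part p 0 = n + 2" by (simp add: conj_part_def)
  have "{i. i < length p \<and> 1 < p ! i} = {0}" by (auto simp: p_def nth_Cons' split: if_splits)
  then have c1: "conj_part p (Suc 0) = 1" by (simp add: conj_part_def)
  have k: "conj_length p = 2" by (simp add: conj_length_def p_def)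
  have set2: "{..<2} = {0, 1 :: nat}" by auto
  have perms: "{s. s permutes {..<2 :: nat}} = {id, transpose 0 1}"
    by (auto simp: set2 permutes_doubleton_iff)
  have ne: "id \<noteq> transpose (0 :: nat) 1" by (metis id_apply transpose_apply_first zero_neq_one)
  have l: "lam i x \<in> carrier R" for i using assms(2) by (rule lam_closed)
  have lz: "nat (3 + int n) = n + 3" "nat (2 + int n) = n + 2" by linarith+
  have "schur R lam p x = lam (n + 2) x \<otimes>\<^bsub>R\<^esub> x \<oplus>\<^bsub>R\<^esub> \<ominus>\<^bsub>R\<^esub> lam (n + 3) x"
    unfolding schur_def Let_def k perms
    using ne l assms(2) lz
    by (simp add: set2 finsum_insert finprod_insert sign_swap_id c0 c1 lamz_def lam_0 lam_1[simplified]
        add.int_pow_neg add.int_pow_1 Pi_def)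
  then have "lam (n + 2) x \<otimes>\<^bsub>R\<^esub> x \<ominus>\<^bsub>R\<^esub> lam (n + 3) x = \<zero>\<^bsub>R\<^esub>" using s by (simp add: minus_eq)
  then show ?thesis using l assms(2) by (simp add: minus_eq_zero_iff)
qed

text \<open>The ring \<open>R[s]/(s^2 - c)\<close>, with the pair \<open>(a, b)\<close> for
  \<open>a + b s\<close>. Being free over \<open>R\<close> on 1 and \<open>s\<close>, it contains
  \<open>R\<close> whatever \<open>c\<close> is.\<close>

definition adjoin_sqrt :: "('a, 'm) ring_scheme \<Rightarrow> 'a \<Rightarrow> ('a \<times> 'a) ring" where
  "adjoin_sqrt R c = \<lparr>carrier = carrier R \<times> carrier R,
     monoid.mult = (\<lambda>(a, b) (a', b'). (a \<otimes>\<^bsub>R\<^esub> a' \<oplus>\<^bsub>R\<^esub> c \<otimes>\<^bsub>R\<^esub> (b \<otimes>\<^bsub>R\<^esub> b'), a \<otimes>\<^bsub>R\<^esub> b' \<oplus>\<^bsub>R\<^esub> b \<otimes>\<^bsub>R\<^esub> a')),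
     one = (\<one>\<^bsub>R\<^esub>, \<zero>\<^bsub>R\<^esub>), zero = (\<zero>\<^bsub>R\<^esub>, \<zero>\<^bsub>R\<^esub>), add = (\<lambda>(a, b) (a', b'). (a \<oplus>\<^bsub>R\<^esub> a', b \<oplus>\<^bsub>R\<^esub> b'))\<rparr>"

lemma (in cring) cring_adjoin_sqrt:
  assumes c: "c \<in> carrier R"
  shows "cring (adjoin_sqrt R c)"
proof (rule cringI)
  show "abelian_group (adjoin_sqrt R c)"
  proof (rule abelian_groupI)
    fix p assume "p \<in> carrier (adjoin_sqrt R c)"
    then obtain a b where p: "p = (a, b)" "a \<in> carrier R" "b \<in> carrier R" by (auto simp: adjoin_sqrt_def)
    show "\<exists>q\<in>carrier (adjoin_sqrt R c). q \<oplus>\<^bsub>adjoin_sqrt R c\<^esub> p = \<zero>\<^bsub>adjoin_sqrt R c\<^esub>"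
      by (rule bexI[of _ "(\<ominus> a, \<ominus> b)"]) (use p in \<open>auto simp: adjoin_sqrt_def l_neg\<close>)
  qed (auto simp: adjoin_sqrt_def a_assoc intro: a_comm)
  show "Group.comm_monoid (adjoin_sqrt R c)"
  proof (rule comm_monoidI)
    fix p q r assume "p \<in> carrier (adjoin_sqrt R c)" "q \<in> carrier (adjoin_sqrt R c)" "r \<in> carrier (adjoin_sqrt R c)"
    then obtain a b a' b' a'' b'' where p: "p = (a, b)" "a \<in> carrier R" "b \<in> carrier R"
      "q = (a', b')" "a' \<in> carrier R" "b' \<in> carrier R" "r = (a'', b'')" "a'' \<in> carrier R" "b'' \<in> carrier R"
      by (auto simp: adjoin_sqrt_def)
    have "(a \<otimes> a' \<oplus> c \<otimes> (b \<otimes> b')) \<otimes> a'' \<oplus> c \<otimes> ((a \<otimes> b' \<oplus> b \<otimes> a') \<otimes> b'')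
      = a \<otimes> (a' \<otimes> a'' \<oplus> c \<otimes> (b' \<otimes> b'')) \<oplus> c \<otimes> (b \<otimes> (a' \<otimes> b'' \<oplus> b' \<otimes> a''))"
      "(a \<otimes> a' \<oplus> c \<otimes> (b \<otimes> b')) \<otimes> b'' \<oplus> (a \<otimes> b' \<oplus> b \<otimes> a') \<otimes> a''
      = a \<otimes> (a' \<otimes> b'' \<oplus> b' \<otimes> a'') \<oplus> b \<otimes> (a' \<otimes> a'' \<oplus> c \<otimes> (b' \<otimes> b''))"
      using p c by algebra+
    then show "p \<otimes>\<^bsub>adjoin_sqrt R c\<^esub> q \<otimes>\<^bsub>adjoin_sqrt R c\<^esub> r = p \<otimes>\<^bsub>adjoin_sqrt R c\<^esub> (q \<otimes>\<^bsub>adjoin_sqrt R c\<^esub> r)"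
      by (simp add: p adjoin_sqrt_def)
    have "a \<otimes> a' \<oplus> c \<otimes> (b \<otimes> b') = a' \<otimes> a \<oplus> c \<otimes> (b' \<otimes> b)" "a \<otimes> b' \<oplus> b \<otimes> a' = a' \<otimes> b \<oplus> b' \<otimes> a"
      using p c by algebra+
    then show "p \<otimes>\<^bsub>adjoin_sqrt R c\<^esub> q = q \<otimes>\<^bsub>adjoin_sqrt R c\<^esub> p"
      by (simp add: p adjoin_sqrt_def)
  qed (use c in \<open>auto simp: adjoin_sqrt_def\<close>)
  fix p q r assume "p \<in> carrier (adjoin_sqrt R c)" "q \<in> carrier (adjoin_sqrt R c)" "r \<in> carrier (adjoin_sqrt R c)"
  then obtain a b a' b' a'' b'' where p: "p = (a, b)" "a \<in> carrier R" "b \<in> carrier R"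
    "q = (a', b')" "a' \<in> carrier R" "b' \<in> carrier R" "r = (a'', b'')" "a'' \<in> carrier R" "b'' \<in> carrier R"
    by (auto simp: adjoin_sqrt_def)
  have "(a \<oplus> a') \<otimes> a'' \<oplus> c \<otimes> ((b \<oplus> b') \<otimes> b'') = a \<otimes> a'' \<oplus> c \<otimes> (b \<otimes> b'') \<oplus> (a' \<otimes> a'' \<oplus> c \<otimes> (b' \<otimes> b''))"
    "(a \<oplus> a') \<otimes> b'' \<oplus> (b \<oplus> b') \<otimes> a'' = a \<otimes> b'' \<oplus> b \<otimes> a'' \<oplus> (a' \<otimes> b'' \<oplus> b' \<otimes> a'')"
    using p c by algebra+
  then show "(p \<oplus>\<^bsub>adjoin_sqrt R c\<^esub> q) \<otimes>\<^bsub>adjoin_sqrt R c\<^esub> r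
      = p \<otimes>\<^bsub>adjoin_sqrt R c\<^esub> r \<oplus>\<^bsub>adjoin_sqrt R c\<^esub> q \<otimes>\<^bsub>adjoin_sqrt R c\<^esub> r"
    by (simp add: p adjoin_sqrt_def)
qed

text \<open>Finite support, enumerated by \<open>prod_encode\<close>, lets one list carry the whole
  polynomial. Cosets can then be named by lists, which provides a type for the extension.\<close>

lemma UP_UP_coded:
  fixes R (structure)
  assumes "p \<in> carrier (UP (UP R))"
  shows "\<exists>xs. p = (\<lambda>i j. if prod_encode (i, j) < length xs then xs ! prod_encode (i, j) else \<zero>)"
proof -
  have p: "p i \<in> up R" for i using assms by (auto simp: UP_def up_def)
  obtain n where "bound (\<lambda>j. \<zero>) n p" using assms unfolding UP_def up_def by auto
  note n = bound.bound[OF this]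
  have "\<exists>m. \<forall>j>m. p i j = \<zero>" for i using p[of i] unfolding up_def by (auto dest: bound.bound)
  then obtain m where m: "\<And>i j. m i < j \<Longrightarrow> p i j = \<zero>" by metis
  define N where "N = Suc (Max (prod_encode ` (SIGMA i:{..n}. {..m i})))"
  have N: "p i j = \<zero>" if "N \<le> prod_encode (i, j)" for i j
  proof (rule ccontr)
    assume "p i j \<noteq> \<zero>"
    then have "i \<le> n" "j \<le> m i" using n[of i] m[of i j] by (auto simp: not_less[symmetric])
    then have "prod_encode (i, j) \<le> Max (prod_encode ` (SIGMA i:{..n}. {..m i}))" by (intro Max_ge) auto
    then show False using that by (simp add: N_def)
  qed
  show ?thesis
    by (rule exI[of _ "map (\<lambda>k. case prod_decode k of (i, j) \<Rightarrow> p i j) [0..<N]"]) (auto simp: fun_eq_iff N)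
qed

text \<open>Evaluating at the negative of \<open>x\<close> and at a square root of \<open>x\<^sup>2 - \<lambda>\<^sup>2(x)\<close>
  turns the total operation of \<open>x + \<ell> - z\<close> into \<open>(1 - (x\<^sup>2 - \<lambda>\<^sup>2(x)) t\<^sup>2) / (1 + z t) = 1 - z t\<close>.\<close>

lemma conv_line_schur:
  assumes "lam_ring R lam" "x \<in> carrier R" "schur_finite R lam [2, 1] x"
  shows "conv R (\<lambda>n. lam n x) (line R (\<ominus>\<^bsub>R\<^esub> x)) n
    = (if n = 0 then \<one>\<^bsub>R\<^esub> else if n = 2 then \<ominus>\<^bsub>R\<^esub> (x \<otimes>\<^bsub>R\<^esub> x \<ominus>\<^bsub>R\<^esub> lam 2 x) else \<zero>\<^bsub>R\<^esub>)"
proof -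
  interpret lam_ring R lam by (rule assms(1))
  have l: "lam i x \<in> carrier R" for i using assms(2) by (rule lam_closed)
  have s: "conv R (\<lambda>n. lam n x) (line R (\<ominus>\<^bsub>R\<^esub> x)) (Suc m) = lam (Suc m) x \<oplus>\<^bsub>R\<^esub> lam m x \<otimes>\<^bsub>R\<^esub> \<ominus>\<^bsub>R\<^esub> x" for m
    using conv_line[OF lam_seqs[OF assms(2)], of "\<ominus>\<^bsub>R\<^esub> x" m] assms(2) by simp
  consider "n = 0" | "n = Suc 0" | "n = Suc (Suc 0)" | m where "n = Suc (m + 2)"
    by (metis add_2_eq_Suc' not0_implies_Suc)
  then show ?thesis
  proof cases
    case 1
    then show ?thesis
      using seqsD(1)[OF conv_closed[OF lam_seqs[OF assms(2)] line_closed[of "\<ominus>\<^bsub>R\<^esub> x"]]] assms(2) by simp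
  next
    case 2
    then show ?thesis unfolding 2 s using assms(2) lam_1[OF assms(2)] by (simp add: lam_0 r_neg)
  next
    case 3
    have "lam 2 x \<oplus>\<^bsub>R\<^esub> x \<otimes>\<^bsub>R\<^esub> \<ominus>\<^bsub>R\<^esub> x = \<ominus>\<^bsub>R\<^esub> (x \<otimes>\<^bsub>R\<^esub> x \<ominus>\<^bsub>R\<^esub> lam 2 x)"
      using l[of 2] assms(2) by algebra
    then show ?thesis unfolding 3 s using lam_1[OF assms(2)] by (simp add: numeral_2_eq_2)
  next
    case 4
    then show ?thesis unfolding 4 s using schur_hook[OF assms, of m] l assms(2)
      by (simp add: r_minus r_neg numeral_3_eq_3)
  qed
qed

theorem theorem4:
  fixes R :: "('a, 'm) ring_scheme" and lam :: "nat \<Rightarrow> 'a \<Rightarrow> 'a" and x :: 'a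
  assumes "lambda_ring R lam"
    and "x \<in> carrier R"
    and "schur_finite R lam [2, 1] x"
  shows "\<exists>(R' :: 'a list ring) lam' f.
           lambda_ring R' lam' \<and> lambda_hom R lam R' lam' f \<and> inj_on f (carrier R) \<and>
           (\<exists>l1 l2 l3. line_element R' lam' l1 \<and> line_element R' lam' l2 \<and>
              line_element R' lam' l3 \<and> f x = l1 \<oplus>\<^bsub>R'\<^esub> l2 \<ominus>\<^bsub>R'\<^esub> l3)"
proof -
  \<comment> \<open>\<open>A\<close> is \<open>R[\<ell>]\<close> and \<open>B\<close> is
    \<open>A[z]\<close>.\<close>
  define A B lA lB where "A = UP R" and "B = UP A" and "lA = ulam R lam" and "lB = ulam A lA"
  have LR: "lam_ring R lam" using assms(1) by (simp add: lambda_ring_iff)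
  then interpret R: lam_ring R lam .
  have LA: "lam_ring A lA" unfolding A_def lA_def by (rule R.lam_ring_UP)
  then interpret A: lam_ring A lA .
  have LB: "lam_ring B lB" unfolding B_def lB_def by (rule A.lam_ring_UP)
  then interpret B: lam_ring B lB .
  define i where "i = (\<lambda>r. up_ring.monom B (up_ring.monom A r 0) 0)"
  define l z where "l = up_ring.monom B (up_ring.monom A \<one>\<^bsub>R\<^esub> 1) 0" and "z = up_ring.monom B \<one>\<^bsub>A\<^esub> 1"
  interpret UA: UP_cring R A by (unfold_locales) (simp add: A_def)
  interpret UB: UP_cring A B by (unfold_locales) (simp add: B_def)
  have hi: "i \<in> ring_hom R B"
    using ring_hom_trans[OF UA.const_ring_hom UB.const_ring_hom] by (simp add: i_def o_def)
  have lBconst: "lB n (up_ring.monom B p 0) = up_ring.monom B (lA n p) 0" if "p \<in> carrier A" for n p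
    using A.ulam_const[OF that] by (simp add: B_def lB_def)
  have lAconst: "lA n (up_ring.monom A r 0) = up_ring.monom A (lam n r) 0" if "r \<in> carrier R" for n r
    using R.ulam_const[OF that] by (simp add: A_def lA_def)
  have lBi: "lB n (i r) = i (lam n r)" if "r \<in> carrier R" for n r
    using that by (simp add: i_def lBconst lAconst)
  have c: "i r \<in> carrier B" if "r \<in> carrier R" for r using that by (simp add: i_def)
  have lc: "l \<in> carrier B" and zc: "z \<in> carrier B" by (simp_all add: l_def z_def)
  have lBz: "(\<lambda>n. lB n z) = line B z" using A.ulam_X by (simp add: B_def lB_def z_def)
  interpret CB: ring_hom_cring A B "\<lambda>p. up_ring.monom B p 0" by unfold_locales (rule UB.const_ring_hom)
  have lBl: "(\<lambda>n. lB n l) = line B l"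
  proof
    fix n
    have "lA n (up_ring.monom A \<one>\<^bsub>R\<^esub> 1) = line A (up_ring.monom A \<one>\<^bsub>R\<^esub> 1) n"
      using fun_cong[OF R.ulam_X, of n] by (simp only: A_def lA_def)
    moreover have "lB n l = up_ring.monom B (lA n (up_ring.monom A \<one>\<^bsub>R\<^esub> 1)) 0"
      unfolding l_def by (rule lBconst) simp
    ultimately have "lB n l = up_ring.monom B (line A (up_ring.monom A \<one>\<^bsub>R\<^esub> 1) n) 0" by simp
    then show "lB n l = line B l n" using CB.hom_one CB.hom_zero by (auto simp: line_def l_def)
  qed
  define W where "W = i x \<oplus>\<^bsub>B\<^esub> l \<ominus>\<^bsub>B\<^esub> z"
  have Wc: "W \<in> carrier B" using c[OF assms(2)] lc zc by (simp add: W_def)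
  \<comment> \<open>The equation is kept multiplied out, which avoids the inverse of the series of
    \<open>z\<close>.\<close>
  have Wz: "conv B (\<lambda>n. lB n W) (\<lambda>n. lB n z) = conv B (\<lambda>n. lB n (i x)) (\<lambda>n. lB n l)"
  proof -
    have "W \<oplus>\<^bsub>B\<^esub> z = i x \<oplus>\<^bsub>B\<^esub> l"
      using c[OF assms(2)] lc zc by (simp add: W_def B.minus_eq B.a_assoc B.l_neg)
    then show ?thesis using B.lam_add[OF Wc zc] B.lam_add[OF c[OF assms(2)] lc] by simp
  qed

  \<comment> \<open>This is \<open>c\<close> of the overview.\<close>
  define d where "d = x \<otimes>\<^bsub>R\<^esub> x \<ominus>\<^bsub>R\<^esub> lam 2 x"
  have dc: "d \<in> carrier R" using assms(2) R.lam_closed by (simp add: d_def)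
  \<comment> \<open>\<open>S\<close> carries no \<lambda>-structure: the map into it only has to
    kill the ideal and to be injective on \<open>R\<close>.\<close>
  define S where "S = adjoin_sqrt R d"
  interpret S: cring S unfolding S_def by (rule R.cring_adjoin_sqrt[OF dc])
  define j where "j = (\<lambda>r :: 'a. (r, \<zero>\<^bsub>R\<^esub>))"
  have hj: "j \<in> ring_hom R S"
    by (rule ring_hom_memI) (use dc in \<open>auto simp: j_def S_def adjoin_sqrt_def\<close>)
  interpret J: ring_hom_cring R S j by unfold_locales (rule hj)
  define u where "u = (\<zero>\<^bsub>R\<^esub>, \<one>\<^bsub>R\<^esub>)"
  have uc: "u \<in> carrier S" by (simp add: u_def S_def adjoin_sqrt_def)
  have uu: "u \<otimes>\<^bsub>S\<^esub> u = j d" using dc by (simp add: u_def S_def adjoin_sqrt_def j_def)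
  interpret EA: UP_pre_univ_prop R S j A by unfold_locales
  \<comment> \<open>First \<open>\<ell>\<close> is evaluated at \<open>-x\<close>; afterwards
    \<open>e\<close> evaluates \<open>z\<close> at the root \<open>u\<close>, using \<open>g\<close>
    on the coefficients.\<close>
  define g where "g = eval R S j (j (\<ominus>\<^bsub>R\<^esub> x))"
  have hg: "g \<in> ring_hom A S" unfolding g_def by (rule EA.eval_ring_hom) (use assms(2) in simp)
  interpret G: ring_hom_cring A S g by unfold_locales (rule hg)
  interpret EB: UP_pre_univ_prop A S g B by unfold_locales
  define e where "e = eval A S g u"
  have he: "e \<in> ring_hom B S" unfolding e_def by (rule EB.eval_ring_hom[OF uc])
  interpret E: ring_hom_cring B S e by unfold_locales (rule he)
  have ei: "e (i r) = j r" if "r \<in> carrier R" for r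
  proof -
    have "e (i r) = g (up_ring.monom A r 0)"
      unfolding e_def i_def by (rule EB.eval_const[OF uc]) (use that in simp)
    also have "\<dots> = j r" unfolding g_def by (rule EA.eval_const) (use that assms(2) in auto)
    finally show ?thesis .
  qed
  have el: "e l = j (\<ominus>\<^bsub>R\<^esub> x)"
  proof -
    have "e l = g (up_ring.monom A \<one>\<^bsub>R\<^esub> 1)"
      unfolding e_def l_def by (rule EB.eval_const[OF uc]) simp
    also have "\<dots> = j (\<ominus>\<^bsub>R\<^esub> x)"
      unfolding g_def by (rule EA.eval_monom1) (use assms(2) in auto)
    finally show ?thesis .
  qed
  have ez: "e z = u" using EB.eval_monom1[OF uc] by (simp add: e_def z_def)
  have eline: "(\<lambda>n. e (line B p n)) = line S (e p)" for p by (auto simp: line_def)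
  \<comment> \<open>Multiplied by \<open>1 + u t\<close>, both series become
    \<open>1 - d t^2\<close>: the left one by the hook relations, the right one because the square
    of \<open>u\<close> is \<open>d\<close>.\<close>
  have eW: "(\<lambda>n. e (lB n W)) = line S (\<ominus>\<^bsub>S\<^esub> u)"
  proof (rule S.seqs_cancel)
    show "conv S (\<lambda>n. e (lB n W)) (line S u) = conv S (line S (\<ominus>\<^bsub>S\<^esub> u)) (line S u)"
    proof
      fix n
      have "conv S (\<lambda>n. e (lB n W)) (line S u) n = conv S (\<lambda>n. e (lB n W)) (\<lambda>n. e (lB n z)) n"
        using eline[of z] fun_cong[OF lBz] by (simp add: ez)
      also have "\<dots> = e (conv B (\<lambda>n. lB n W) (\<lambda>n. lB n z) n)"
        using fun_cong[OF E.hom_conv[OF B.lam_seqs[OF Wc] B.lam_seqs[OF zc]], of n] by simp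
      also have "\<dots> = e (conv B (\<lambda>n. lB n (i x)) (\<lambda>n. lB n l) n)" by (simp only: Wz)
      also have "\<dots> = conv S (\<lambda>n. e (lB n (i x))) (\<lambda>n. e (lB n l)) n"
        using fun_cong[OF E.hom_conv[OF B.lam_seqs[OF c[OF assms(2)]] B.lam_seqs[OF lc]], of n] by simp
      also have "\<dots> = conv S (\<lambda>n. j (lam n x)) (\<lambda>n. j (line R (\<ominus>\<^bsub>R\<^esub> x) n)) n"
      proof (rule conv_cong)
        show "e (lB k (i x)) = j (lam k x)" for k using assms(2) by (simp add: lBi ei R.lam_closed)
        show "e (lB k l) = j (line R (\<ominus>\<^bsub>R\<^esub> x) k)" for k
          using fun_cong[OF eline[of l], of k] fun_cong[OF lBl, of k] by (simp add: el) (auto simp: line_def)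
      qed
      also have "\<dots> = j (conv R (\<lambda>n. lam n x) (line R (\<ominus>\<^bsub>R\<^esub> x)) n)"
        using fun_cong[OF J.hom_conv[OF R.lam_seqs[OF assms(2)] R.line_closed[of "\<ominus>\<^bsub>R\<^esub> x"]], of n] assms(2) by simp
      also have "\<dots> = conv S (line S (\<ominus>\<^bsub>S\<^esub> u)) (line S u) n"
      proof -
        have uS: "line S (\<ominus>\<^bsub>S\<^esub> u) \<in> carrier (seqs S)" using uc by (intro S.line_closed) simp
        consider "n = 0" | "n = Suc 0" | "n = Suc (Suc 0)" | m where "n = Suc (Suc (Suc m))"
          by (metis not0_implies_Suc)
        then show ?thesis
        proof cases
          case 1
          then show ?thesis using S.seqsD(1)[OF S.conv_closed[OF uS S.line_closed[OF uc]]]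
            by (simp add: conv_line_schur[OF LR assms(2,3)])
        next
          case 2
          then show ?thesis unfolding 2 S.conv_line[OF uS uc] using uc
            by (simp add: conv_line_schur[OF LR assms(2,3)]) (simp add: line_def S.l_neg)
        next
          case 3
          have "j (\<ominus>\<^bsub>R\<^esub> d) = \<ominus>\<^bsub>S\<^esub> u \<otimes>\<^bsub>S\<^esub> u" using dc uc by (simp add: S.l_minus uu)
          then show ?thesis unfolding 3 S.conv_line[OF uS uc] using uc
            by (simp add: conv_line_schur[OF LR assms(2,3)] d_def[symmetric]) (simp add: line_def)
        next
          case 4
          then show ?thesis unfolding 4 S.conv_line[OF uS uc] using uc
            by (simp add: conv_line_schur[OF LR assms(2,3)]) (simp add: line_def)
        qed
      qed
      finally show "conv S (\<lambda>n. e (lB n W)) (line S u) n = conv S (line S (\<ominus>\<^bsub>S\<^esub> u)) (line S u) n" .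
    qed
  qed (use uc E.hom_seqs[OF B.lam_seqs[OF Wc]] in \<open>auto intro: S.line_closed\<close>)

  define Y where "Y = {lB k W |k. 2 \<le> k}"
  define I where "I = genideal B Y"
  have Yc: "Y \<subseteq> carrier B" using Wc B.lam_closed by (auto simp: Y_def)
  interpret I: ideal I B unfolding I_def by (rule B.genideal_ideal[OF Yc])
  have YI: "Y \<subseteq> I" unfolding I_def by (rule B.genideal_self[OF Yc])
  \<comment> \<open>The series \<open>1 - u t\<close> has no terms of index 2 or more, so
    \<open>e\<close> kills the generators.\<close>
  have eI: "e p = \<zero>\<^bsub>S\<^esub>" if "p \<in> I" for p
  proof -
    have rh: "ring_hom_ring B S e" by (rule ring_hom_ringI2[OF B.ring_axioms S.ring_axioms he])
    have kernel: "a_kernel B S e = {p \<in> carrier B. e p = \<zero>\<^bsub>S\<^esub>}" by (rule a_kernel_def')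
    have "y \<in> a_kernel B S e" if y: "y \<in> Y" for y
    proof -
      obtain k where k: "y = lB k W" "2 \<le> k" using y unfolding Y_def by blast
      then have "e y = \<zero>\<^bsub>S\<^esub>" using fun_cong[OF eW, of k] by (simp add: line_def)
      moreover have "y \<in> carrier B" using y Yc by (rule subsetD[rotated])
      ultimately show ?thesis unfolding kernel by blast
    qed
    then have "Y \<subseteq> a_kernel B S e" by (rule subsetI)
    then have "I \<subseteq> a_kernel B S e"
      unfolding I_def by (intro B.genideal_minimal ring_hom_ring.kernel_is_ideal[OF rh])
    with that have "p \<in> a_kernel B S e" by (rule subsetD[rotated])
    then show ?thesis unfolding kernel by blast
  qed
  define Q where "Q = B Quot I"
  interpret Q: cring Q unfolding Q_def by (rule I.quotient_is_cring) (rule B.is_cring)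
  define q where "q = (\<lambda>p. I +>\<^bsub>B\<^esub> p)"
  have hq: "q \<in> ring_hom B Q" unfolding q_def Q_def by (rule I.rcos_ring_hom)
  interpret Qh: ring_hom_cring B Q q by unfold_locales (rule hq)
  have carQ: "carrier Q = q ` carrier B" by (auto simp: Q_def q_def FactRing_def A_RCOSETS_def')
  have sub: "subgroup I (add_monoid B)" by (rule I.a_subgroup)
  have q0: "p \<in> I" if "p \<in> carrier B" "q p = \<zero>\<^bsub>Q\<^esub>" for p
    using that B.a_coset_join1[OF _ that(1) sub] by (simp add: q_def Q_def FactRing_def)
  have qI: "q p = \<zero>\<^bsub>Q\<^esub>" if "p \<in> I" for p
    using B.a_coset_join2[OF _ sub that] that I.Icarr by (simp add: q_def Q_def FactRing_def)
  have qW: "(\<lambda>n. q (lB n W)) = line Q (q W)"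
  proof
    fix n :: nat
    consider "n = 0" | "n = 1" | "2 \<le> n" by linarith
    then show "q (lB n W) = line Q (q W) n"
    proof cases
      case 3
      then have "lB n W \<in> I" using YI by (auto simp: Y_def)
      then show ?thesis using 3 by (simp add: qI line_def)
    qed (use Wc B.lam_0[OF Wc] B.lam_1[OF Wc] in \<open>simp_all add: line_def\<close>)
  qed
  \<comment> \<open>In the quotient, \<open>W\<close> has the series of a line element;
    \<open>cmp_line\<close> settles the generators and \<open>lambda_ideal\<close> passes to the
    whole ideal.\<close>
  have lI: "(\<lambda>n. q (lB n p)) = delta Q" if "p \<in> I" for p
  proof -
    have "(\<lambda>m. q (lB m (lB k W))) = delta Q" if "2 \<le> k" for k
    proof -
      have "(\<lambda>m. q (lB m (lB k W))) = cmp Q (\<lambda>n. q (lB n W)) k"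
        using fun_cong[OF B.lam_lam[OF Wc, of k]] Qh.hom_cmp[OF B.lam_seqs[OF Wc], of k] by simp
      then show ?thesis unfolding qW using Q.cmp_line[OF Qh.hom_closed[OF Wc] that] by simp
    qed
    then have "Y \<subseteq> {p \<in> carrier B. (\<lambda>n. q (lB n p)) = delta Q}" using Yc by (auto simp: Y_def)
    then have "I \<subseteq> {p \<in> carrier B. (\<lambda>n. q (lB n p)) = delta Q}"
      unfolding I_def by (intro B.genideal_minimal B.lambda_ideal[OF Q.is_cring hq])
    then show ?thesis using that by blast
  qed

  define dec where "dec = (\<lambda>(xs :: 'a list) i j. if prod_encode (i, j) < length xs then xs ! prod_encode (i, j) else \<zero>\<^bsub>R\<^esub>)"
  \<comment> \<open>Any list that decodes to a member of the coset will do: decoding and applying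
    \<open>q\<close> recovers the coset, which makes \<open>enc\<close> injective.\<close>
  define enc where "enc = (\<lambda>C. SOME xs. dec xs \<in> C)"
  have enc: "q (dec (enc C)) = C" if "C \<in> carrier Q" for C
  proof -
    from \<open>C \<in> carrier Q\<close> carQ obtain p where p: "p \<in> carrier B" "C = q p" by auto
    obtain xs where "dec xs = p"
      using UP_UP_coded[of p R] p(1) by (auto simp: dec_def B_def A_def)
    moreover have "p \<in> C" using p I.a_rcos_self by (simp add: q_def)
    ultimately have "dec (enc C) \<in> C" unfolding enc_def by (metis (mono_tags, lifting) someI_ex)
    then show ?thesis using B.a_repr_independence[OF _ p(1) sub] p(2) by (simp add: q_def)
  qed
  have inj: "inj_on enc (carrier Q)" by (rule inj_on_inverseI[of _ "\<lambda>xs. q (dec xs)"]) (rule enc)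
  \<comment> \<open>The ring structure of the quotient is carried along \<open>enc\<close> to
    lists.\<close>
  define R' where "R' = image_ring enc Q"
  have iso: "enc \<in> ring_iso Q R'" unfolding R'_def by (rule inj_imp_image_ring_iso[OF inj])
  then have henc: "enc \<in> ring_hom Q R'" by (simp add: ring_iso_def)
  have carR': "carrier R' = enc ` carrier Q" by (simp add: R'_def image_ring_carrier)
  have zeroR': "\<zero>\<^bsub>R'\<^esub> = enc \<zero>\<^bsub>Q\<^esub>" by (simp add: R'_def image_ring_zero)
  have "cring R'" using Q.ring_iso_imp_img_cring[OF iso] by (simp add: zeroR'[symmetric])
  then interpret R': cring R' .
  interpret N: ring_hom_cring Q R' enc by unfold_locales (rule henc)
  define h where "h = (\<lambda>p. enc (q p))"
  have hh: "h \<in> ring_hom B R'" using ring_hom_trans[OF hq henc] by (simp add: h_def o_def)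
  interpret H: ring_hom_cring B R' h by unfold_locales (rule hh)
  have h0: "p \<in> I" if "p \<in> carrier B" "h p = \<zero>\<^bsub>R'\<^esub>" for p
  proof (rule q0[OF that(1)])
    have "enc (q p) = enc \<zero>\<^bsub>Q\<^esub>" using that(2) unfolding h_def zeroR' .
    from inj_onD[OF inj this] show "q p = \<zero>\<^bsub>Q\<^esub>" using that(1) by simp
  qed
  have "\<exists>lam'. lam_ring R' lam' \<and> (\<forall>p\<in>carrier B. \<forall>n. lam' n (h p) = h (lB n p))"
  proof (rule lam_ring_quotient[OF LB R'.is_cring hh])
    show "h ` carrier B = carrier R'" by (simp add: carR' carQ h_def image_image)
    show "(\<lambda>n. h (lB n p)) = delta R'" if "p \<in> carrier B" "h p = \<zero>\<^bsub>R'\<^esub>" for p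
      using fun_cong[OF lI[OF h0[OF that]]] N.hom_delta by (simp add: h_def)
  qed
  then obtain lam' where lam': "lam_ring R' lam'" "\<And>p n. p \<in> carrier B \<Longrightarrow> lam' n (h p) = h (lB n p)"
    by blast
  have line_elem: "line_element R' lam' (h p)" if "p \<in> carrier B" "\<And>n. 1 < n \<Longrightarrow> h (lB n p) = \<zero>\<^bsub>R'\<^esub>" for p
    using that by (simp add: line_element_def lam'(2))
  have "line_element R' lam' (h z)"
    by (rule line_elem[OF zc]) (use fun_cong[OF lBz] in \<open>simp add: line_def\<close>)
  moreover have "line_element R' lam' (h l)"
    by (rule line_elem[OF lc]) (use fun_cong[OF lBl] in \<open>simp add: line_def\<close>)
  moreover have "line_element R' lam' (h W)"
    by (rule line_elem[OF Wc]) (use fun_cong[OF qW] in \<open>simp add: h_def line_def\<close>)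
  moreover have "h (i x) = h z \<oplus>\<^bsub>R'\<^esub> h W \<ominus>\<^bsub>R'\<^esub> h l"
  proof -
    have "i x = z \<oplus>\<^bsub>B\<^esub> W \<ominus>\<^bsub>B\<^esub> l"
      using c[OF assms(2)] zc lc unfolding W_def by algebra
    then show ?thesis using zc Wc lc by (simp add: B.minus_eq R'.minus_eq)
  qed
  moreover have "lambda_hom R lam R' lam' (\<lambda>r. h (i r))"
    using ring_hom_trans[OF hi hh] by (auto simp: lambda_hom_def o_def lam'(2) c lBi)
  moreover have "inj_on (\<lambda>r. h (i r)) (carrier R)"
  proof (rule inj_onI)
    fix r s assume rs: "r \<in> carrier R" "s \<in> carrier R" "h (i r) = h (i s)"
    interpret Ih: ring_hom_cring R B i by unfold_locales (rule hi)
    have "h (i (r \<ominus>\<^bsub>R\<^esub> s)) = \<zero>\<^bsub>R'\<^esub>"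
      using rs c by (simp add: R.minus_eq R'.r_neg)
    then have "i (r \<ominus>\<^bsub>R\<^esub> s) \<in> I" by (rule h0[rotated]) (use rs c in simp)
    \<comment> \<open>\<open>e\<close> vanishes on the ideal, yet on the image of \<open>R\<close>
      it is the injection \<open>j\<close>.\<close>
    then have "j (r \<ominus>\<^bsub>R\<^esub> s) = \<zero>\<^bsub>S\<^esub>" using eI[of "i (r \<ominus>\<^bsub>R\<^esub> s)"] rs ei by simp
    then have "r \<ominus>\<^bsub>R\<^esub> s = \<zero>\<^bsub>R\<^esub>" by (simp add: j_def S_def adjoin_sqrt_def)
    then show "r = s" using rs by (simp add: R.minus_eq_zero_iff)
  qed
  ultimately show ?thesis using lam'(1) unfolding lambda_ring_iff by blast
qed

end
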